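(* Let $\mathsf{p}:P\to M$ be a sufficiently non-trivial principal fibre bundle with structure Lie group $G$ over a symplectic manifold $M$, and let $\star$ be a symplectic star product on $M$. Then there exists no deformation of $\mathsf{p}^*$ into a $G$-invariant bimodule structure with respect to $\star$; that is, there is no $(C^\infty(M)[[\lambda]],\star)$-bimodule structure on $C^\infty(P)[[\lambda]]$ with left and right multiplications of the form $$b\bullet_{\mathrm{l}}f=\mathsf{p}^*b\cdot f+\sum_{r=1}^\infty\lambda^r\ell_r(b,f),\qquad f\bullet a=f\cdot\mathsf{p}^*a+\sum_{r=1}^\infty\lambda^r\rho_r(f,a)$$ with bidifferential operators $\ell_r,\rho_r$, such that $\mathsf{r}_g^*(b\bullet_{\mathrm{l}}f)=b\bullet_{\mathrm{l}}\mathsf{r}_g^*f$ and $\mathsf{r}_g^*(f\bullet a)=(\mathsf{r}_g^*f)\bullet a$ for all $g\in G$, $a,b\in C^\infty(M)[[\lambda]]$, $f\in C^\infty(P)[[\lambda]]$.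
   Context: All functions are smooth and complex valued; $\lambda$ is a formal parameter; maps are extended $\mathbb{C}[[\lambda]]$-(multi)linearly. The principal right action is $\mathsf{r}_g:P\to P$, $g\in G$. Sufficiently non-trivial: there exists at least one non-trivial representation of $G$ on $\mathbb{C}$ such that the associated line bundle $L=P\times_G\mathbb{C}$ over $M$ has non-trivial first Chern class $c_1(L)\in H^2_{\mathrm{dR}}(M,\mathbb{C})$ (image in de Rham cohomology). Star product: an associative $\mathbb{C}[[\lambda]]$-bilinear product $a \star b = \sum_{r\ge0} \lambda^r C_r(a,b)$ on $C^\infty(M)[[\lambda]]$ with $C_0(a,b)=ab$, all $C_r$ bidifferential, $1\star a = a = a\star 1$. It is symplectic if the Poisson bracket $\{a,b\}=\frac1{\mathrm{i}}(C_1(a,b)-C_1(b,a))$ comes from a symplectic form on $M$. *)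

theory Defs
  imports
    "HOL-Analysis.Analysis"
    "HOL-Library.Function_Algebras"
    "HOL-Computational_Algebra.Formal_Power_Series"
begin

text \<open>
  Functions are added and multiplied pointwise (theory \<open>Function_Algebras\<close>); this is used for
  \<open>'m \<Rightarrow> complex\<close>, for operators on such functions, and for formal series with such coefficients.
\<close>

section \<open>Smooth manifolds\<close>

primrec Ck_on :: "nat \<Rightarrow> 'a::real_normed_vector set \<Rightarrow> ('a \<Rightarrow> 'b::real_normed_vector) \<Rightarrow> bool" where
  "Ck_on 0 S f \<longleftrightarrow> continuous_on S f"
| "Ck_on (Suc k) S f \<longleftrightarrow> (\<forall>x\<in>S. f differentiable (at x)) \<and>
     (\<forall>v. Ck_on k S (\<lambda>x. frechet_derivative f (at x) v))"

definition smooth_on :: "'a::real_normed_vector set \<Rightarrow> ('a \<Rightarrow> 'b::real_normed_vector) \<Rightarrow> bool" where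
  "smooth_on S f \<longleftrightarrow> (\<forall>k. Ck_on k S f)"

type_synonym ('m, 'e) atlas = "('m set \<times> ('m \<Rightarrow> 'e)) set"

definition chart :: "'m::topological_space set \<Rightarrow> ('m \<Rightarrow> 'e::real_normed_vector) \<Rightarrow> bool" where
  "chart U \<phi> \<longleftrightarrow> open U \<and> open (\<phi> ` U) \<and> homeomorphism U (\<phi> ` U) \<phi> (inv_into U \<phi>)"

text \<open>
  A manifold is a Hausdorff, second countable type with an atlas (not necessarily maximal).
  The sort \<open>{real_inner, heine_borel}\<close> of the model space describes exactly the finite-dimensional
  Euclidean spaces; unlike \<open>euclidean_space\<close> it admits dimension 0, so that for instance discrete
  groups count as Lie groups.
\<close>

definition smooth_manifold ::
  "('m::{t2_space, second_countable_topology}, 'e::{real_inner, heine_borel}) atlas \<Rightarrow> bool" where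
  "smooth_manifold A \<longleftrightarrow>
     (\<forall>(U, \<phi>)\<in>A. chart U \<phi>) \<and> (\<Union>(U, \<phi>)\<in>A. U) = UNIV \<and>
     (\<forall>(U, \<phi>)\<in>A. \<forall>(V, \<psi>)\<in>A. smooth_on (\<phi> ` (U \<inter> V)) (\<psi> \<circ> inv_into U \<phi>))"

definition smooth_map_on ::
  "('m::topological_space, 'e::real_normed_vector) atlas \<Rightarrow>
   ('n::topological_space, 'f::real_normed_vector) atlas \<Rightarrow> 'm set \<Rightarrow> ('m \<Rightarrow> 'n) \<Rightarrow> bool" where
  "smooth_map_on A B S f \<longleftrightarrow> continuous_on S f \<and>
     (\<forall>(U, \<phi>)\<in>A. \<forall>(V, \<psi>)\<in>B. smooth_on (\<phi> ` (U \<inter> S \<inter> f -` V)) (\<psi> \<circ> f \<circ> inv_into U \<phi>))"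

definition prod_atlas :: "('m, 'e) atlas \<Rightarrow> ('n, 'f) atlas \<Rightarrow> ('m \<times> 'n, 'e \<times> 'f) atlas" where
  "prod_atlas A B = {(U \<times> V, map_prod \<phi> \<psi>) | U \<phi> V \<psi>. (U, \<phi>) \<in> A \<and> (V, \<psi>) \<in> B}"

definition C_inf :: "('m, 'e::real_normed_vector) atlas \<Rightarrow> ('m \<Rightarrow> complex) set" where
  "C_inf A = {f. \<forall>(U, \<phi>)\<in>A. smooth_on (\<phi> ` U) (f \<circ> inv_into U \<phi>)}"


section \<open>Complex vector fields, differential forms, de Rham cohomology\<close>

text \<open>
  Complex vector fields are the \<open>\<complex>\<close>-linear derivations of the algebra of smooth complex functions.
  In order to make them unique as HOL functions they are set to 0 on non-smooth arguments.
\<close>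

type_synonym 'm vfield = "('m \<Rightarrow> complex) \<Rightarrow> ('m \<Rightarrow> complex)"

definition vector_fields :: "('m, 'e::real_normed_vector) atlas \<Rightarrow> 'm vfield set" where
  "vector_fields A = {X.
     (\<forall>f\<in>C_inf A. X f \<in> C_inf A) \<and>
     (\<forall>f\<in>C_inf A. \<forall>g\<in>C_inf A. X (f + g) = X f + X g) \<and>
     (\<forall>c. \<forall>f\<in>C_inf A. X ((\<lambda>_. c) * f) = (\<lambda>_. c) * X f) \<and>
     (\<forall>f\<in>C_inf A. \<forall>g\<in>C_inf A. X (f * g) = X f * g + f * X g) \<and>
     (\<forall>f. f \<notin> C_inf A \<longrightarrow> X f = 0)}"

definition vscale :: "('m \<Rightarrow> complex) \<Rightarrow> 'm vfield \<Rightarrow> 'm vfield" where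
  "vscale h X = (\<lambda>f. h * X f)"

definition lie_bracket :: "'m vfield \<Rightarrow> 'm vfield \<Rightarrow> 'm vfield" where
  "lie_bracket X Y = (\<lambda>f. X (Y f) - Y (X f))"

text \<open>
  Complex differential forms are the (alternating) \<open>C\<^sup>\<infinity>\<close>-multilinear maps on vector fields;
  their values outside the set of vector fields are irrelevant.
\<close>

type_synonym 'm form1 = "'m vfield \<Rightarrow> ('m \<Rightarrow> complex)"
type_synonym 'm form2 = "'m vfield \<Rightarrow> 'm vfield \<Rightarrow> ('m \<Rightarrow> complex)"

definition forms1 :: "('m, 'e::real_normed_vector) atlas \<Rightarrow> 'm form1 set" where
  "forms1 A = {\<theta>.
     (\<forall>X\<in>vector_fields A. \<theta> X \<in> C_inf A) \<and>
     (\<forall>X\<in>vector_fields A. \<forall>Y\<in>vector_fields A. \<theta> (X + Y) = \<theta> X + \<theta> Y) \<and>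
     (\<forall>h\<in>C_inf A. \<forall>X\<in>vector_fields A. \<theta> (vscale h X) = h * \<theta> X)}"

definition forms2 :: "('m, 'e::real_normed_vector) atlas \<Rightarrow> 'm form2 set" where
  "forms2 A = {\<alpha>. \<forall>X\<in>vector_fields A.
     \<alpha> X \<in> forms1 A \<and> (\<lambda>Y. \<alpha> Y X) \<in> forms1 A \<and> \<alpha> X X = 0}"

definition ext_d1 :: "'m form1 \<Rightarrow> 'm form2" where
  "ext_d1 \<theta> X Y = X (\<theta> Y) - Y (\<theta> X) - \<theta> (lie_bracket X Y)"

definition ext_d2 :: "'m form2 \<Rightarrow> 'm vfield \<Rightarrow> 'm vfield \<Rightarrow> 'm vfield \<Rightarrow> ('m \<Rightarrow> complex)" where
  "ext_d2 \<alpha> X Y Z = X (\<alpha> Y Z) - Y (\<alpha> X Z) + Z (\<alpha> X Y)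
     - \<alpha> (lie_bracket X Y) Z + \<alpha> (lie_bracket X Z) Y - \<alpha> (lie_bracket Y Z) X"

definition closed_forms2 :: "('m, 'e::real_normed_vector) atlas \<Rightarrow> 'm form2 set" where
  "closed_forms2 A = {\<alpha>\<in>forms2 A. \<forall>X\<in>vector_fields A. \<forall>Y\<in>vector_fields A. \<forall>Z\<in>vector_fields A.
     ext_d2 \<alpha> X Y Z = 0}"

definition cohomologous :: "('m, 'e::real_normed_vector) atlas \<Rightarrow> ('m form2 \<times> 'm form2) set" where
  "cohomologous A = {(\<alpha>, \<beta>). \<alpha> \<in> closed_forms2 A \<and> \<beta> \<in> closed_forms2 A \<and>
     (\<exists>\<theta>\<in>forms1 A. \<forall>X\<in>vector_fields A. \<forall>Y\<in>vector_fields A. \<alpha> X Y - \<beta> X Y = ext_d1 \<theta> X Y)}"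

text \<open>The elements of \<open>H\<^sup>2\<close> are the sets \<open>de_rham_class A \<alpha>\<close> with \<open>\<alpha>\<close> closed.\<close>

definition de_rham_class :: "('m, 'e::real_normed_vector) atlas \<Rightarrow> 'm form2 \<Rightarrow> 'm form2 set" where
  "de_rham_class A \<alpha> = cohomologous A `` {\<alpha>}"


section \<open>Symplectic forms\<close>

definition real_vector_fields :: "('m, 'e::real_normed_vector) atlas \<Rightarrow> 'm vfield set" where
  "real_vector_fields A = {X\<in>vector_fields A. \<forall>f\<in>C_inf A. range f \<subseteq> \<real> \<longrightarrow> range (X f) \<subseteq> \<real>}"

text \<open>Non-degeneracy is pointwise: \<open>\<forall>f\<in>C_inf A. X f m = 0\<close> says that \<open>X\<close> vanishes at \<open>m\<close>.\<close>

definition symplectic_form :: "('m, 'e::real_normed_vector) atlas \<Rightarrow> 'm form2 \<Rightarrow> bool" where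
  "symplectic_form A \<omega> \<longleftrightarrow> \<omega> \<in> closed_forms2 A \<and>
     (\<forall>X\<in>real_vector_fields A. \<forall>Y\<in>real_vector_fields A. range (\<omega> X Y) \<subseteq> \<real>) \<and>
     (\<forall>m. \<forall>X\<in>vector_fields A.
        (\<forall>Y\<in>vector_fields A. \<omega> X Y m = 0) \<longrightarrow> (\<forall>f\<in>C_inf A. X f m = 0))"

definition hamiltonian_vf ::
  "('m, 'e::real_normed_vector) atlas \<Rightarrow> 'm form2 \<Rightarrow> ('m \<Rightarrow> complex) \<Rightarrow> 'm vfield \<Rightarrow> bool" where
  "hamiltonian_vf A \<omega> a X \<longleftrightarrow> X \<in> vector_fields A \<and> (\<forall>Y\<in>vector_fields A. \<omega> X Y = Y a)"

text \<open>
  \<open>br\<close> is the Poisson bracket of \<open>\<omega>\<close>. For a symplectic \<open>\<omega>\<close> the Hamiltonian vector fields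
  exist and are unique.
\<close>

definition poisson_bracket_of ::
  "('m, 'e::real_normed_vector) atlas \<Rightarrow> 'm form2 \<Rightarrow>
   (('m \<Rightarrow> complex) \<Rightarrow> ('m \<Rightarrow> complex) \<Rightarrow> ('m \<Rightarrow> complex)) \<Rightarrow> bool" where
  "poisson_bracket_of A \<omega> br \<longleftrightarrow> (\<forall>a\<in>C_inf A. \<forall>b\<in>C_inf A.
     \<exists>X Y. hamiltonian_vf A \<omega> a X \<and> hamiltonian_vf A \<omega> b Y \<and> br a b = \<omega> X Y)"


section \<open>Bidifferential operators and formal series\<close>

primrec commutators ::
  "('n \<Rightarrow> 'm) \<Rightarrow> ('m \<Rightarrow> complex) list \<Rightarrow> (('m \<Rightarrow> complex) \<Rightarrow> ('n \<Rightarrow> complex)) \<Rightarrow>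
   ('m \<Rightarrow> complex) \<Rightarrow> ('n \<Rightarrow> complex)" where
  "commutators q [] D = D"
| "commutators q (h # hs) D = commutators q hs (\<lambda>f. D (h * f) - (h \<circ> q) * D f)"

text \<open>
  Bidifferential operators \<open>C\<^sup>\<infinity>(M\<^sub>1) \<times> C\<^sup>\<infinity>(M\<^sub>2) \<rightarrow> C\<^sup>\<infinity>(N)\<close> along smooth maps \<open>q1 : N \<rightarrow> M\<^sub>1\<close> and
  \<open>q2 : N \<rightarrow> M\<^sub>2\<close>, which turn \<open>C\<^sup>\<infinity>(N)\<close> into a module over \<open>C\<^sup>\<infinity>(M\<^sub>1)\<close> and \<open>C\<^sup>\<infinity>(M\<^sub>2)\<close>. Being
  differential is meant in Grothendieck's sense: in either argument, \<open>k + 1\<close> successive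
  commutators with multiplication operators vanish. As in the description by local coordinates
  the order only has to be locally bounded on \<open>N\<close>.
\<close>

definition bidifferential ::
  "('m1, 'e1::real_normed_vector) atlas \<Rightarrow> ('m2, 'e2::real_normed_vector) atlas \<Rightarrow>
   ('n::topological_space, 'f::real_normed_vector) atlas \<Rightarrow> ('n \<Rightarrow> 'm1) \<Rightarrow> ('n \<Rightarrow> 'm2) \<Rightarrow>
   (('m1 \<Rightarrow> complex) \<Rightarrow> ('m2 \<Rightarrow> complex) \<Rightarrow> ('n \<Rightarrow> complex)) \<Rightarrow> bool" where
  "bidifferential A1 A2 B q1 q2 D \<longleftrightarrow>
     (\<forall>a\<in>C_inf A1. \<forall>b\<in>C_inf A2. D a b \<in> C_inf B) \<and>
     (\<forall>a\<in>C_inf A1. \<forall>a'\<in>C_inf A1. \<forall>b\<in>C_inf A2. D (a + a') b = D a b + D a' b) \<and>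
     (\<forall>a\<in>C_inf A1. \<forall>b\<in>C_inf A2. \<forall>b'\<in>C_inf A2. D a (b + b') = D a b + D a b') \<and>
     (\<forall>c. \<forall>a\<in>C_inf A1. \<forall>b\<in>C_inf A2.
        D ((\<lambda>_. c) * a) b = (\<lambda>_. c) * D a b \<and> D a ((\<lambda>_. c) * b) = (\<lambda>_. c) * D a b) \<and>
     (\<forall>x. \<exists>W k. open W \<and> x \<in> W \<and> (\<forall>y\<in>W. \<forall>a\<in>C_inf A1. \<forall>b\<in>C_inf A2.
        (\<forall>hs. set hs \<subseteq> C_inf A1 \<and> length hs = Suc k \<longrightarrow>
           commutators q1 hs (\<lambda>u. D u b) a y = 0) \<and>
        (\<forall>hs. set hs \<subseteq> C_inf A2 \<and> length hs = Suc k \<longrightarrow>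
           commutators q2 hs (\<lambda>u. D a u) b y = 0)))"

definition formal_C_inf :: "('m, 'e::real_normed_vector) atlas \<Rightarrow> ('m \<Rightarrow> complex) fps set" where
  "formal_C_inf A = {a. \<forall>n. fps_nth a n \<in> C_inf A}"

text \<open>\<open>formal_ext B a b = (\<Sum>r. \<lambda>\<^sup>r B\<^sub>r(a, b))\<close>, with every \<open>B\<^sub>r\<close> extended \<open>\<complex>[[\<lambda>]]\<close>-bilinearly.\<close>

definition formal_ext ::
  "(nat \<Rightarrow> ('x \<Rightarrow> complex) \<Rightarrow> ('y \<Rightarrow> complex) \<Rightarrow> ('z \<Rightarrow> complex)) \<Rightarrow>
   ('x \<Rightarrow> complex) fps \<Rightarrow> ('y \<Rightarrow> complex) fps \<Rightarrow> ('z \<Rightarrow> complex) fps" where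
  "formal_ext B a b =
     Abs_fps (\<lambda>n. \<Sum>r\<le>n. \<Sum>i\<le>n - r. B r (fps_nth a i) (fps_nth b (n - r - i)))"

definition pullback :: "('x \<Rightarrow> 'y) \<Rightarrow> ('y \<Rightarrow> complex) fps \<Rightarrow> ('x \<Rightarrow> complex) fps" where
  "pullback q f = Abs_fps (\<lambda>n. fps_nth f n \<circ> q)"


section \<open>Star products\<close>

definition star_product ::
  "('m::topological_space, 'e::real_normed_vector) atlas \<Rightarrow>
   (nat \<Rightarrow> ('m \<Rightarrow> complex) \<Rightarrow> ('m \<Rightarrow> complex) \<Rightarrow> ('m \<Rightarrow> complex)) \<Rightarrow> bool" where
  "star_product A C \<longleftrightarrow>
     (\<forall>a\<in>C_inf A. \<forall>b\<in>C_inf A. C 0 a b = a * b) \<and>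
     (\<forall>r. bidifferential A A A id id (C r)) \<and>
     (\<forall>a\<in>formal_C_inf A. \<forall>b\<in>formal_C_inf A. \<forall>c\<in>formal_C_inf A.
        formal_ext C (formal_ext C a b) c = formal_ext C a (formal_ext C b c)) \<and>
     (\<forall>a\<in>formal_C_inf A. formal_ext C 1 a = a \<and> formal_ext C a 1 = a)"

definition symplectic_star_product ::
  "('m::topological_space, 'e::real_normed_vector) atlas \<Rightarrow>
   (nat \<Rightarrow> ('m \<Rightarrow> complex) \<Rightarrow> ('m \<Rightarrow> complex) \<Rightarrow> ('m \<Rightarrow> complex)) \<Rightarrow> bool" where
  "symplectic_star_product A C \<longleftrightarrow> star_product A C \<and>
     (\<exists>\<omega>. symplectic_form A \<omega> \<and>
        poisson_bracket_of A \<omega> (\<lambda>a b. (\<lambda>_. 1 / \<i>) * (C 1 a b - C 1 b a)))"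


section \<open>Principal bundles\<close>

definition lie_group ::
  "('g::{t2_space, second_countable_topology}, 'k::{real_inner, heine_borel}) atlas \<Rightarrow>
   ('g \<Rightarrow> 'g \<Rightarrow> 'g) \<Rightarrow> 'g \<Rightarrow> ('g \<Rightarrow> 'g) \<Rightarrow> bool" where
  "lie_group AG gmul e iv \<longleftrightarrow> smooth_manifold AG \<and> group gmul e iv \<and>
     smooth_map_on (prod_atlas AG AG) AG UNIV (\<lambda>(g, h). gmul g h) \<and>
     smooth_map_on AG AG UNIV iv"

text \<open>
  An equivariant diffeomorphism \<open>\<Phi>\<close> from \<open>p -` U\<close> onto \<open>U \<times> G\<close> over \<open>U\<close>, with inverse \<open>\<Psi>\<close>.
\<close>

definition local_trivialization ::
  "('m::topological_space, 'e::real_normed_vector) atlas \<Rightarrow>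
   ('p::topological_space, 'q::real_normed_vector) atlas \<Rightarrow>
   ('g::topological_space, 'k::real_normed_vector) atlas \<Rightarrow>
   ('g \<Rightarrow> 'g \<Rightarrow> 'g) \<Rightarrow> ('p \<Rightarrow> 'm) \<Rightarrow> ('p \<Rightarrow> 'g \<Rightarrow> 'p) \<Rightarrow>
   'm set \<Rightarrow> ('p \<Rightarrow> 'm \<times> 'g) \<Rightarrow> ('m \<times> 'g \<Rightarrow> 'p) \<Rightarrow> bool" where
  "local_trivialization AM AP AG gmul p act U \<Phi> \<Psi> \<longleftrightarrow>
     open U \<and>
     (\<forall>x\<in>p -` U. fst (\<Phi> x) = p x \<and> \<Psi> (\<Phi> x) = x) \<and>
     (\<forall>y\<in>U \<times> UNIV. p (\<Psi> y) = fst y \<and> \<Phi> (\<Psi> y) = y) \<and>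
     smooth_map_on AP (prod_atlas AM AG) (p -` U) \<Phi> \<and>
     smooth_map_on (prod_atlas AM AG) AP (U \<times> UNIV) \<Psi> \<and>
     (\<forall>x\<in>p -` U. \<forall>g. \<Phi> (act x g) = (p x, gmul (snd (\<Phi> x)) g))"

definition principal_bundle ::
  "('m::{t2_space, second_countable_topology}, 'e::{real_inner, heine_borel}) atlas \<Rightarrow>
   ('p::{t2_space, second_countable_topology}, 'q::{real_inner, heine_borel}) atlas \<Rightarrow>
   ('g::{t2_space, second_countable_topology}, 'k::{real_inner, heine_borel}) atlas \<Rightarrow>
   ('g \<Rightarrow> 'g \<Rightarrow> 'g) \<Rightarrow> 'g \<Rightarrow> ('g \<Rightarrow> 'g) \<Rightarrow> ('p \<Rightarrow> 'm) \<Rightarrow> ('p \<Rightarrow> 'g \<Rightarrow> 'p) \<Rightarrow> bool" where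
  "principal_bundle AM AP AG gmul e iv p act \<longleftrightarrow>
     smooth_manifold AM \<and> smooth_manifold AP \<and> lie_group AG gmul e iv \<and>
     smooth_map_on AP AM UNIV p \<and>
     smooth_map_on (prod_atlas AP AG) AP UNIV (\<lambda>(x, g). act x g) \<and>
     (\<forall>x. act x e = x) \<and> (\<forall>x g h. act (act x g) h = act x (gmul g h)) \<and>
     (\<forall>x g. p (act x g) = p x) \<and>
     (\<forall>m. \<exists>U \<Phi> \<Psi>. m \<in> U \<and> local_trivialization AM AP AG gmul p act U \<Phi> \<Psi>)"


section \<open>Associated line bundles and their first Chern class\<close>

text \<open>A representation on \<open>\<complex>\<close> is given by a smooth homomorphism into the non-zero complex numbers.\<close>

definition representation_on_C ::
  "('g, 'k::real_normed_vector) atlas \<Rightarrow> ('g \<Rightarrow> 'g \<Rightarrow> 'g) \<Rightarrow> 'g \<Rightarrow> ('g \<Rightarrow> complex) \<Rightarrow> bool" where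
  "representation_on_C AG gmul e \<kappa> \<longleftrightarrow> \<kappa> \<in> C_inf AG \<and> \<kappa> e = 1 \<and>
     (\<forall>g h. \<kappa> (gmul g h) = \<kappa> g * \<kappa> h)"

text \<open>
  The line bundle \<open>L = P \<times>\<^sub>G \<complex>\<close> consists of the classes \<open>[x, z]\<close> for the relation
  \<open>(act x g, z) \<sim> (x, \<kappa> g * z)\<close>. A smooth section of \<open>L\<close> is a map \<open>p x \<mapsto> [x, s x]\<close> for a unique
  smooth \<open>s\<close> on \<open>P\<close> with the equivariance property below, and is represented by this \<open>s\<close>;
  the \<open>C\<^sup>\<infinity>(M)\<close>-module structure is multiplication by \<open>h \<circ> p\<close>.
\<close>

definition line_bundle_sections ::
  "('p, 'q::real_normed_vector) atlas \<Rightarrow> ('p \<Rightarrow> 'g \<Rightarrow> 'p) \<Rightarrow> ('g \<Rightarrow> complex) \<Rightarrow>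
   ('p \<Rightarrow> complex) set" where
  "line_bundle_sections AP act \<kappa> = {s\<in>C_inf AP. \<forall>x g. s (act x g) = inverse (\<kappa> g) * s x}"

definition connection ::
  "('m, 'e::real_normed_vector) atlas \<Rightarrow> ('p, 'q::real_normed_vector) atlas \<Rightarrow> ('p \<Rightarrow> 'm) \<Rightarrow>
   ('p \<Rightarrow> 'g \<Rightarrow> 'p) \<Rightarrow> ('g \<Rightarrow> complex) \<Rightarrow>
   ('m vfield \<Rightarrow> ('p \<Rightarrow> complex) \<Rightarrow> ('p \<Rightarrow> complex)) \<Rightarrow> bool" where
  "connection AM AP p act \<kappa> nabla \<longleftrightarrow> (let \<Gamma> = line_bundle_sections AP act \<kappa> in
     (\<forall>X\<in>vector_fields AM. \<forall>s\<in>\<Gamma>. nabla X s \<in> \<Gamma>) \<and>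
     (\<forall>X\<in>vector_fields AM. \<forall>Y\<in>vector_fields AM. \<forall>s\<in>\<Gamma>. nabla (X + Y) s = nabla X s + nabla Y s) \<and>
     (\<forall>h\<in>C_inf AM. \<forall>X\<in>vector_fields AM. \<forall>s\<in>\<Gamma>. nabla (vscale h X) s = (h \<circ> p) * nabla X s) \<and>
     (\<forall>X\<in>vector_fields AM. \<forall>s\<in>\<Gamma>. \<forall>t\<in>\<Gamma>. nabla X (s + t) = nabla X s + nabla X t) \<and>
     (\<forall>h\<in>C_inf AM. \<forall>X\<in>vector_fields AM. \<forall>s\<in>\<Gamma>.
        nabla X ((h \<circ> p) * s) = (X h \<circ> p) * s + (h \<circ> p) * nabla X s))"

definition curvature_form ::
  "('m, 'e::real_normed_vector) atlas \<Rightarrow> ('p, 'q::real_normed_vector) atlas \<Rightarrow> ('p \<Rightarrow> 'm) \<Rightarrow>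
   ('p \<Rightarrow> 'g \<Rightarrow> 'p) \<Rightarrow> ('g \<Rightarrow> complex) \<Rightarrow>
   ('m vfield \<Rightarrow> ('p \<Rightarrow> complex) \<Rightarrow> ('p \<Rightarrow> complex)) \<Rightarrow> 'm form2 \<Rightarrow> bool" where
  "curvature_form AM AP p act \<kappa> nabla F \<longleftrightarrow> F \<in> forms2 AM \<and>
     (\<forall>X\<in>vector_fields AM. \<forall>Y\<in>vector_fields AM. \<forall>s\<in>line_bundle_sections AP act \<kappa>.
        nabla X (nabla Y s) - nabla Y (nabla X s) - nabla (lie_bracket X Y) s = (F X Y \<circ> p) * s)"

text \<open>
  Chern--Weil description of the image of the first Chern class in de Rham cohomology:
  the class of \<open>\<i> / (2 \<pi>)\<close> times the curvature form, which is the same for all connections on \<open>L\<close>.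
\<close>

definition chern_class1 ::
  "('m, 'e::real_normed_vector) atlas \<Rightarrow> ('p, 'q::real_normed_vector) atlas \<Rightarrow> ('p \<Rightarrow> 'm) \<Rightarrow>
   ('p \<Rightarrow> 'g \<Rightarrow> 'p) \<Rightarrow> ('g \<Rightarrow> complex) \<Rightarrow> 'm form2 set" where
  "chern_class1 AM AP p act \<kappa> = (THE c. \<exists>nabla F.
     connection AM AP p act \<kappa> nabla \<and> curvature_form AM AP p act \<kappa> nabla F \<and>
     c = de_rham_class AM (\<lambda>X Y. (\<lambda>_. \<i> / (2 * of_real pi)) * F X Y))"

definition sufficiently_nontrivial ::
  "('m, 'e::real_normed_vector) atlas \<Rightarrow> ('p, 'q::real_normed_vector) atlas \<Rightarrow>
   ('g, 'k::real_normed_vector) atlas \<Rightarrow> ('g \<Rightarrow> 'g \<Rightarrow> 'g) \<Rightarrow> 'g \<Rightarrow> ('p \<Rightarrow> 'm) \<Rightarrow>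
   ('p \<Rightarrow> 'g \<Rightarrow> 'p) \<Rightarrow> bool" where
  "sufficiently_nontrivial AM AP AG gmul e p act \<longleftrightarrow>
     (\<exists>\<kappa>. representation_on_C AG gmul e \<kappa> \<and> (\<exists>g. \<kappa> g \<noteq> 1) \<and>
        chern_class1 AM AP p act \<kappa> \<noteq> de_rham_class AM 0)"


section \<open>Invariant bimodule deformations\<close>

text \<open>
  The \<open>\<complex>[[\<lambda>]]\<close>-bilinearity of the two multiplications is part of \<open>formal_ext\<close> and
  \<open>bidifferential\<close>. The unit 1 need not be required to act as the identity: it acts
  idempotently, and invertibly by the form of the zeroth order.
\<close>

definition invariant_bimodule_deformation ::
  "('m::topological_space, 'e::real_normed_vector) atlas \<Rightarrow>
   ('p::topological_space, 'q::real_normed_vector) atlas \<Rightarrow> ('p \<Rightarrow> 'm) \<Rightarrow> ('p \<Rightarrow> 'g \<Rightarrow> 'p) \<Rightarrow>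
   (nat \<Rightarrow> ('m \<Rightarrow> complex) \<Rightarrow> ('m \<Rightarrow> complex) \<Rightarrow> ('m \<Rightarrow> complex)) \<Rightarrow>
   (nat \<Rightarrow> ('m \<Rightarrow> complex) \<Rightarrow> ('p \<Rightarrow> complex) \<Rightarrow> ('p \<Rightarrow> complex)) \<Rightarrow>
   (nat \<Rightarrow> ('p \<Rightarrow> complex) \<Rightarrow> ('m \<Rightarrow> complex) \<Rightarrow> ('p \<Rightarrow> complex)) \<Rightarrow> bool" where
  "invariant_bimodule_deformation AM AP p act C l \<rho> \<longleftrightarrow>
     (\<forall>b\<in>C_inf AM. \<forall>f\<in>C_inf AP. l 0 b f = (b \<circ> p) * f \<and> \<rho> 0 f b = f * (b \<circ> p)) \<and>
     (\<forall>r\<ge>1. bidifferential AM AP AP p id (l r) \<and> bidifferential AP AM AP id p (\<rho> r)) \<and>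
     (\<forall>a\<in>formal_C_inf AM. \<forall>b\<in>formal_C_inf AM. \<forall>f\<in>formal_C_inf AP.
        formal_ext l (formal_ext C a b) f = formal_ext l a (formal_ext l b f) \<and>
        formal_ext \<rho> f (formal_ext C a b) = formal_ext \<rho> (formal_ext \<rho> f a) b \<and>
        formal_ext \<rho> (formal_ext l a f) b = formal_ext l a (formal_ext \<rho> f b)) \<and>
     (\<forall>g. \<forall>a\<in>formal_C_inf AM. \<forall>f\<in>formal_C_inf AP.
        pullback (\<lambda>x. act x g) (formal_ext l a f) = formal_ext l a (pullback (\<lambda>x. act x g) f) \<and>
        pullback (\<lambda>x. act x g) (formal_ext \<rho> f a) = formal_ext \<rho> (pullback (\<lambda>x. act x g) f) a)"

end

theory Submission
  imports Defs
begin

text \<open>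
  Let \<open>D a s\<close> be the first order of \<open>a \<bullet> s - s \<bullet> a\<close>. By invariance it acts on the sections of every
  associated line bundle. The bimodule axioms in first order make \<open>D\<close> a derivation in \<open>a\<close> that satisfies
  a Leibniz rule in \<open>s\<close> along the Poisson bracket, and in second order they make \<open>a \<mapsto> D a\<close> compatible
  with the brackets. So \<open>nabla X\<^sub>a s = \<i> D a s\<close> for Hamiltonian vector fields \<open>X\<^sub>a\<close> extends to a
  connection that is flat on Hamiltonian vector fields, hence flat, because these generate all vector
  fields. By Chern--Weil the first Chern class of the line bundle vanishes.
\<close>

text \<open>The extension of the connection from Hamiltonian to all vector fields is the delicate
  step, because Hamiltonian fields satisfy relations over functions. A formula replaces the choice
  of generators: since \<open>D\<close> is a derivation in its first argument, contracting
  \<open>D a s\<close> with a section \<open>t\<close> of the dual bundle gives a vector field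
  \<open>V s t\<close> on the base, and \<i> \<omega>(X, V s t) makes sense for every
  \<open>X\<close>, is linear over functions in \<open>X\<close>, and equals \<i> t (D a s) for
  \<open>X = ham a\<close>. The factor \<i> is forced by the Leibniz rule: \<open>br\<close> is \<i>
  times the Poisson bracket, so \<i> times \<open>br a b\<close> is \<open>ham a b\<close>.

  Line bundles appear only as equivariant functions on the total space, without local frames.
  Sections and cosections that are non-zero at a given point replace frames: their products descend
  to the base, and one may divide by them near the point.

  \<open>chern_class1\<close> is a definite description. One flat connection is therefore not
  enough: every connection with a curvature form has to give the class 0, which is seen by comparing
  it with the flat one.\<close>

section \<open>Differential calculus of smooth functions\<close>

definition finite_frame :: "'a::real_inner set \<Rightarrow> bool" where
  "finite_frame B \<longleftrightarrow> finite B \<and> 0 \<notin> B \<and> (\<forall>x. (\<Sum>b\<in>B. (x \<bullet> b) *\<^sub>R b) = x)"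

text \<open>The closed unit ball is compact, hence covered by finitely many balls of radius 1/2. Two
  distinct orthonormal vectors have distance sqrt 2 > 1, so no such ball contains both, and the
  number of balls is a bound.\<close>

lemma heine_borel_orthonormal_bound:
  obtains N where "\<And>B :: 'a::{real_inner, heine_borel} set.
    \<lbrakk>finite B; \<forall>b\<in>B. norm b = 1; pairwise (\<lambda>x y. x \<bullet> y = 0) B\<rbrakk> \<Longrightarrow> card B \<le> N"
proof -
  have "compact (cball (0::'a) 1)"
    by (simp add: compact_eq_bounded_closed)
  then have "\<exists>k. finite k \<and> cball (0::'a) 1 \<subseteq> (\<Union>x\<in>k. ball x (1/2))"
    unfolding compact_eq_totally_bounded by (meson half_gt_zero zero_less_one)
  then obtain K where K: "finite K" "cball (0::'a) 1 \<subseteq> (\<Union>x\<in>K. ball x (1/2))"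
    by blast
  have "card B \<le> card K"
    if B: "finite B" "\<forall>b\<in>B. norm b = 1" "pairwise (\<lambda>x y. x \<bullet> y = 0) B" for B :: "'a set"
  proof -
    have "\<forall>b\<in>B. \<exists>x\<in>K. dist x b < 1/2"
      using B(2) K(2) by (force simp: subset_iff)
    then obtain f where f: "\<And>b. b \<in> B \<Longrightarrow> f b \<in> K \<and> dist (f b) b < 1/2"
      by metis
    have "inj_on f B"
    proof (rule inj_onI, rule ccontr)
      fix b c assume bc: "b \<in> B" "c \<in> B" "f b = f c" "b \<noteq> c"
      have "dist b c < 1"
        using f[OF bc(1)] f[OF bc(2)] bc(3) by (smt (verit) dist_commute dist_triangle field_sum_of_halves)
      moreover have "(norm (b - c))\<^sup>2 = 2"
      proof -
        have "b \<bullet> c = 0" "c \<bullet> b = 0" using B(3) bc by (auto simp: pairwise_def)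
        moreover have "b \<bullet> b = 1" "c \<bullet> c = 1" using B(2) bc by (auto simp: norm_eq_1)
        ultimately show ?thesis by (simp add: power2_norm_eq_inner inner_diff)
      qed
      ultimately show False
        by (smt (verit, best) dist_norm norm_ge_zero power2_less_imp_less power_one real_sqrt_less_iff one_power2 power_mono)
    qed
    then show ?thesis
      using f K(1) by (metis card_inj_on_le image_subset_iff)
  qed
  then show ?thesis using that by blast
qed

text \<open>Among the orthonormal families, whose size is bounded, take a largest one. The
  difference between a vector and its expansion is orthogonal to the family; if it were non-zero, it
  could be normalised and added.\<close>

lemma finite_frame_exists: "\<exists>B :: 'a::{real_inner, heine_borel} set. finite_frame B"
proof -
  define P where "P B \<longleftrightarrow> finite B \<and> (\<forall>b\<in>B. norm b = 1) \<and> pairwise (\<lambda>x y. x \<bullet> y = 0) B"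
    for B :: "'a set"
  obtain N where N: "\<And>B. P B \<Longrightarrow> card B \<le> N"
    using heine_borel_orthonormal_bound unfolding P_def by metis
  have "P {}" by (simp add: P_def)
  then obtain B where B: "P B" and max: "\<And>B'. P B' \<Longrightarrow> card B' \<le> card B"
    using ex_has_greatest_nat[of P "{}" card "Suc N"] N by (metis le_imp_less_Suc)
  have fin: "finite B" and ort: "\<And>b c. \<lbrakk>b \<in> B; c \<in> B; b \<noteq> c\<rbrakk> \<Longrightarrow> b \<bullet> c = 0"
    and one: "\<And>b. b \<in> B \<Longrightarrow> b \<bullet> b = 1"
    using B by (auto simp: P_def pairwise_def norm_eq_1)
  have "(\<Sum>b\<in>B. (x \<bullet> b) *\<^sub>R b) = x" for x
  proof (rule ccontr)
    assume ne: "(\<Sum>b\<in>B. (x \<bullet> b) *\<^sub>R b) \<noteq> x"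
    define y where "y = x - (\<Sum>b\<in>B. (x \<bullet> b) *\<^sub>R b)"
    have y: "y \<noteq> 0" using ne by (simp add: y_def)
    have orth: "y \<bullet> c = 0" if "c \<in> B" for c
    proof -
      have "(\<Sum>b\<in>B. (x \<bullet> b) * (b \<bullet> c)) = (\<Sum>b\<in>B. if b = c then x \<bullet> c else 0)"
        by (rule sum.cong) (use ort one that in auto)
      then show ?thesis
        using that fin by (simp add: y_def inner_diff_left inner_sum_left)
    qed
    define u where "u = y /\<^sub>R norm y"
    have u: "norm u = 1" "\<And>c. c \<in> B \<Longrightarrow> u \<bullet> c = 0" using y orth by (auto simp: u_def)
    then have "u \<notin> B" using one by fastforce
    moreover have "P (insert u B)"
      using B u by (auto simp: P_def pairwise_insert inner_commute)
    ultimately show False using max[of "insert u B"] fin by simp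
  qed
  moreover have "0 \<notin> B" using one by force
  ultimately have "finite_frame B" using fin by (simp add: finite_frame_def)
  then show ?thesis by blast
qed

text \<open>Stands in for an orthonormal basis: all coordinate computations rest on the expansion
  formula alone. In dimension 0 it is empty. As it never contains 0, the index 0 is free for the
  bump function in \<open>vector_fields_dual_basis\<close>.\<close>

definition frame :: "'a::{real_inner, heine_borel} set" where
  "frame = (SOME B. finite_frame B)"

lemma finite_frame: "finite_frame frame"
  unfolding frame_def by (rule someI_ex[OF finite_frame_exists])

lemma finite_frame_finite [simp]: "finite frame" and frame_nonzero: "0 \<notin> frame"
  and frame_expand: "(\<Sum>b\<in>frame. (x \<bullet> b) *\<^sub>R b) = x"
  using finite_frame by (auto simp: finite_frame_def)

lemma linear_frame_expand: "linear f \<Longrightarrow> f v = (\<Sum>b\<in>frame. (v \<bullet> b) *\<^sub>R f b)"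
  by (subst frame_expand[of v, symmetric]) (simp add: linear_sum linear_scale)

section \<open>Closure properties of C^k and smooth maps\<close>

lemma frechet_derivative_eqI: "(f has_derivative f') (at x) \<Longrightarrow> frechet_derivative f (at x) = f'"
  by (metis frechet_derivative_at)

lemma frechet_derivative_cong_open:
  assumes "open S" "x \<in> S" "\<And>x. x \<in> S \<Longrightarrow> f x = g x"
  shows "frechet_derivative f (at x) = frechet_derivative g (at x)"
proof -
  have "(f has_derivative F) (at x) \<longleftrightarrow> (g has_derivative F) (at x)" for F
    using assms by (metis has_derivative_transform_within_open)
  then show ?thesis by (simp add: frechet_derivative_def)
qed

lemma Ck_on_cong:
  assumes "open S" "\<And>x. x \<in> S \<Longrightarrow> f x = g x"
  shows "Ck_on k S f \<longleftrightarrow> Ck_on k S g"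
  using assms(2)
proof (induction k arbitrary: f g)
  case 0 then show ?case by (auto intro: continuous_on_cong[THEN iffD1])
next
  case (Suc k)
  have "f differentiable at x \<longleftrightarrow> g differentiable at x" if "x \<in> S" for x
    using Suc.prems assms(1) that unfolding differentiable_def
    by (metis has_derivative_transform_within_open)
  moreover have "Ck_on k S (\<lambda>x. frechet_derivative f (at x) v) \<longleftrightarrow>
      Ck_on k S (\<lambda>x. frechet_derivative g (at x) v)" for v
    by (rule Suc.IH) (use Suc.prems assms(1) in \<open>metis frechet_derivative_cong_open\<close>)
  ultimately show ?case by simp
qed

lemma Ck_on_subset: "Ck_on k S f \<Longrightarrow> T \<subseteq> S \<Longrightarrow> Ck_on k T f"
  by (induction k arbitrary: f) (auto intro: continuous_on_subset)

lemma Ck_on_local: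
  assumes "\<And>x. x \<in> S \<Longrightarrow> \<exists>T. open T \<and> x \<in> T \<and> Ck_on k T f"
  shows "Ck_on k S f"
  using assms
proof (induction k arbitrary: f)
  case 0
  then show ?case
    by (metis Ck_on.simps(1) continuous_at_imp_continuous_on continuous_on_eq_continuous_at)
next
  case (Suc k) then show ?case by (metis Ck_on.simps(2))
qed

lemma Ck_on_SucI:
  assumes "open S" "\<And>x. x \<in> S \<Longrightarrow> (f has_derivative f' x) (at x)" "\<And>v. Ck_on k S (\<lambda>x. f' x v)"
  shows "Ck_on (Suc k) S f"
proof -
  have "Ck_on k S (\<lambda>x. frechet_derivative f (at x) v)" for v
    using assms(3)[of v] Ck_on_cong[OF assms(1), of "\<lambda>x. frechet_derivative f (at x) v" "\<lambda>x. f' x v"]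
      assms(2) frechet_derivative_eqI by metis
  then show ?thesis using assms(2) by (auto simp: differentiable_def)
qed

lemma Ck_on_SucD:
  assumes "Ck_on (Suc k) S f"
  shows "x \<in> S \<Longrightarrow> (f has_derivative frechet_derivative f (at x)) (at x)"
    and "Ck_on k S (\<lambda>x. frechet_derivative f (at x) v)"
  using assms by (auto simp: frechet_derivative_works)

lemma Ck_on_lower: "Ck_on (Suc k) S f \<Longrightarrow> Ck_on k S f"
proof (induction k arbitrary: f)
  case 0
  then show ?case
    by (auto intro!: continuous_at_imp_continuous_on differentiable_imp_continuous_within)
next
  case (Suc k)
  have "Ck_on k S (\<lambda>x. frechet_derivative f (at x) v)" for v
    using Suc by (metis Ck_on_SucD(2))
  then show ?case using Suc.prems by simp
qed

lemma Ck_on_continuous: "Ck_on k S f \<Longrightarrow> continuous_on S f"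
  by (induction k) (use Ck_on_lower in auto)

lemma Ck_on_const [simp]: "Ck_on k S (\<lambda>_. c)"
proof (induction k arbitrary: c)
  case (Suc k)
  have "frechet_derivative (\<lambda>_. c) (at x) = (\<lambda>_. 0)" for x :: 'a
    by simp
  then show ?case using Suc by simp
qed simp

lemma Ck_on_bounded_linear:
  assumes "bounded_linear F" shows "Ck_on k S F"
proof (cases k)
  case 0 then show ?thesis using assms by (simp add: linear_continuous_on)
next
  case (Suc l)
  have "Ck_on (Suc l) UNIV F"
    by (rule Ck_on_SucI[where f' = "\<lambda>_. F"]) (use assms in \<open>auto intro: bounded_linear_imp_has_derivative\<close>)
  then show ?thesis using Suc Ck_on_subset by blast
qed

lemma Ck_on_add:
  assumes "open S" "Ck_on k S f" "Ck_on k S g" shows "Ck_on k S (\<lambda>x. f x + g x)"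
  using assms(2,3)
proof (induction k arbitrary: f g)
  case 0 then show ?case by (auto intro: continuous_intros)
next
  case (Suc k)
  show ?case
    by (rule Ck_on_SucI[OF assms(1), where
          f' = "\<lambda>x v. frechet_derivative f (at x) v + frechet_derivative g (at x) v"])
      (intro has_derivative_add Suc.IH Ck_on_SucD[OF Suc.prems(1)] Ck_on_SucD[OF Suc.prems(2)]; assumption)+
qed

text \<open>Stated for bounded bilinear maps so that products, scalar multiples and inner products
  are instances of one product rule.\<close>

lemma (in bounded_bilinear) Ck_on:
  assumes "open S" "Ck_on k S f" "Ck_on k S g" shows "Ck_on k S (\<lambda>x. prod (f x) (g x))"
  using assms(2,3)
proof (induction k arbitrary: f g)
  case 0 then show ?case by (auto intro: continuous_on)
next
  case (Suc k)
  have "Ck_on k S f" "Ck_on k S g" using Suc.prems Ck_on_lower by blast+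
  then show ?case
    by (intro Ck_on_SucI[OF assms(1), where
          f' = "\<lambda>x v. prod (f x) (frechet_derivative g (at x) v) +
                      prod (frechet_derivative f (at x) v) (g x)"])
      (intro FDERIV Ck_on_add[OF assms(1)] Suc.IH Ck_on_SucD[OF Suc.prems(1)] Ck_on_SucD[OF Suc.prems(2)]; assumption)+
qed

lemma Ck_on_sum:
  assumes "open S" "\<And>i. i \<in> I \<Longrightarrow> Ck_on k S (f i)" shows "Ck_on k S (\<lambda>x. \<Sum>i\<in>I. f i x)"
  using assms(2) by (induction I rule: infinite_finite_induct) (auto intro: Ck_on_add[OF assms(1)])

lemma Ck_on_inverse:
  fixes f :: "'a::real_normed_vector \<Rightarrow> 'b::real_normed_field"
  assumes "open S" "Ck_on k S f" "\<And>x. x \<in> S \<Longrightarrow> f x \<noteq> 0" shows "Ck_on k S (\<lambda>x. inverse (f x))"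
  using assms(2)
proof (induction k)
  case 0 then show ?case using assms(3) by (auto intro: continuous_intros)
next
  case (Suc k)
  have "Ck_on k S (\<lambda>x. inverse (f x))" using Suc Ck_on_lower by blast
  moreover have "Ck_on k S (\<lambda>x. - (inverse (f x) * g x * inverse (f x)))"
    if "Ck_on k S (\<lambda>x. inverse (f x))" "Ck_on k S g" for g
    using bounded_bilinear.Ck_on[OF bounded_bilinear_mult assms(1) Ck_on_const[of k S "-1"]
        bounded_bilinear.Ck_on[OF bounded_bilinear_mult assms(1)
        bounded_bilinear.Ck_on[OF bounded_bilinear_mult assms(1) that] that(1)]]
    by simp
  ultimately show ?case
    by (intro Ck_on_SucI[OF assms(1), where
          f' = "\<lambda>x v. - (inverse (f x) * frechet_derivative f (at x) v * inverse (f x))"])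
      (auto intro!: Deriv.has_derivative_inverse assms(3) Ck_on_SucD[OF Suc.prems] simp del: Ck_on.simps)
qed

text \<open>The chain rule yields \<open>g' (f x) (f' x v)\<close>, in which the direction varies
  with \<open>x\<close>, so the induction hypothesis does not apply to it. Expanding the direction
  along the frame leaves the scalars \<open>f' x v \<bullet> b\<close> and the functions
  \<open>g' (f x) b\<close> with fixed \<open>b\<close>, and to these it applies.\<close>

lemma Ck_on_compose:
  fixes f :: "'a::real_normed_vector \<Rightarrow> 'b::{real_inner, heine_borel}"
  assumes "open S" "open T" "Ck_on k S f" "Ck_on k T g" "f ` S \<subseteq> T"
  shows "Ck_on k S (\<lambda>x. g (f x))"
  using assms(3,4)
proof (induction k arbitrary: g)
  case 0
  then show ?case using assms(5) by (auto intro: continuous_on_compose2)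
next
  case (Suc k)
  have fk: "Ck_on k S f" using Suc.prems Ck_on_lower by blast
  define g' where "g' y = frechet_derivative g (at y)" for y
  define f' where "f' y = frechet_derivative f (at y)" for y
  have "(g has_derivative g' y) (at y)" if "y \<in> T" for y
    using Suc.prems(2) that Ck_on_SucD unfolding g'_def by blast
  moreover have f': "(f has_derivative f' y) (at y)" if "y \<in> S" for y
    using Suc.prems(1) that Ck_on_SucD unfolding f'_def by blast
  ultimately have der: "((\<lambda>x. g (f x)) has_derivative (\<lambda>v. g' (f x) (f' x v))) (at x)" if "x \<in> S" for x
    using that assms(5) has_derivative_compose[of f "f' x" x UNIV g "g' (f x)"] by blast
  have lin: "linear (g' (f x))" if "x \<in> S" for x
    using \<open>\<And>y. y \<in> T \<Longrightarrow> (g has_derivative g' y) (at y)\<close> that assms(5) has_derivative_linear by blast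
  have "((\<lambda>x. g (f x)) has_derivative (\<lambda>v. \<Sum>b\<in>frame. (f' x v \<bullet> b) *\<^sub>R g' (f x) b)) (at x)"
    if "x \<in> S" for x
  proof -
    have "(\<lambda>v. g' (f x) (f' x v)) = (\<lambda>v. \<Sum>b\<in>frame. (f' x v \<bullet> b) *\<^sub>R g' (f x) b)"
      by (rule ext, rule linear_frame_expand[OF lin[OF that]])
    then show ?thesis using der[OF that] by simp
  qed
  moreover have "Ck_on k S (\<lambda>x. \<Sum>b\<in>frame. (f' x v \<bullet> b) *\<^sub>R g' (f x) b)" for v
  proof (intro Ck_on_sum assms(1) bounded_bilinear.Ck_on[OF bounded_bilinear_scaleR])
    fix b
    show "Ck_on k S (\<lambda>x. f' x v \<bullet> b)"
      using bounded_bilinear.Ck_on[OF bounded_bilinear_inner assms(1) Ck_on_SucD(2)[OF Suc.prems(1)]]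
      unfolding f'_def by simp
    show "Ck_on k S (\<lambda>x. g' (f x) b)"
      using Suc.IH[OF fk] Suc.prems(2) Ck_on_SucD(2) unfolding g'_def by blast
  qed
  ultimately show ?case by (rule Ck_on_SucI[OF assms(1)])
qed

lemma smooth_on_cong:
  assumes "open S" "\<And>x. x \<in> S \<Longrightarrow> f x = g x"
  shows "smooth_on S f \<longleftrightarrow> smooth_on S g"
  using Ck_on_cong[OF assms] by (simp add: smooth_on_def)

lemma smooth_on_subset: "smooth_on S f \<Longrightarrow> T \<subseteq> S \<Longrightarrow> smooth_on T f"
  by (auto simp: smooth_on_def intro: Ck_on_subset)

lemma smooth_on_local:
  "(\<And>x. x \<in> S \<Longrightarrow> \<exists>T. open T \<and> x \<in> T \<and> smooth_on T f) \<Longrightarrow> smooth_on S f"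
  unfolding smooth_on_def by (meson Ck_on_local)

lemma smooth_on_continuous: "smooth_on S f \<Longrightarrow> continuous_on S f"
  by (auto simp: smooth_on_def intro: Ck_on_continuous)

lemma smooth_on_const [simp]: "smooth_on S (\<lambda>_. c)"
  by (simp add: smooth_on_def)

lemma smooth_on_bounded_linear: "bounded_linear F \<Longrightarrow> smooth_on S F"
  unfolding smooth_on_def by (blast intro: Ck_on_bounded_linear)

lemma smooth_on_add: "open S \<Longrightarrow> smooth_on S f \<Longrightarrow> smooth_on S g \<Longrightarrow> smooth_on S (\<lambda>x. f x + g x)"
  unfolding smooth_on_def by (blast intro: Ck_on_add)

lemma (in bounded_bilinear) smooth_on:
  "open S \<Longrightarrow> smooth_on S f \<Longrightarrow> smooth_on S g \<Longrightarrow> smooth_on S (\<lambda>x. prod (f x) (g x))"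
  unfolding smooth_on_def by (blast intro: Ck_on)

lemmas smooth_on_mult = bounded_bilinear.smooth_on[OF bounded_bilinear_mult]
lemmas smooth_on_scaleR = bounded_bilinear.smooth_on[OF bounded_bilinear_scaleR]
lemmas smooth_on_inner = bounded_bilinear.smooth_on[OF bounded_bilinear_inner]

lemma smooth_on_diff:
  "open S \<Longrightarrow> smooth_on S f \<Longrightarrow> smooth_on S g \<Longrightarrow> smooth_on S (\<lambda>x. f x - g x)"
  using smooth_on_add[of S f "\<lambda>x. (-1) *\<^sub>R g x"] smooth_on_scaleR[of S "\<lambda>_. -1" g] by simp

lemma smooth_on_sum:
  "open S \<Longrightarrow> (\<And>i. i \<in> I \<Longrightarrow> smooth_on S (f i)) \<Longrightarrow> smooth_on S (\<lambda>x. \<Sum>i\<in>I. f i x)"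
  unfolding smooth_on_def by (blast intro: Ck_on_sum)

lemma smooth_on_inverse:
  fixes f :: "'a::real_normed_vector \<Rightarrow> 'b::real_normed_field"
  shows "open S \<Longrightarrow> smooth_on S f \<Longrightarrow> (\<And>x. x \<in> S \<Longrightarrow> f x \<noteq> 0) \<Longrightarrow> smooth_on S (\<lambda>x. inverse (f x))"
  unfolding smooth_on_def by (blast intro: Ck_on_inverse)

lemma smooth_on_compose:
  fixes f :: "'a::real_normed_vector \<Rightarrow> 'b::{real_inner, heine_borel}"
  shows "open S \<Longrightarrow> open T \<Longrightarrow> smooth_on S f \<Longrightarrow> smooth_on T g \<Longrightarrow> f ` S \<subseteq> T \<Longrightarrow>
    smooth_on S (\<lambda>x. g (f x))"
  unfolding smooth_on_def using Ck_on_compose by blast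

lemma smooth_on_frechet_derivative:
  "smooth_on S f \<Longrightarrow> smooth_on S (\<lambda>x. frechet_derivative f (at x) v)"
  unfolding smooth_on_def by (metis Ck_on_SucD(2))

lemma smooth_on_has_derivative:
  "smooth_on S f \<Longrightarrow> x \<in> S \<Longrightarrow> (f has_derivative frechet_derivative f (at x)) (at x)"
  unfolding smooth_on_def by (metis Ck_on_SucD(1))

subsection \<open>Bump functions\<close>

text \<open>The index makes the family closed under differentiation up to linear combinations, so
  that smoothness of all members follows by one induction on the order of differentiability.\<close>

definition exp_inv :: "nat \<Rightarrow> real \<Rightarrow> real" where
  "exp_inv n x = (if x \<le> 0 then 0 else exp (- inverse x) * inverse x ^ n)"

lemma exp_inv_tendsto_0: "(exp_inv n \<longlongrightarrow> 0) (at 0)"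
proof -
  have "((\<lambda>x::real. x ^ n / exp x) \<longlongrightarrow> 0) at_top"
    by (rule tendsto_power_div_exp_0)
  then have "((\<lambda>x::real. inverse x ^ n / exp (inverse x)) \<longlongrightarrow> 0) (at_right 0)"
    using filterlim_compose filterlim_inverse_at_top_right by blast
  moreover have "\<forall>\<^sub>F x in at_right 0. inverse x ^ n / exp (inverse x) = exp_inv n x"
    by (auto simp: eventually_at_right_field exp_inv_def exp_minus field_simps intro!: exI[of _ 1])
  ultimately have "(exp_inv n \<longlongrightarrow> 0) (at_right 0)"
    using tendsto_cong by force
  moreover have "\<forall>\<^sub>F x in at_left 0. 0 = exp_inv n x"
    by (auto simp: eventually_at_left_field exp_inv_def intro!: exI[of _ "-1"])
  then have "(exp_inv n \<longlongrightarrow> 0) (at_left 0)"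
    using tendsto_cong by force
  ultimately show ?thesis by (simp add: filterlim_split_at)
qed

lemma exp_inv_has_field_derivative:
  "(exp_inv n has_field_derivative (exp_inv (n + 2) x - real n * exp_inv (n + 1) x)) (at x)"
proof -
  consider "x < 0" | "x = 0" | "x > 0" by linarith
  then show ?thesis
  proof cases
    case 1
    have "((\<lambda>_. 0) has_field_derivative 0) (at x)" by simp
    then have "(exp_inv n has_field_derivative 0) (at x)"
      by (rule has_field_derivative_transform_within_open[where S = "{..<0}"]) (use 1 in \<open>auto simp: exp_inv_def\<close>)
    then show ?thesis using 1 by (simp add: exp_inv_def)
  next
    case 2
    \<comment> \<open>The difference quotient at 0 is the next member of the family, whose limit is
      already known.\<close>
    have "\<forall>\<^sub>F h in at 0. exp_inv (n + 1) h = (exp_inv n (0 + h) - exp_inv n 0) / h"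
      by (auto simp: eventually_at_filter exp_inv_def field_simps)
    then have "((\<lambda>h. (exp_inv n (0 + h) - exp_inv n 0) / h) \<longlongrightarrow> 0) (at 0)"
      using exp_inv_tendsto_0[of "n + 1"] tendsto_cong by force
    then show ?thesis using 2 by (simp add: DERIV_def exp_inv_def)
  next
    case 3
    have i: "(inverse has_field_derivative - (inverse x)\<^sup>2) (at x)"
      using DERIV_inverse[of x UNIV] 3 by (simp add: numeral_2_eq_2)
    \<comment> \<open>For \<open>n = 0\<close> the truncated exponent \<open>n - 1\<close> is
      harmless, because both sides carry the factor 0.\<close>
    have "real n * (inverse x ^ (n - 1) * (inverse x)\<^sup>2) = real n * inverse x ^ (n + 1)"
      by (cases n) (simp_all add: power2_eq_square)
    then have eq: "exp (- inverse x) * (inverse x)\<^sup>2 * inverse x ^ n -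
        real n * (inverse x ^ (n - 1) * (inverse x)\<^sup>2) * exp (- inverse x) =
        exp_inv (n + 2) x - real n * exp_inv (n + 1) x"
      using 3 by (simp only: exp_inv_def) (simp add: power_add power2_eq_square)
    have "((\<lambda>x. exp (- inverse x) * inverse x ^ n) has_field_derivative
        exp_inv (n + 2) x - real n * exp_inv (n + 1) x) (at x)"
      unfolding eq[symmetric]
      using DERIV_mult[OF DERIV_fun_exp[OF DERIV_minus[OF i]] DERIV_power[OF i, of n]]
      by (simp add: algebra_simps)
    then show ?thesis
      by (rule has_field_derivative_transform_within_open[where S = "{0<..}"]) (use 3 in \<open>auto simp: exp_inv_def\<close>)
  qed
qed

lemma smooth_on_exp_inv: "smooth_on UNIV (exp_inv n)"
proof -
  have "Ck_on k UNIV (exp_inv n)" for k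
  proof (induction k arbitrary: n)
    case 0
    show ?case
      using DERIV_isCont[OF exp_inv_has_field_derivative] by (auto simp: continuous_on_eq_continuous_at)
  next
    case (Suc k)
    have "Ck_on k UNIV (\<lambda>x. (exp_inv (n + 2) x + (- real n) * exp_inv (n + 1) x) * v)" for v
      by (intro bounded_bilinear.Ck_on[OF bounded_bilinear_mult] Ck_on_add Suc Ck_on_const open_UNIV)
    then show ?case
      using exp_inv_has_field_derivative[of n]
      by (intro Ck_on_SucI[where f' = "\<lambda>x v. (exp_inv (n + 2) x - real n * exp_inv (n + 1) x) * v"])
        (auto simp: has_field_derivative_def)
  qed
  then show ?thesis by (simp add: smooth_on_def)
qed

lemma smooth_bump:
  fixes z :: "'e::real_inner"
  assumes "r > 0"
  obtains \<beta> :: "'e \<Rightarrow> complex" where "smooth_on UNIV \<beta>" "\<And>x. \<beta> x \<noteq> 0 \<longleftrightarrow> x \<in> ball z r"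
proof
  \<comment> \<open>The squared distance is smooth also at the centre, and \<open>?q\<close> is
    positive exactly on the ball.\<close>
  let ?q = "\<lambda>x. r\<^sup>2 - (x - z) \<bullet> (x - z)"
  let ?\<beta> = "\<lambda>x. complex_of_real (exp_inv 0 (?q x))"
  have "smooth_on UNIV (\<lambda>x. x - z)"
    by (rule smooth_on_diff) (auto intro: smooth_on_bounded_linear[OF bounded_linear_ident])
  then have "smooth_on UNIV ?q"
    by (intro smooth_on_diff[OF open_UNIV smooth_on_const] smooth_on_inner[OF open_UNIV])
  then have "smooth_on UNIV (\<lambda>x. exp_inv 0 (?q x))"
    by (rule smooth_on_compose[OF open_UNIV open_UNIV _ smooth_on_exp_inv]) simp
  then show "smooth_on UNIV ?\<beta>"
    by (rule smooth_on_compose[OF open_UNIV open_UNIV])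
      (auto intro: smooth_on_bounded_linear bounded_linear_of_real)
  show "?\<beta> x \<noteq> 0 \<longleftrightarrow> x \<in> ball z r" for x
  proof -
    have "?\<beta> x \<noteq> 0 \<longleftrightarrow> (norm (x - z))\<^sup>2 < r\<^sup>2"
      by (simp add: exp_inv_def power2_norm_eq_inner)
    also have "\<dots> \<longleftrightarrow> norm (x - z) < r"
      using assms by (meson norm_ge_zero less_imp_le pos2 power2_less_imp_less power_strict_mono)
    finally show ?thesis by (simp add: dist_norm norm_minus_commute)
  qed
qed

subsection \<open>Hadamard's lemma\<close>

text \<open>Caratheodory's form of differentiability: coefficients \<open>K b\<close> that are
  continuous at 0 leave an error of size o(|h|). This turns differentiation under an integral into a
  question of continuity of a parameter integral.\<close>

lemma has_derivative_frameI:
  fixes f :: "'e::{real_inner, heine_borel} \<Rightarrow> 'b::real_normed_vector"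
  assumes "open S" "z \<in> S"
    and eq: "\<And>h. z + h \<in> S \<Longrightarrow> f (z + h) - f z = (\<Sum>b\<in>frame. (h \<bullet> b) *\<^sub>R K b h)"
    and K: "\<And>b. b \<in> frame \<Longrightarrow> isCont (K b) 0"
  shows "(f has_derivative (\<lambda>h. \<Sum>b\<in>frame. (h \<bullet> b) *\<^sub>R K b 0)) (at z)"
  unfolding has_derivative_at
proof
  let ?D = "\<lambda>h. \<Sum>b\<in>frame. (h \<bullet> b) *\<^sub>R K b 0"
  show "bounded_linear ?D"
    by (intro bounded_linear_sum bounded_linear_compose[OF bounded_linear_scaleR_left]
        bounded_linear_inner_left)
  have "\<forall>\<^sub>F h in at 0. z + h \<in> S"
  proof -
    have "((\<lambda>h. z + h) \<longlongrightarrow> z + 0) (at 0)" by (intro tendsto_intros)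
    then show ?thesis using assms(1,2) by (metis add.right_neutral topological_tendstoD)
  qed
  then have "\<forall>\<^sub>F h in at 0. norm (norm (f (z + h) - f z - ?D h) / norm h)
      \<le> (\<Sum>b\<in>frame. norm b * norm (K b h - K b 0))"
  proof eventually_elim
    case (elim h)
    have "f (z + h) - f z - ?D h = (\<Sum>b\<in>frame. (h \<bullet> b) *\<^sub>R (K b h - K b 0))"
      by (simp add: eq[OF elim] scaleR_diff_right sum_subtractf)
    also have "norm \<dots> \<le> (\<Sum>b\<in>frame. (norm h * norm b) * norm (K b h - K b 0))"
      by (rule sum_norm_le) (simp add: mult_right_mono Cauchy_Schwarz_ineq2)
    also have "\<dots> = norm h * (\<Sum>b\<in>frame. norm b * norm (K b h - K b 0))"
      by (simp add: sum_distrib_left mult.assoc)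
    finally show ?case
      by (cases "h = 0") (simp_all add: divide_le_eq mult.commute sum_nonneg)
  qed
  moreover have "((\<lambda>h. \<Sum>b\<in>frame. norm b * norm (K b h - K b 0)) \<longlongrightarrow>
      (\<Sum>b\<in>frame. norm b * norm (K b 0 - K b 0))) (at 0)"
    using K by (intro tendsto_intros) (auto simp: isCont_def)
  ultimately show "(\<lambda>h. norm (f (z + h) - f z - ?D h) / norm h) \<midarrow>0\<rightarrow> 0"
    by (simp add: Lim_null_comparison)
qed

text \<open>The fundamental theorem of calculus along the segment from \<open>w\<close> to
  \<open>w + k\<close>. The frame expansion of the direction \<open>k\<close> moves it out of the
  integral.\<close>

lemma segment_derivative_integral:
  fixes H :: "'e::{real_inner, heine_borel} \<Rightarrow> complex"
  assumes "open S" "convex S" "smooth_on S H" "w \<in> S" "w + k \<in> S"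
  shows "H (w + k) - H w =
    (\<Sum>b\<in>frame. (k \<bullet> b) *\<^sub>R integral {0..1} (\<lambda>s. frechet_derivative H (at (w + s *\<^sub>R k)) b))"
proof -
  define D where "D b x = frechet_derivative H (at x) b" for b x
  have der: "(H has_derivative (\<lambda>b. D b x)) (at x)" if "x \<in> S" for x
    using smooth_on_has_derivative[OF assms(3) that] by (simp add: D_def)
  have cD: "continuous_on S (D b)" for b
    using smooth_on_frechet_derivative[OF assms(3)] smooth_on_continuous unfolding D_def by blast
  have inS: "w + s *\<^sub>R k \<in> S" if "s \<in> {0..1}" for s
    using convexD_alt[OF assms(2,4,5), of s] that by (simp add: algebra_simps)
  have "((\<lambda>s. H (w + s *\<^sub>R k)) has_vector_derivative D k (w + s *\<^sub>R k)) (at s within {0..1})"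
    if "s \<in> {0..1}" for s
  proof -
    have "((\<lambda>s. w + s *\<^sub>R k) has_derivative (\<lambda>t. t *\<^sub>R k)) (at s within {0..1})"
      by (auto intro!: derivative_eq_intros)
    then have "((\<lambda>s. H (w + s *\<^sub>R k)) has_derivative (\<lambda>t. D (t *\<^sub>R k) (w + s *\<^sub>R k))) (at s within {0..1})"
      using has_derivative_compose der[OF inS[OF that]] by blast
    moreover have "D (t *\<^sub>R k) (w + s *\<^sub>R k) = t *\<^sub>R D k (w + s *\<^sub>R k)" for t
      using linear_scale[OF has_derivative_linear[OF der[OF inS[OF that]]]] by blast
    ultimately show ?thesis by (simp add: has_vector_derivative_def)
  qed
  then have "((\<lambda>s. D k (w + s *\<^sub>R k)) has_integral H (w + 1 *\<^sub>R k) - H (w + 0 *\<^sub>R k)) {0..1}"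
    by (intro fundamental_theorem_of_calculus) auto
  then have "H (w + k) - H w = integral {0..1} (\<lambda>s. D k (w + s *\<^sub>R k))"
    by (simp add: integral_unique)
  also have "\<dots> = integral {0..1} (\<lambda>s. \<Sum>b\<in>frame. (k \<bullet> b) *\<^sub>R D b (w + s *\<^sub>R k))"
    by (rule integral_cong, rule linear_frame_expand, rule has_derivative_linear[OF der[OF inS]])
  also have "\<dots> = (\<Sum>b\<in>frame. integral {0..1} (\<lambda>s. (k \<bullet> b) *\<^sub>R D b (w + s *\<^sub>R k)))"
  proof (rule integral_sum)
    show "(\<lambda>s. (k \<bullet> b) *\<^sub>R D b (w + s *\<^sub>R k)) integrable_on {0..1}" for b
      by (intro integrable_continuous_interval continuous_intros continuous_on_compose2[OF cD])
        (use inS in auto)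
  qed simp
  finally show ?thesis by (simp add: D_def)
qed

text \<open>Differentiating in \<open>z\<close> brings out one factor \<open>t\<close> by the chain
  rule; the weight \<open>t ^ n\<close> keeps the family closed under derivatives. For each
  \<open>t\<close> the increment of the integrand is expressed by
  \<open>segment_derivative_integral\<close> through the averages \<open>J b h t\<close>.
  Integrating over \<open>t\<close> gives coefficients \<open>K b h\<close> that are continuous in
  \<open>h\<close>, so \<open>has_derivative_frameI\<close> applies.\<close>

lemma segment_integral_has_derivative:
  fixes H :: "'e::{real_inner, heine_borel} \<Rightarrow> complex"
  assumes S: "open S" "convex S" and H: "smooth_on S H" and y: "y \<in> S" and z: "z \<in> S"
  shows "((\<lambda>z. integral {0..1} (\<lambda>t. t ^ n *\<^sub>R H (y + t *\<^sub>R (z - y)))) has_derivative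
    (\<lambda>v. \<Sum>b\<in>frame. (v \<bullet> b) *\<^sub>R
      integral {0..1} (\<lambda>t. t ^ Suc n *\<^sub>R frechet_derivative H (at (y + t *\<^sub>R (z - y))) b))) (at z)"
proof -
  define D where "D b x = frechet_derivative H (at x) b" for b x
  have cD: "continuous_on S (D b)" for b
    using smooth_on_frechet_derivative[OF H] smooth_on_continuous unfolding D_def by blast
  have cH: "continuous_on S H" using H smooth_on_continuous by blast
  obtain \<delta> where \<delta>: "\<delta> > 0" "ball z \<delta> \<subseteq> S" using S(1) z openE by blast
  have inS: "y + t *\<^sub>R (x - y) \<in> S" if "x \<in> S" "t \<in> {0..1}" for x t
    using convexD_alt[OF S(2) y that(1), of t] that(2) by (simp add: algebra_simps)
  \<comment> \<open>The point is \<open>y + t *\<^sub>R ((z + s *\<^sub>R h) - y)\<close>, and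
    \<open>z + s *\<^sub>R h\<close> still lies in the ball around \<open>z\<close>.\<close>
  have inS': "y + t *\<^sub>R (z - y) + s *\<^sub>R (t *\<^sub>R h) \<in> S"
    if "h \<in> ball 0 \<delta>" "t \<in> {0..1}" "s \<in> {0..1}" for h t s
  proof -
    have "norm (s *\<^sub>R h) < \<delta>"
      using that mult_left_le_one_le[of "norm h" "\<bar>s\<bar>"] by (simp add: dist_norm)
    then have "z + s *\<^sub>R h \<in> S" using \<delta>(2) by (auto simp: dist_norm)
    from inS[OF this that(2)] show ?thesis by (simp add: algebra_simps)
  qed
  define J where "J b h t = integral {0..1} (\<lambda>s. D b (y + t *\<^sub>R (z - y) + s *\<^sub>R (t *\<^sub>R h)))"
    for b h and t :: real
  define K where "K b h = integral {0..1} (\<lambda>t. t ^ Suc n *\<^sub>R J b h t)" for b h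
  have cJ: "continuous_on (ball 0 \<delta> \<times> {0..1}) (\<lambda>(h, t). J b h t)" for b
  proof -
    have "continuous_on ((ball 0 \<delta> \<times> {0..1}) \<times> cbox 0 1)
        (\<lambda>(u, s). D b (y + snd u *\<^sub>R (z - y) + s *\<^sub>R (snd u *\<^sub>R fst u)))"
      unfolding case_prod_beta
      by (intro continuous_intros continuous_on_compose2[OF cD]) (use inS' in auto)
    then show ?thesis
      using integral_continuous_on_param unfolding J_def case_prod_beta interval_cbox by fastforce
  qed
  have cK: "continuous_on (ball 0 \<delta>) (K b)" for b
  proof -
    have "continuous_on (ball 0 \<delta> \<times> cbox 0 1) (\<lambda>(h, t). t ^ Suc n *\<^sub>R J b h t)"
      using cJ[of b] unfolding case_prod_beta interval_cbox by (intro continuous_intros)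
    then show ?thesis
      using integral_continuous_on_param unfolding K_def interval_cbox by fastforce
  qed
  have iH: "(\<lambda>t. t ^ n *\<^sub>R H (y + t *\<^sub>R (x - y))) integrable_on {0..1}" if "x \<in> S" for x
    by (intro integrable_continuous_interval continuous_intros continuous_on_compose2[OF cH])
      (use inS that in auto)
  have iJ: "(\<lambda>t. t ^ Suc n *\<^sub>R J b h t) integrable_on {0..1}" if "h \<in> ball 0 \<delta>" for b h
  proof (intro integrable_continuous_interval continuous_intros)
    show "continuous_on {0..1} (J b h)"
      using continuous_on_compose2[OF cJ[of b], of "{0..1}" "\<lambda>t. (h, t)"] that
      by (auto simp: image_subset_iff continuous_on_Pair)
  qed
  let ?G = "\<lambda>z. integral {0..1} (\<lambda>t. t ^ n *\<^sub>R H (y + t *\<^sub>R (z - y)))"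
  have "(?G has_derivative (\<lambda>h. \<Sum>b\<in>frame. (h \<bullet> b) *\<^sub>R K b 0)) (at z)"
  proof (rule has_derivative_frameI[where S = "ball z \<delta>"])
    show "z \<in> ball z \<delta>" using \<delta> by simp
    show "isCont (K b) 0" for b
      using cK[of b] \<delta>(1) by (simp add: continuous_on_eq_continuous_at)
    fix h assume "z + h \<in> ball z \<delta>"
    then have h: "h \<in> ball 0 \<delta>" and zh: "z + h \<in> S" using \<delta>(2) by (auto simp: dist_norm)
    have eq: "t ^ n *\<^sub>R H (y + t *\<^sub>R (z + h - y)) - t ^ n *\<^sub>R H (y + t *\<^sub>R (z - y)) =
        (\<Sum>b\<in>frame. (h \<bullet> b) *\<^sub>R (t ^ Suc n *\<^sub>R J b h t))" if t: "t \<in> {0..1}" for t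
    proof -
      have "H (y + t *\<^sub>R (z - y) + t *\<^sub>R h) - H (y + t *\<^sub>R (z - y)) =
          (\<Sum>b\<in>frame. ((t *\<^sub>R h) \<bullet> b) *\<^sub>R J b h t)"
        unfolding J_def D_def
        by (rule segment_derivative_integral[OF S H]) (use inS[OF z t] inS'[OF h t, of 1] in auto)
      then have "t ^ n *\<^sub>R (H (y + t *\<^sub>R (z + h - y)) - H (y + t *\<^sub>R (z - y))) =
          t ^ n *\<^sub>R (\<Sum>b\<in>frame. ((t *\<^sub>R h) \<bullet> b) *\<^sub>R J b h t)"
        by (simp add: algebra_simps)
      then show ?thesis
        by (simp add: scaleR_diff_right scaleR_sum_right mult_ac)
    qed
    have "?G (z + h) - ?G z = integral {0..1} (\<lambda>t. \<Sum>b\<in>frame. (h \<bullet> b) *\<^sub>R (t ^ Suc n *\<^sub>R J b h t))"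
      unfolding integral_diff[OF iH[OF zh] iH[OF z], symmetric] by (rule integral_cong) (rule eq)
    also have "\<dots> = (\<Sum>b\<in>frame. integral {0..1} (\<lambda>t. (h \<bullet> b) *\<^sub>R (t ^ Suc n *\<^sub>R J b h t)))"
      by (rule integral_sum) (auto intro!: integrable_cmul iJ[OF h] simp del: power_Suc scaleR_scaleR)
    also have "\<dots> = (\<Sum>b\<in>frame. (h \<bullet> b) *\<^sub>R K b h)"
      unfolding K_def by (simp only: integral_cmul)
    finally show "?G (z + h) - ?G z = (\<Sum>b\<in>frame. (h \<bullet> b) *\<^sub>R K b h)" .
  qed simp
  then show ?thesis by (simp add: K_def J_def D_def)
qed

lemma smooth_on_segment_integral:
  fixes H :: "'e::{real_inner, heine_borel} \<Rightarrow> complex"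
  assumes S: "open S" "convex S" and y: "y \<in> S" and H: "smooth_on S H"
  shows "smooth_on S (\<lambda>z. integral {0..1} (\<lambda>t. t ^ n *\<^sub>R H (y + t *\<^sub>R (z - y))))"
proof -
  have "Ck_on k S (\<lambda>z. integral {0..1} (\<lambda>t. t ^ n *\<^sub>R H (y + t *\<^sub>R (z - y))))" for k
    using H
  proof (induction k arbitrary: n H)
    case 0
    show ?case
      using has_derivative_continuous[OF segment_integral_has_derivative[OF S 0 y]]
      by (auto intro!: continuous_at_imp_continuous_on)
  next
    case (Suc k)
    show ?case
      by (rule Ck_on_SucI[OF S(1) segment_integral_has_derivative[OF S Suc.prems y]])
        (auto intro!: Ck_on_sum[OF S(1)] bounded_bilinear.Ck_on[OF bounded_bilinear_scaleR] S(1)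
          Suc.IH smooth_on_frechet_derivative[OF Suc.prems] simp del: power_Suc)
  qed
  then show ?thesis by (simp add: smooth_on_def)
qed

text \<open>The coefficient \<open>g b z\<close> is the mean of the derivative in direction
  \<open>b\<close> over the segment from \<open>y\<close> to \<open>z\<close>; at
  \<open>z = y\<close> the segment is a point and the mean is the derivative itself.\<close>

lemma hadamard:
  fixes H :: "'e::{real_inner, heine_borel} \<Rightarrow> complex"
  assumes S: "open S" "convex S" and y: "y \<in> S" and H: "smooth_on S H"
  obtains g where "\<And>b. smooth_on S (g b)"
    "\<And>z. z \<in> S \<Longrightarrow> H z = H y + (\<Sum>b\<in>frame. complex_of_real ((z - y) \<bullet> b) * g b z)"
    "\<And>b. g b y = frechet_derivative H (at y) b"
proof
  define g where "g b z = integral {0..1} (\<lambda>t. t ^ 0 *\<^sub>R frechet_derivative H (at (y + t *\<^sub>R (z - y))) b)" for b z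
  show "smooth_on S (g b)" for b
    unfolding g_def
    by (rule smooth_on_segment_integral[OF S y smooth_on_frechet_derivative[OF H]])
  show "H z = H y + (\<Sum>b\<in>frame. complex_of_real ((z - y) \<bullet> b) * g b z)" if "z \<in> S" for z
    using segment_derivative_integral[OF S H y, of "z - y"] that
    by (simp add: g_def scaleR_conv_of_real algebra_simps)
  show "g b y = frechet_derivative H (at y) b" for b
    by (simp add: g_def)
qed

section \<open>Smooth functions on manifolds\<close>

definition C_inf_on :: "('m, 'e::real_normed_vector) atlas \<Rightarrow> 'm set \<Rightarrow> ('m \<Rightarrow> complex) \<Rightarrow> bool" where
  "C_inf_on A S f \<longleftrightarrow> (\<forall>(U, \<phi>)\<in>A. smooth_on (\<phi> ` (U \<inter> S)) (f \<circ> inv_into U \<phi>))"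

text \<open>The part of \<open>smooth_manifold\<close> that does not speak of transition maps.
  Pointwise algebra, gluing and composition rest on it, and it is what
  \<open>prod_atlas_charts\<close> establishes for products.\<close>

definition covering_charts ::
  "('m::topological_space, 'e::real_normed_vector) atlas \<Rightarrow> bool" where
  "covering_charts A \<longleftrightarrow> (\<forall>(U, \<phi>)\<in>A. chart U \<phi>) \<and> (\<Union>(U, \<phi>)\<in>A. U) = UNIV"

lemma smooth_manifold_charts: "smooth_manifold A \<Longrightarrow> covering_charts A"
  by (simp add: smooth_manifold_def covering_charts_def)

lemma covering_chartsD: "covering_charts A \<Longrightarrow> (U, \<phi>) \<in> A \<Longrightarrow> chart U \<phi>"
  by (auto simp: covering_charts_def)

lemma covering_chartsE:
  assumes "covering_charts A" obtains U \<phi> where "(U, \<phi>) \<in> A" "x \<in> U"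
proof -
  have "x \<in> (\<Union>(U, \<phi>)\<in>A. U)" using assms by (simp add: covering_charts_def)
  then show ?thesis using that by auto
qed

lemma C_inf_iff: "f \<in> C_inf A \<longleftrightarrow> C_inf_on A UNIV f"
  by (simp add: C_inf_def C_inf_on_def)

lemma C_inf_onD: "C_inf_on A S f \<Longrightarrow> (U, \<phi>) \<in> A \<Longrightarrow> smooth_on (\<phi> ` (U \<inter> S)) (f \<circ> inv_into U \<phi>)"
  by (auto simp: C_inf_on_def)

lemma C_inf_on_subset: "C_inf_on A S f \<Longrightarrow> T \<subseteq> S \<Longrightarrow> C_inf_on A T f"
  unfolding C_inf_on_def by (blast intro: smooth_on_subset)

lemma C_inf_imp_on: "f \<in> C_inf A \<Longrightarrow> C_inf_on A S f"
  using C_inf_on_subset C_inf_iff by blast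

lemma chart_inv:
  assumes "chart U \<phi>"
  shows "x \<in> U \<Longrightarrow> inv_into U \<phi> (\<phi> x) = x"
    and "y \<in> \<phi> ` U \<Longrightarrow> \<phi> (inv_into U \<phi> y) = y"
    and "y \<in> \<phi> ` U \<Longrightarrow> inv_into U \<phi> y \<in> U"
  using assms by (auto simp: chart_def homeomorphism_def)

lemma chart_open:
  assumes "chart U \<phi>"
  shows "open U" "open (\<phi> ` U)" "continuous_on U \<phi>" "continuous_on (\<phi> ` U) (inv_into U \<phi>)"
  using assms by (auto simp: chart_def homeomorphism_def)

lemma chart_open_image:
  assumes "chart U \<phi>" "open S" shows "open (\<phi> ` (U \<inter> S))"
proof -
  have "\<phi> ` (U \<inter> S) = \<phi> ` U \<inter> inv_into U \<phi> -` S"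
    using chart_inv[OF assms(1)] by force
  then show ?thesis
    using chart_open[OF assms(1)] assms(2) by (simp add: continuous_on_open_vimage Int_commute)
qed

lemma chart_open_vimage:
  assumes "chart U \<phi>" "open T" shows "open (U \<inter> \<phi> -` T)"
  using chart_open[OF assms(1)] assms(2) by (simp add: continuous_on_open_vimage Int_commute)

lemma C_inf_on_local:
  assumes A: "covering_charts A"
    and loc: "\<And>x. x \<in> S \<Longrightarrow> \<exists>T. open T \<and> x \<in> T \<and> C_inf_on A T f"
  shows "C_inf_on A S f"
  unfolding C_inf_on_def
proof safe
  fix U \<phi> assume U: "(U, \<phi>) \<in> A"
  show "smooth_on (\<phi> ` (U \<inter> S)) (f \<circ> inv_into U \<phi>)"
  proof (rule smooth_on_local)
    fix z assume "z \<in> \<phi> ` (U \<inter> S)"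
    then obtain x where x: "x \<in> U" "x \<in> S" "z = \<phi> x" by blast
    then obtain T where T: "open T" "x \<in> T" "C_inf_on A T f" using loc by blast
    then show "\<exists>T. open T \<and> z \<in> T \<and> smooth_on T (f \<circ> inv_into U \<phi>)"
      using x U chart_open_image[OF covering_chartsD[OF A U] T(1)] C_inf_onD[OF T(3) U] by blast
  qed
qed

context
  fixes A :: "('m::topological_space, 'e::real_normed_vector) atlas" and S :: "'m set"
  assumes A: "covering_charts A" and S: "open S"
begin

lemma C_inf_on_cong:
  assumes "\<And>x. x \<in> S \<Longrightarrow> f x = g x" "C_inf_on A S f"
  shows "C_inf_on A S g"
  unfolding C_inf_on_def
proof safe
  fix U \<phi> assume U: "(U, \<phi>) \<in> A"
  have ch: "chart U \<phi>" by (rule covering_chartsD[OF A U])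
  show "smooth_on (\<phi> ` (U \<inter> S)) (g \<circ> inv_into U \<phi>)"
    using smooth_on_cong[OF chart_open_image[OF ch S], of "f \<circ> inv_into U \<phi>" "g \<circ> inv_into U \<phi>"]
      C_inf_onD[OF assms(2) U] assms(1) chart_inv(1)[OF ch] by force
qed

lemma C_inf_on_const: "C_inf_on A S (\<lambda>_. c)"
  by (auto simp: C_inf_on_def comp_def)

lemma C_inf_on_add: "C_inf_on A S f \<Longrightarrow> C_inf_on A S g \<Longrightarrow> C_inf_on A S (\<lambda>x. f x + g x)"
  unfolding C_inf_on_def comp_def
  by (auto intro!: smooth_on_add chart_open_image[OF covering_chartsD[OF A] S])

lemma C_inf_on_mult: "C_inf_on A S f \<Longrightarrow> C_inf_on A S g \<Longrightarrow> C_inf_on A S (\<lambda>x. f x * g x)"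
  unfolding C_inf_on_def comp_def
  by (auto intro!: smooth_on_mult chart_open_image[OF covering_chartsD[OF A] S])

lemma C_inf_on_inverse:
  assumes "C_inf_on A S f" "\<And>x. x \<in> S \<Longrightarrow> f x \<noteq> 0" shows "C_inf_on A S (\<lambda>x. inverse (f x))"
  unfolding C_inf_on_def comp_def
proof safe
  fix U \<phi> assume U: "(U, \<phi>) \<in> A"
  have ch: "chart U \<phi>" by (rule covering_chartsD[OF A U])
  show "smooth_on (\<phi> ` (U \<inter> S)) (\<lambda>x. inverse (f (inv_into U \<phi> x)))"
    using C_inf_onD[OF assms(1) U] assms(2) chart_inv(1)[OF ch]
    by (intro smooth_on_inverse chart_open_image[OF ch S]) (auto simp: comp_def)
qed

lemma C_inf_on_divide:
  "C_inf_on A S f \<Longrightarrow> C_inf_on A S g \<Longrightarrow> (\<And>x. x \<in> S \<Longrightarrow> g x \<noteq> 0) \<Longrightarrow> C_inf_on A S (\<lambda>x. f x / g x)"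
  unfolding divide_inverse by (intro C_inf_on_mult C_inf_on_inverse)

end

context
  fixes A :: "('m::topological_space, 'e::real_normed_vector) atlas"
  assumes A: "covering_charts A"
begin

lemma C_inf_const: "(\<lambda>_. c) \<in> C_inf A"
  and C_inf_add: "f \<in> C_inf A \<Longrightarrow> g \<in> C_inf A \<Longrightarrow> f + g \<in> C_inf A"
  and C_inf_mult: "f \<in> C_inf A \<Longrightarrow> g \<in> C_inf A \<Longrightarrow> f * g \<in> C_inf A"
  using C_inf_on_const[OF A open_UNIV] C_inf_on_add[OF A open_UNIV] C_inf_on_mult[OF A open_UNIV]
  by (auto simp: C_inf_iff plus_fun_def times_fun_def)

lemma C_inf_zero: "0 \<in> C_inf A"
  using C_inf_const[of 0] by (simp add: zero_fun_def)

lemma C_inf_cmult: "f \<in> C_inf A \<Longrightarrow> (\<lambda>_. c) * f \<in> C_inf A"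
  by (intro C_inf_mult C_inf_const)

lemma C_inf_uminus: "f \<in> C_inf A \<Longrightarrow> - f \<in> C_inf A"
  using C_inf_cmult[of f "-1"] by (simp add: times_fun_def fun_Compl_def)

lemma C_inf_diff: "f \<in> C_inf A \<Longrightarrow> g \<in> C_inf A \<Longrightarrow> f - g \<in> C_inf A"
  using C_inf_add[OF _ C_inf_uminus, of f g] by simp

lemma C_inf_sum: "(\<And>i. i \<in> I \<Longrightarrow> f i \<in> C_inf A) \<Longrightarrow> sum f I \<in> C_inf A"
  by (induction I rule: infinite_finite_induct) (auto simp: C_inf_zero C_inf_add)

text \<open>\<open>U\<close> and the complement of \<open>K\<close> are open, cover the space, and
  the function is smooth on each of them.\<close>

lemma C_inf_zero_extension:
  assumes "open U" "closed K" "K \<subseteq> U" "C_inf_on A U f" "\<And>x. x \<notin> K \<Longrightarrow> f x = 0"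
  shows "f \<in> C_inf A"
  unfolding C_inf_iff
proof (rule C_inf_on_local[OF A])
  fix x
  have "C_inf_on A (- K) f"
    by (rule C_inf_on_cong[OF A _ _ C_inf_on_const[OF A, of _ 0]]) (use assms(2,5) in auto)
  then show "\<exists>T. open T \<and> x \<in> T \<and> C_inf_on A T f"
    using assms by (metis ComplI in_mono open_Compl)
qed

end

lemma C_inf_on_compose:
  fixes B :: "('n::topological_space, 'f::{real_inner, heine_borel}) atlas"
  assumes A: "covering_charts A" and B: "covering_charts B"
    and S: "open S" and T: "open T" and F: "smooth_map_on A B S F" and FS: "F ` S \<subseteq> T"
    and f: "C_inf_on B T f"
  shows "C_inf_on A S (\<lambda>x. f (F x))"
proof (rule C_inf_on_local[OF A])
  fix x assume x: "x \<in> S"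
  obtain V \<psi> where V: "(V, \<psi>) \<in> B" "F x \<in> V" using covering_chartsE[OF B] .
  have chV: "chart V \<psi>" by (rule covering_chartsD[OF B V(1)])
  have "continuous_on S F" using F by (simp add: smooth_map_on_def)
  then have open': "open (S \<inter> F -` V)"
    using S chart_open(1)[OF chV] by (simp add: continuous_on_open_vimage Int_commute)
  have "C_inf_on A (S \<inter> F -` V) (\<lambda>x. f (F x))"
    unfolding C_inf_on_def comp_def
  proof safe
    fix U \<phi> assume U: "(U, \<phi>) \<in> A"
    have chU: "chart U \<phi>" by (rule covering_chartsD[OF A U])
    let ?N = "\<phi> ` (U \<inter> (S \<inter> F -` V))"
    have "smooth_on (\<phi> ` (U \<inter> S \<inter> F -` V)) (\<psi> \<circ> F \<circ> inv_into U \<phi>)"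
      using F U V(1) unfolding smooth_map_on_def by blast
    then have 1: "smooth_on ?N (\<lambda>z. \<psi> (F (inv_into U \<phi> z)))"
      by (simp add: comp_def Int_assoc)
    have "smooth_on ?N (\<lambda>z. (f \<circ> inv_into V \<psi>) (\<psi> (F (inv_into U \<phi> z))))"
      by (rule smooth_on_compose[OF chart_open_image[OF chU open'] chart_open_image[OF chV T] 1 C_inf_onD[OF f V(1)]])
        (use chart_inv(1)[OF chU] FS in auto)
    moreover have "(f \<circ> inv_into V \<psi>) (\<psi> (F (inv_into U \<phi> z))) = f (F (inv_into U \<phi> z))" if "z \<in> ?N" for z
      using that chart_inv(1)[OF chU] chart_inv(1)[OF chV] by auto
    ultimately show "smooth_on ?N (\<lambda>x. f (F (inv_into U \<phi> x)))"
      using smooth_on_cong[OF chart_open_image[OF chU open']] by (metis (no_types, lifting))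
  qed
  then show "\<exists>T. open T \<and> x \<in> T \<and> C_inf_on A T (\<lambda>x. f (F x))"
    using open' x V(2) by blast
qed

text \<open>A function written in one chart is smooth in all others by composition with a transition
  map. The compatibility of charts enters here.\<close>

lemma C_inf_on_chart:
  fixes A :: "('m::{t2_space, second_countable_topology}, 'e::{real_inner, heine_borel}) atlas"
  assumes A: "smooth_manifold A" and U: "(U, \<phi>) \<in> A" and T: "open T" "T \<subseteq> \<phi> ` U"
    and h: "smooth_on T h"
  shows "C_inf_on A (U \<inter> \<phi> -` T) (\<lambda>x. h (\<phi> x))"
  unfolding C_inf_on_def comp_def
proof safe
  fix V \<psi> assume V: "(V, \<psi>) \<in> A"
  note charts = covering_chartsD[OF smooth_manifold_charts[OF A]]
  have op: "open (\<psi> ` (V \<inter> (U \<inter> \<phi> -` T)))"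
    using chart_open_image[OF charts[OF V] chart_open_vimage[OF charts[OF U] T(1)]] .
  have "smooth_on (\<psi> ` (V \<inter> U)) (\<phi> \<circ> inv_into V \<psi>)"
    using A U V unfolding smooth_manifold_def by blast
  then have "smooth_on (\<psi> ` (V \<inter> (U \<inter> \<phi> -` T))) (\<lambda>z. \<phi> (inv_into V \<psi> z))"
    unfolding comp_def by (rule smooth_on_subset) blast
  then show "smooth_on (\<psi> ` (V \<inter> (U \<inter> \<phi> -` T))) (\<lambda>z. h (\<phi> (inv_into V \<psi> z)))"
    by (rule smooth_on_compose[OF op T(1) _ h]) (use chart_inv(1)[OF charts[OF V]] in auto)
qed

text \<open>Two radii are used: the inner closed ball is compact, so its preimage in the manifold is
  compact and hence closed in a Hausdorff space, while it lies in the larger open ball on which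
  \<open>h\<close> is smooth. The cut-off function can then be extended by 0.\<close>

lemma bump_extension:
  fixes A :: "('m::{t2_space, second_countable_topology}, 'e::{real_inner, heine_borel}) atlas"
  assumes A: "smooth_manifold A" and U: "(U, \<phi>) \<in> A" and r: "0 < r" "r < R" "ball z R \<subseteq> \<phi> ` U"
    and \<beta>: "smooth_on UNIV \<beta>" "\<And>x. x \<notin> ball z r \<Longrightarrow> \<beta> x = 0" and h: "smooth_on (ball z R) h"
  shows "(\<lambda>x. if x \<in> U then \<beta> (\<phi> x) * h (\<phi> x) else 0) \<in> C_inf A"
    and "closed (U \<inter> \<phi> -` cball z r)"
proof -
  let ?f = "\<lambda>x. if x \<in> U then \<beta> (\<phi> x) * h (\<phi> x) else 0"
  note ch = covering_chartsD[OF smooth_manifold_charts[OF A] U]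
  have sub: "cball z r \<subseteq> ball z R" using r by auto
  then have sub': "cball z r \<subseteq> \<phi> ` U" using r by blast
  have "U \<inter> \<phi> -` cball z r = inv_into U \<phi> ` cball z r"
    using chart_inv[OF ch] sub' by force
  moreover have "compact (inv_into U \<phi> ` cball z r)"
    using chart_open(4)[OF ch] sub' continuous_on_subset
    by (intro compact_continuous_image) (auto simp: compact_eq_bounded_closed)
  ultimately show cl: "closed (U \<inter> \<phi> -` cball z r)" by (simp add: compact_imp_closed)
  have "C_inf_on A (U \<inter> \<phi> -` ball z R) (\<lambda>x. \<beta> (\<phi> x) * h (\<phi> x))"
    by (rule C_inf_on_chart[OF A U _ r(3)])
      (auto intro!: smooth_on_mult h smooth_on_subset[OF \<beta>(1)])
  then have "C_inf_on A (U \<inter> \<phi> -` ball z R) ?f"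
    by (rule C_inf_on_cong[OF smooth_manifold_charts[OF A] chart_open_vimage[OF ch open_ball], rotated]) auto
  then show "?f \<in> C_inf A"
    by (rule C_inf_zero_extension[OF smooth_manifold_charts[OF A] chart_open_vimage[OF ch open_ball] cl, rotated])
      (use sub \<beta>(2) in auto)
qed

lemma smooth_manifold_bump:
  fixes A :: "('m::{t2_space, second_countable_topology}, 'e::{real_inner, heine_borel}) atlas"
  assumes A: "smooth_manifold A" and W: "open W" "m \<in> W"
  obtains \<eta> K where "\<eta> \<in> C_inf A" "\<eta> m \<noteq> 0" "closed K" "K \<subseteq> W" "\<And>x. x \<notin> K \<Longrightarrow> \<eta> x = 0"
proof -
  obtain U \<phi> where U: "(U, \<phi>) \<in> A" "m \<in> U" using covering_chartsE[OF smooth_manifold_charts[OF A]] .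
  note ch = covering_chartsD[OF smooth_manifold_charts[OF A] U(1)]
  obtain R where R: "R > 0" "ball (\<phi> m) R \<subseteq> \<phi> ` (U \<inter> W)"
    using chart_open_image[OF ch W(1)] U(2) W(2) openE by blast
  obtain \<beta> :: "'e \<Rightarrow> complex" where \<beta>: "smooth_on UNIV \<beta>" "\<And>x. \<beta> x \<noteq> 0 \<longleftrightarrow> x \<in> ball (\<phi> m) (R/2)"
    using smooth_bump[of "R/2" "\<phi> m"] R(1) by (metis half_gt_zero)
  let ?\<eta> = "\<lambda>x. if x \<in> U then \<beta> (\<phi> x) * 1 else 0"
  have sub: "ball (\<phi> m) R \<subseteq> \<phi> ` U" using R(2) by blast
  have "?\<eta> \<in> C_inf A" "closed (U \<inter> \<phi> -` cball (\<phi> m) (R/2))"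
    using bump_extension[OF A U(1) _ _ sub \<beta>(1), of "R/2" "\<lambda>_. 1"] \<beta>(2) R(1) by auto
  moreover have "x \<in> W" if "x \<in> U" "\<phi> x \<in> cball (\<phi> m) (R/2)" for x
  proof -
    have "\<phi> x \<in> ball (\<phi> m) R" using that(2) R(1) by auto
    then have "\<phi> x \<in> \<phi> ` (U \<inter> W)" using R(2) by blast
    then show ?thesis using chart_inv(1)[OF ch] that(1) by (metis Int_iff imageE)
  qed
  moreover have "?\<eta> m \<noteq> 0" using \<beta>(2) U(2) R(1) by simp
  moreover have "?\<eta> x = 0" if "x \<notin> U \<inter> \<phi> -` cball (\<phi> m) (R/2)" for x
    using \<beta>(2)[of "\<phi> x"] that by auto
  ultimately show ?thesis
    by (intro that[of ?\<eta> "U \<inter> \<phi> -` cball (\<phi> m) (R/2)"]) blast+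
qed

lemma prod_atlas_charts:
  fixes A :: "('m::topological_space, 'e::real_normed_vector) atlas"
    and B :: "('n::topological_space, 'f::real_normed_vector) atlas"
  assumes A: "covering_charts A" and B: "covering_charts B"
  shows "covering_charts (prod_atlas A B)"
    and "(U, \<phi>) \<in> A \<Longrightarrow> (V, \<psi>) \<in> B \<Longrightarrow> x \<in> \<phi> ` U \<times> \<psi> ` V \<Longrightarrow>
      inv_into (U \<times> V) (map_prod \<phi> \<psi>) x = (inv_into U \<phi> (fst x), inv_into V \<psi> (snd x))"
proof -
  show inv: "inv_into (U \<times> V) (map_prod \<phi> \<psi>) x = (inv_into U \<phi> (fst x), inv_into V \<psi> (snd x))"
    if "(U, \<phi>) \<in> A" "(V, \<psi>) \<in> B" "x \<in> \<phi> ` U \<times> \<psi> ` V" for U \<phi> V \<psi> x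
  proof (rule inv_into_f_eq)
    show "inj_on (map_prod \<phi> \<psi>) (U \<times> V)"
      using chart_inv(1) covering_chartsD[OF A that(1)] covering_chartsD[OF B that(2)]
      by (metis inj_on_inverseI map_prod_inj_on)
  qed (use that chart_inv(2,3)[OF covering_chartsD[OF A that(1)]]
      chart_inv(2,3)[OF covering_chartsD[OF B that(2)]] in auto)
  have "chart (U \<times> V) (map_prod \<phi> \<psi>)" if UV: "(U, \<phi>) \<in> A" "(V, \<psi>) \<in> B" for U \<phi> V \<psi>
  proof -
    note chU = covering_chartsD[OF A UV(1)] and chV = covering_chartsD[OF B UV(2)]
    have im: "map_prod \<phi> \<psi> ` (U \<times> V) = \<phi> ` U \<times> \<psi> ` V" by auto
    have "continuous_on (\<phi> ` U \<times> \<psi> ` V) (\<lambda>x. (inv_into U \<phi> (fst x), inv_into V \<psi> (snd x)))"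
      by (intro continuous_intros continuous_on_compose2[OF chart_open(4)[OF chU]]
          continuous_on_compose2[OF chart_open(4)[OF chV]]) auto
    then have 1: "continuous_on (\<phi> ` U \<times> \<psi> ` V) (inv_into (U \<times> V) (map_prod \<phi> \<psi>))"
      by (rule continuous_on_eq) (rule inv[OF UV, symmetric])
    have "continuous_on (U \<times> V) (\<lambda>x. (\<phi> (fst x), \<psi> (snd x)))"
      by (intro continuous_intros continuous_on_compose2[OF chart_open(3)[OF chU]]
          continuous_on_compose2[OF chart_open(3)[OF chV]]) auto
    then have 2: "continuous_on (U \<times> V) (map_prod \<phi> \<psi>)"
      by (simp add: map_prod_def case_prod_beta)
    show ?thesis
      unfolding chart_def im
    proof (intro conjI homeomorphismI)
      show "open (U \<times> V)" "open (\<phi> ` U \<times> \<psi> ` V)"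
        by (intro open_Times chart_open(1,2)[OF chU] chart_open(1,2)[OF chV])+
      show "inv_into (U \<times> V) (map_prod \<phi> \<psi>) ` (\<phi> ` U \<times> \<psi> ` V) \<subseteq> U \<times> V"
        using inv[OF UV] chart_inv(3)[OF chU] chart_inv(3)[OF chV] by fastforce
    qed (use 1 2 inv[OF UV] chart_inv[OF chU] chart_inv[OF chV] in auto)
  qed
  moreover have "x \<in> (\<Union>(U, \<phi>)\<in>prod_atlas A B. U)" for x
  proof -
    obtain U \<phi> where U: "(U, \<phi>) \<in> A" "fst x \<in> U" using covering_chartsE[OF A] .
    obtain V \<psi> where V: "(V, \<psi>) \<in> B" "snd x \<in> V" using covering_chartsE[OF B] .
    have "(U \<times> V, map_prod \<phi> \<psi>) \<in> prod_atlas A B" "x \<in> U \<times> V"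
      using U V by (auto simp: prod_atlas_def mem_Times_iff)
    then show ?thesis by blast
  qed
  ultimately show "covering_charts (prod_atlas A B)"
    by (auto simp: covering_charts_def prod_atlas_def)
qed

section \<open>Vector fields and forms\<close>

lemma sum_fun_apply: "(\<Sum>i\<in>I. f i) x = (\<Sum>i\<in>I. f i x)"
  for f :: "'i \<Rightarrow> 'a \<Rightarrow> 'b::comm_monoid_add"
  by (induction I rule: infinite_finite_induct) auto

lemma vfD:
  assumes "X \<in> vector_fields A"
  shows vf_C_inf: "f \<in> C_inf A \<Longrightarrow> X f \<in> C_inf A"
    and vf_add: "f \<in> C_inf A \<Longrightarrow> g \<in> C_inf A \<Longrightarrow> X (f + g) = X f + X g"
    and vf_cmult: "f \<in> C_inf A \<Longrightarrow> X ((\<lambda>_. c) * f) = (\<lambda>_. c) * X f"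
    and vf_mult: "f \<in> C_inf A \<Longrightarrow> g \<in> C_inf A \<Longrightarrow> X (f * g) = X f * g + f * X g"
    and vf_outside: "f \<notin> C_inf A \<Longrightarrow> X f = 0"
  using assms by (auto simp: vector_fields_def)

lemma vfI:
  assumes "\<And>f. f \<in> C_inf A \<Longrightarrow> X f \<in> C_inf A"
    and "\<And>f g. f \<in> C_inf A \<Longrightarrow> g \<in> C_inf A \<Longrightarrow> X (f + g) = X f + X g"
    and "\<And>f c. f \<in> C_inf A \<Longrightarrow> X ((\<lambda>_. c) * f) = (\<lambda>_. c) * X f"
    and "\<And>f g. f \<in> C_inf A \<Longrightarrow> g \<in> C_inf A \<Longrightarrow> X (f * g) = X f * g + f * X g"
    and "\<And>f. f \<notin> C_inf A \<Longrightarrow> X f = 0"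
  shows "X \<in> vector_fields A"
  using assms by (auto simp: vector_fields_def)

lemma vscale_apply: "vscale h X f = h * X f"
  by (simp add: vscale_def)

context
  fixes A :: "('m::topological_space, 'e::real_normed_vector) atlas"
  assumes A: "covering_charts A"
begin

lemma vf_const:
  assumes "X \<in> vector_fields A" shows "X (\<lambda>_. c) = 0"
proof -
  have one: "(\<lambda>_. 1) \<in> C_inf A" by (rule C_inf_const[OF A])
  have "(\<lambda>_::'m. 1::complex) * (\<lambda>_. 1) = (\<lambda>_. 1)" by (simp add: times_fun_def)
  then have "X (\<lambda>_. 1) = X (\<lambda>_. 1) * (\<lambda>_. 1) + (\<lambda>_. 1) * X (\<lambda>_. 1)"
    using vf_mult[OF assms one one] by metis
  then have "X (\<lambda>_. 1) = 0" by (auto simp: fun_eq_iff)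
  moreover have "(\<lambda>_::'m. c) = (\<lambda>_. c) * (\<lambda>_. 1)" by (simp add: times_fun_def)
  ultimately show ?thesis using vf_cmult[OF assms one, of c] by simp
qed

lemma vf_zero: assumes "X \<in> vector_fields A" shows "X 0 = 0"
  using vf_const[OF assms, of 0] by (simp add: zero_fun_def)

lemma vf_uminus: "X \<in> vector_fields A \<Longrightarrow> f \<in> C_inf A \<Longrightarrow> X (- f) = - X f"
  using vf_cmult[of X A f "-1"] by (simp add: times_fun_def fun_Compl_def)

lemma vf_diff: "X \<in> vector_fields A \<Longrightarrow> f \<in> C_inf A \<Longrightarrow> g \<in> C_inf A \<Longrightarrow> X (f - g) = X f - X g"
  using vf_add[of X A f "- g"] vf_uminus[of X g] C_inf_uminus[OF A, of g] by simp

lemma vf_sum_arg: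
  assumes "X \<in> vector_fields A" "\<And>i. i \<in> I \<Longrightarrow> f i \<in> C_inf A"
  shows "X (sum f I) = (\<Sum>i\<in>I. X (f i))"
  using assms(2)
  by (induction I rule: infinite_finite_induct)
    (auto simp: vf_zero[OF assms(1)] vf_add[OF assms(1)] C_inf_sum[OF A])

lemma zero_vector_field: "0 \<in> vector_fields A"
  by (rule vfI) (simp_all add: C_inf_zero[OF A])

lemma vector_fields_add:
  assumes X: "X \<in> vector_fields A" and Y: "Y \<in> vector_fields A"
  shows "X + Y \<in> vector_fields A"
  using X Y
  by (intro vfI; simp add: vfD[OF X] vfD[OF Y] C_inf_add[OF A]; simp add: algebra_simps)

lemma vector_fields_vscale:
  assumes h: "h \<in> C_inf A" and X: "X \<in> vector_fields A" shows "vscale h X \<in> vector_fields A"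
  by (rule vfI; simp add: vscale_apply vfD[OF X] C_inf_mult[OF A] h; simp add: algebra_simps)

lemma vector_fields_sum:
  "(\<And>i. i \<in> I \<Longrightarrow> X i \<in> vector_fields A) \<Longrightarrow> sum X I \<in> vector_fields A"
  by (induction I rule: infinite_finite_induct) (auto simp: zero_vector_field vector_fields_add)

lemma vscale_minus_one: "vscale (\<lambda>_. -1) X = - X"
  by (simp add: vscale_def fun_eq_iff)

lemma vector_fields_uminus: "X \<in> vector_fields A \<Longrightarrow> - X \<in> vector_fields A"
  using vector_fields_vscale[OF C_inf_const[OF A], of X "-1"] by (simp add: vscale_minus_one)

lemma vector_fields_diff:
  "X \<in> vector_fields A \<Longrightarrow> Y \<in> vector_fields A \<Longrightarrow> X - Y \<in> vector_fields A"
  using vector_fields_add[of X "- Y"] vector_fields_uminus[of Y] by simp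

lemma vector_fields_lie_bracket:
  assumes X: "X \<in> vector_fields A" and Y: "Y \<in> vector_fields A"
  shows "lie_bracket X Y \<in> vector_fields A"
proof (rule vfI)
  fix f g assume f: "f \<in> C_inf A" and g: "g \<in> C_inf A"
  note [simp] = vf_C_inf[OF X] vf_C_inf[OF Y] C_inf_mult[OF A]
  show "lie_bracket X Y (f * g) = lie_bracket X Y f * g + f * lie_bracket X Y g"
    using f g by (simp add: lie_bracket_def vf_mult[OF X] vf_mult[OF Y] vf_add[OF X] vf_add[OF Y]
        algebra_simps)
next
  fix f c assume f: "f \<in> C_inf A"
  show "lie_bracket X Y ((\<lambda>_. c) * f) = (\<lambda>_. c) * lie_bracket X Y f"
    using f by (simp add: lie_bracket_def vfD[OF X] vfD[OF Y] right_diff_distrib)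
qed (simp_all add: lie_bracket_def vfD[OF X] vfD[OF Y] vf_zero[OF X] vf_zero[OF Y]
    C_inf_diff[OF A])

lemma lie_bracket_vscale_left:
  assumes h: "h \<in> C_inf A" and X: "X \<in> vector_fields A" and Y: "Y \<in> vector_fields A"
  shows "lie_bracket (vscale h X) Y = vscale h (lie_bracket X Y) - vscale (Y h) X"
proof
  fix f
  have "Y (h * X f) = Y h * X f + h * Y (X f)"
    using vf_mult[OF Y h vf_C_inf[OF X]] vf_outside[OF X] vf_zero[OF Y]
    by (cases "f \<in> C_inf A") auto
  then show "lie_bracket (vscale h X) Y f = (vscale h (lie_bracket X Y) - vscale (Y h) X) f"
    by (simp add: lie_bracket_def vscale_apply algebra_simps)
qed

lemma lie_bracket_add_left:
  assumes X: "X \<in> vector_fields A" "X' \<in> vector_fields A" and Y: "Y \<in> vector_fields A"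
  shows "lie_bracket (X + X') Y = lie_bracket X Y + lie_bracket X' Y"
proof
  fix f
  have "Y (X f + X' f) = Y (X f) + Y (X' f)"
    using vf_add[OF Y vf_C_inf[OF X(1)] vf_C_inf[OF X(2)]] vf_outside X vf_zero[OF Y]
    by (cases "f \<in> C_inf A") fastforce+
  then show "lie_bracket (X + X') Y f = (lie_bracket X Y + lie_bracket X' Y) f"
    by (simp add: lie_bracket_def algebra_simps)
qed

lemma form1_add: "\<theta> \<in> forms1 A \<Longrightarrow> X \<in> vector_fields A \<Longrightarrow> Y \<in> vector_fields A \<Longrightarrow> \<theta> (X + Y) = \<theta> X + \<theta> Y"
  and form1_vscale: "\<theta> \<in> forms1 A \<Longrightarrow> h \<in> C_inf A \<Longrightarrow> X \<in> vector_fields A \<Longrightarrow> \<theta> (vscale h X) = h * \<theta> X"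
  and form1_C_inf: "\<theta> \<in> forms1 A \<Longrightarrow> X \<in> vector_fields A \<Longrightarrow> \<theta> X \<in> C_inf A"
  by (auto simp: forms1_def)

lemma form1_zero: assumes "\<theta> \<in> forms1 A" shows "\<theta> 0 = 0"
  using form1_add[OF assms zero_vector_field zero_vector_field] by simp

lemma form1_uminus: assumes "\<theta> \<in> forms1 A" "X \<in> vector_fields A" shows "\<theta> (- X) = - \<theta> X"
  using form1_add[OF assms(1) assms(2) vector_fields_uminus[OF assms(2)]] form1_zero[OF assms(1)]
  by (simp add: eq_neg_iff_add_eq_0 add.commute)

lemma form1_diff:
  assumes "\<theta> \<in> forms1 A" "X \<in> vector_fields A" "Y \<in> vector_fields A" shows "\<theta> (X - Y) = \<theta> X - \<theta> Y"
  using form1_add[OF assms(1,2) vector_fields_uminus[OF assms(3)]] form1_uminus[OF assms(1,3)] by simp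

lemma form1_sum:
  assumes "\<theta> \<in> forms1 A" "\<And>i. i \<in> I \<Longrightarrow> X i \<in> vector_fields A"
  shows "\<theta> (sum X I) = (\<Sum>i\<in>I. \<theta> (X i))"
  using assms(2)
  by (induction I rule: infinite_finite_induct)
    (auto simp: form1_zero[OF assms(1)] form1_add[OF assms(1)] vector_fields_sum)

lemma form2_left: "\<alpha> \<in> forms2 A \<Longrightarrow> X \<in> vector_fields A \<Longrightarrow> \<alpha> X \<in> forms1 A"
  and form2_right: "\<alpha> \<in> forms2 A \<Longrightarrow> X \<in> vector_fields A \<Longrightarrow> (\<lambda>Y. \<alpha> Y X) \<in> forms1 A"
  and form2_self: "\<alpha> \<in> forms2 A \<Longrightarrow> X \<in> vector_fields A \<Longrightarrow> \<alpha> X X = 0"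
  by (auto simp: forms2_def)

lemma form2_antisym:
  assumes \<alpha>: "\<alpha> \<in> forms2 A" and X: "X \<in> vector_fields A" and Y: "Y \<in> vector_fields A"
  shows "\<alpha> X Y = - \<alpha> Y X"
proof -
  have "0 = \<alpha> (X + Y) (X + Y)" using form2_self[OF \<alpha> vector_fields_add[OF X Y]] by simp
  also have "\<dots> = \<alpha> X X + \<alpha> X Y + (\<alpha> Y X + \<alpha> Y Y)"
    using form1_add[OF form2_right[OF \<alpha> vector_fields_add[OF X Y]] X Y]
      form1_add[OF form2_left[OF \<alpha> X] X Y] form1_add[OF form2_left[OF \<alpha> Y] X Y] by simp
  finally show ?thesis using form2_self[OF \<alpha> X] form2_self[OF \<alpha> Y]
    by (simp add: eq_neg_iff_add_eq_0)
qed

lemma ext_d2_cong: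
  assumes eq: "\<And>X Y. X \<in> vector_fields A \<Longrightarrow> Y \<in> vector_fields A \<Longrightarrow> \<alpha> X Y = \<beta> X Y"
    and XYZ: "X \<in> vector_fields A" "Y \<in> vector_fields A" "Z \<in> vector_fields A"
  shows "ext_d2 \<alpha> X Y Z = ext_d2 \<beta> X Y Z"
  using XYZ by (simp add: ext_d2_def eq vector_fields_lie_bracket)

text \<open>The terms in which two fields act on a value of \<theta> cancel against those in which a
  Lie bracket acts. What remains is \<theta> applied to the Jacobi sum of \<open>X\<close>,
  \<open>Y\<close>, \<open>Z\<close>.\<close>

lemma ext_d2_ext_d1:
  assumes \<theta>: "\<theta> \<in> forms1 A"
    and X: "X \<in> vector_fields A" and Y: "Y \<in> vector_fields A" and Z: "Z \<in> vector_fields A"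
  shows "ext_d2 (ext_d1 \<theta>) X Y Z = 0"
proof -
  note LB = vector_fields_lie_bracket
  note C = form1_C_inf[OF \<theta>]
  have jac: "lie_bracket (lie_bracket X Y) Z - lie_bracket (lie_bracket X Z) Y +
      lie_bracket (lie_bracket Y Z) X = 0"
  proof
    fix f
    \<comment> \<open>Vector fields are 0 on non-smooth functions, so an equation between vector
      fields has to be checked there as well.\<close>
    have out: "f \<notin> C_inf A \<Longrightarrow> X f = 0 \<and> Y f = 0 \<and> Z f = 0"
      using vf_outside X Y Z by blast
    show "(lie_bracket (lie_bracket X Y) Z - lie_bracket (lie_bracket X Z) Y +
      lie_bracket (lie_bracket Y Z) X) f = 0 f"
      using out
      by (cases "f \<in> C_inf A")
        (simp_all add: lie_bracket_def vf_diff[OF X] vf_diff[OF Y] vf_diff[OF Z] vf_C_inf[OF X]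
          vf_C_inf[OF Y] vf_C_inf[OF Z] vf_zero[OF X] vf_zero[OF Y] vf_zero[OF Z])
  qed
  have "\<theta> (lie_bracket (lie_bracket X Y) Z) - \<theta> (lie_bracket (lie_bracket X Z) Y) +
      \<theta> (lie_bracket (lie_bracket Y Z) X) = \<theta> 0"
    unfolding jac[symmetric]
    by (simp add: form1_add[OF \<theta>] form1_diff[OF \<theta>] LB X Y Z vector_fields_diff)
  then have jac': "\<theta> (lie_bracket (lie_bracket X Z) Y) = \<theta> (lie_bracket (lie_bracket X Y) Z) +
      \<theta> (lie_bracket (lie_bracket Y Z) X)"
    by (simp add: form1_zero[OF \<theta>] algebra_simps)
  show ?thesis
    by (simp add: ext_d2_def ext_d1_def vf_diff[OF X] vf_diff[OF Y] vf_diff[OF Z] C C_inf_diff[OF A]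
        vf_C_inf[OF X] vf_C_inf[OF Y] vf_C_inf[OF Z] X Y Z LB jac')
      (simp add: lie_bracket_def algebra_simps)
qed

text \<open>Classes are sets of closed forms. A primitive \<theta>' of \<alpha> - \<beta> becomes
  the primitive \<theta>' - \<theta> of -\<beta>, and conversely by adding \<theta>; closedness of
  \<alpha> is d d = 0.\<close>

lemma de_rham_class_exact:
  assumes \<theta>: "\<theta> \<in> forms1 A" and \<alpha>: "\<alpha> \<in> forms2 A"
    and eq: "\<And>X Y. X \<in> vector_fields A \<Longrightarrow> Y \<in> vector_fields A \<Longrightarrow> \<alpha> X Y = ext_d1 \<theta> X Y"
  shows "de_rham_class A \<alpha> = de_rham_class A 0"
proof -
  have "ext_d2 \<alpha> X Y Z = 0"
    if "X \<in> vector_fields A" "Y \<in> vector_fields A" "Z \<in> vector_fields A" for X Y Z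
    using ext_d2_cong[OF eq that] ext_d2_ext_d1[OF \<theta> that] by simp
  then have cl: "\<alpha> \<in> closed_forms2 A" using \<alpha> by (simp add: closed_forms2_def)
  have "0 \<in> forms2 A"
    using C_inf_zero[OF A] by (simp add: forms2_def forms1_def zero_fun_def fun_eq_iff)
  then have cl0: "0 \<in> closed_forms2 A"
    by (auto simp: closed_forms2_def ext_d2_def vf_zero fun_eq_iff)
  have shift: "(\<lambda>X. \<theta>1 X + \<theta>2 X) \<in> forms1 A" if "\<theta>1 \<in> forms1 A" "\<theta>2 \<in> forms1 A" for \<theta>1 \<theta>2
    using that by (auto simp: forms1_def C_inf_add[OF A] algebra_simps)
  have neg: "(\<lambda>X. - \<theta>1 X) \<in> forms1 A" if "\<theta>1 \<in> forms1 A" for \<theta>1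
    using that by (auto simp: forms1_def C_inf_uminus[OF A] algebra_simps)
  have d_add: "ext_d1 (\<lambda>X. \<theta>1 X + \<theta>2 X) X Y = ext_d1 \<theta>1 X Y + ext_d1 \<theta>2 X Y"
    and d_neg: "ext_d1 (\<lambda>X. - \<theta>1 X) X Y = - ext_d1 \<theta>1 X Y"
    if "\<theta>1 \<in> forms1 A" "\<theta>2 \<in> forms1 A" "X \<in> vector_fields A" "Y \<in> vector_fields A" for \<theta>1 \<theta>2 X Y
    using that by (simp_all add: ext_d1_def vf_add vf_uminus form1_C_inf)
      (simp_all add: fun_eq_iff algebra_simps)
  show ?thesis
    unfolding de_rham_class_def
  proof (intro set_eqI iffI)
    fix \<beta> assume "\<beta> \<in> cohomologous A `` {\<alpha>}"
    then obtain \<theta>' where \<theta>': "\<theta>' \<in> forms1 A" "\<beta> \<in> closed_forms2 A"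
      "\<And>X Y. X \<in> vector_fields A \<Longrightarrow> Y \<in> vector_fields A \<Longrightarrow> \<alpha> X Y - \<beta> X Y = ext_d1 \<theta>' X Y"
      by (auto simp: cohomologous_def)
    have "0 - \<beta> X Y = ext_d1 (\<lambda>X. \<theta>' X + - \<theta> X) X Y" if "X \<in> vector_fields A" "Y \<in> vector_fields A" for X Y
      using \<theta>'(3)[OF that] eq[OF that] d_add[OF \<theta>'(1) neg[OF \<theta>] that] d_neg[OF \<theta> \<theta> that]
      by (simp add: algebra_simps)
    then show "\<beta> \<in> cohomologous A `` {0}"
      using shift[OF \<theta>'(1) neg[OF \<theta>]] \<theta>'(2) cl0 by (auto simp: cohomologous_def)
  next
    fix \<beta> assume "\<beta> \<in> cohomologous A `` {0}"
    then obtain \<theta>' where \<theta>': "\<theta>' \<in> forms1 A" "\<beta> \<in> closed_forms2 A"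
      "\<And>X Y. X \<in> vector_fields A \<Longrightarrow> Y \<in> vector_fields A \<Longrightarrow> 0 - \<beta> X Y = ext_d1 \<theta>' X Y"
      by (auto simp: cohomologous_def)
    have "\<alpha> X Y - \<beta> X Y = ext_d1 (\<lambda>X. \<theta>' X + \<theta> X) X Y" if "X \<in> vector_fields A" "Y \<in> vector_fields A" for X Y
      using \<theta>'(3)[OF that] eq[OF that] d_add[OF \<theta>'(1) \<theta> that]
      by (metis (no_types, lifting) add.commute add_diff_eq diff_0 diff_conv_add_uminus)
    then show "\<beta> \<in> cohomologous A `` {\<alpha>}"
      using shift[OF \<theta>'(1) \<theta>] \<theta>'(2) cl by (auto simp: cohomologous_def)
  qed
qed

end

text \<open>
  A local dual basis for the module of vector fields: the bump function \<open>\<eta>\<close> plays the role of an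
  additional coordinate, which avoids plateau functions.
\<close>

lemma vector_fields_dual_basis:
  fixes A :: "('m::{t2_space, second_countable_topology}, 'e::{real_inner, heine_borel}) atlas"
  assumes A: "smooth_manifold A"
  obtains \<sigma> and I :: "'e set" and x E where "\<sigma> \<in> C_inf A" "\<sigma> m \<noteq> 0" "finite I"
    "\<And>i. i \<in> I \<Longrightarrow> x i \<in> C_inf A" "\<And>i. i \<in> I \<Longrightarrow> E i \<in> vector_fields A"
    "\<And>Y f. Y \<in> vector_fields A \<Longrightarrow> f \<in> C_inf A \<Longrightarrow> \<sigma> * Y f = (\<Sum>i\<in>I. Y (x i) * E i f)"
proof -
  note AC = smooth_manifold_charts[OF A]
  obtain U \<phi> where U: "(U, \<phi>) \<in> A" "m \<in> U" using covering_chartsE[OF AC] .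
  note ch = covering_chartsD[OF AC U(1)]
  obtain R where R: "R > 0" "ball (\<phi> m) R \<subseteq> \<phi> ` U"
    using chart_open(2)[OF ch] U(2) openE by blast
  define S where "S = ball (\<phi> m) R"
  have S: "open S" "convex S" "S \<subseteq> \<phi> ` U" using R by (auto simp: S_def)
  obtain \<beta> :: "'e \<Rightarrow> complex" where \<beta>: "smooth_on UNIV \<beta>" "\<And>x. \<beta> x \<noteq> 0 \<longleftrightarrow> x \<in> ball (\<phi> m) (R/2)"
    using smooth_bump[of "R/2" "\<phi> m"] R(1) by (metis half_gt_zero)
  have \<beta>S: "\<phi> u \<in> S" if "\<beta> (\<phi> u) \<noteq> 0" for u using \<beta>(2)[of "\<phi> u"] that R(1) by (auto simp: S_def)
  define ex where "ex h = (\<lambda>u. if u \<in> U then \<beta> (\<phi> u) * h (\<phi> u) else 0)" for h :: "'e \<Rightarrow> complex"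
  have ex_C: "ex h \<in> C_inf A" if "smooth_on S h" for h
    unfolding ex_def
    by (rule bump_extension(1)[OF A U(1), of "R/2" R "\<phi> m"]) (use \<beta> R that in \<open>auto simp: S_def\<close>)
  define lc where "lc f = f \<circ> inv_into U \<phi>" for f :: "'m \<Rightarrow> complex"
  have lc: "smooth_on (\<phi> ` U) (lc f)" if "f \<in> C_inf A" for f
    using that U(1) by (auto simp: C_inf_def lc_def)
  define d where "d f z b = frechet_derivative (lc f) (at z) b" for f z b
  have der: "(lc f has_derivative d f z) (at z)" if "f \<in> C_inf A" "z \<in> S" for f z
    using smooth_on_has_derivative[OF lc[OF that(1)]] that(2) S(3) by (auto simp: d_def[abs_def])
  have d_eq: "d f z = F" if "(lc f has_derivative F) (at z)" for f z F
    using frechet_derivative_eqI[OF that] by (auto simp: d_def)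
  \<comment> \<open>The coordinate field with components \<open>c\<close>, multiplied by the bump
    function and extended by 0.\<close>
  define vf where "vf c f = (if f \<in> C_inf A then ex (\<lambda>z. \<Sum>b\<in>frame. c b z * d f z b) else 0)"
    for c :: "'e \<Rightarrow> 'e \<Rightarrow> complex" and f
  have vf: "vf c \<in> vector_fields A" if c: "\<And>b. b \<in> frame \<Longrightarrow> smooth_on S (c b)" for c
  proof (rule vfI)
    fix f assume f: "f \<in> C_inf A"
    show "vf c f \<in> C_inf A"
      using f S(1) c smooth_on_subset[OF smooth_on_frechet_derivative[OF lc[OF f]] S(3)]
      by (auto simp: vf_def d_def intro!: ex_C smooth_on_sum smooth_on_mult)
    have "d ((\<lambda>_. a) * f) z b = a * d f z b" if "z \<in> S" for a z b
    proof -
      have "(lc ((\<lambda>_. a) * f) has_derivative (\<lambda>b. a * d f z b)) (at z)"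
        using has_derivative_mult_right[OF der[OF f that], of a] by (simp add: lc_def comp_def)
      from d_eq[OF this] show ?thesis by simp
    qed
    then have "vf c ((\<lambda>_. a) * f) u = ((\<lambda>_. a) * vf c f) u" for a u
      using \<beta>S[of u] f
      by (cases "u \<in> U"; cases "\<beta> (\<phi> u) = 0";
          simp add: vf_def ex_def C_inf_cmult[OF AC] sum_distrib_left; simp add: mult_ac)
    then show "vf c ((\<lambda>_. a) * f) = (\<lambda>_. a) * vf c f" for a by blast
    fix g assume g: "g \<in> C_inf A"
    have "d (f + g) z b = d f z b + d g z b" if "z \<in> S" for z b
    proof -
      have "(lc (f + g) has_derivative (\<lambda>b. d f z b + d g z b)) (at z)"
        using has_derivative_add[OF der[OF f that] der[OF g that]] by (simp add: lc_def comp_def)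
      from d_eq[OF this] show ?thesis by simp
    qed
    then have "vf c (f + g) u = (vf c f + vf c g) u" for u
      using \<beta>S[of u] f g
      by (cases "u \<in> U"; cases "\<beta> (\<phi> u) = 0")
        (simp_all add: vf_def ex_def C_inf_add[OF AC] sum.distrib distrib_left)
    then show "vf c (f + g) = vf c f + vf c g" by blast
    have "d (f * g) z b = lc f z * d g z b + d f z b * lc g z" if "z \<in> S" for z b
    proof -
      have "(lc (f * g) has_derivative (\<lambda>b. lc f z * d g z b + d f z b * lc g z)) (at z)"
        using has_derivative_mult[OF der[OF f that] der[OF g that]] by (simp add: lc_def comp_def)
      from d_eq[OF this] show ?thesis by simp
    qed
    moreover have "lc h (\<phi> u) = h u" if "u \<in> U" for h u
      using chart_inv(1)[OF ch that] by (simp add: lc_def)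
    ultimately have "vf c (f * g) u = (vf c f * g + f * vf c g) u" for u
      using \<beta>S[of u] f g
      by (cases "u \<in> U"; cases "\<beta> (\<phi> u) = 0")
        (simp_all add: vf_def ex_def C_inf_mult[OF AC] sum.distrib algebra_simps sum_distrib_left)
    then show "vf c (f * g) = vf c f * g + f * vf c g" by blast
  qed (simp add: vf_def)
  define \<eta> where "\<eta> = ex (\<lambda>_. 1)"
  define co where "co b = ex (\<lambda>z. complex_of_real (z \<bullet> b))" for b
  define x where "x i = (if i = 0 then \<eta> else co i)" for i
  \<comment> \<open>Write z_b for the coordinate \<open>z \<bullet> b\<close>. From
    \<open>co b\<close> = \<eta> z_b one gets \<eta> Y(z_b) = Y(co b) - z_b Y(\<eta>). Collecting
    the terms with Y(\<eta>) in \<eta>^2 Y f leaves minus the cut-off Euler field, which is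
    \<open>E 0\<close>; the other \<open>E b\<close> are the cut-off coordinate derivatives.\<close>
  define E where "E i = vf (if i = 0 then (\<lambda>b z. - complex_of_real (z \<bullet> b)) else (\<lambda>b z. if b = i then 1 else 0))" for i
  have inn: "smooth_on T (\<lambda>z::'e. complex_of_real (z \<bullet> b))" for b T
    by (intro smooth_on_bounded_linear bounded_linear_compose[OF bounded_linear_of_real] bounded_linear_inner_left)
  have \<eta>: "\<eta> \<in> C_inf A" and co: "\<And>b. co b \<in> C_inf A"
    unfolding \<eta>_def co_def by (intro ex_C inn smooth_on_const)+
  have "smooth_on S (\<lambda>z. - complex_of_real (z \<bullet> b))" for b
    using smooth_on_diff[OF S(1) smooth_on_const[of S 0] inn[of S b]] by simp
  then have E: "E i \<in> vector_fields A" for i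
    unfolding E_def by (intro vf) auto
  have main: "\<eta> u * \<eta> u * Y f u = (\<Sum>i\<in>insert 0 frame. Y (x i) u * E i f u)"
    if Y: "Y \<in> vector_fields A" and f: "f \<in> C_inf A" for Y f u
  proof (cases "u \<in> U \<and> \<beta> (\<phi> u) \<noteq> 0")
    case False
    then show ?thesis by (auto simp: \<eta>_def E_def vf_def ex_def f)
  next
    case True
    define y where "y = \<phi> u"
    have y: "y \<in> S" using True \<beta>S by (simp add: y_def)
    obtain g where g: "\<And>b. smooth_on S (g b)"
      "\<And>z. z \<in> S \<Longrightarrow> lc f z = lc f y + (\<Sum>b\<in>frame. complex_of_real ((z - y) \<bullet> b) * g b z)"
      "\<And>b. g b y = d f y b"
      using hadamard[OF S(1,2) y smooth_on_subset[OF lc[OF f] S(3)]] unfolding d_def by metis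
    let ?a = "\<lambda>b. co b + (\<lambda>_. - complex_of_real (y \<bullet> b)) * \<eta>"
    have a: "?a b \<in> C_inf A" and eg: "ex (g b) \<in> C_inf A" for b
      by (intro C_inf_add[OF AC] C_inf_cmult[OF AC] co \<eta> ex_C g)+
    \<comment> \<open>Hadamard's formula at \<open>u\<close>, multiplied by \<eta>^2. One factor
      \<eta> cuts off the coordinate difference and the other cuts off \<open>g b\<close>, so that
      all factors are global smooth functions to which \<open>Y\<close> can be applied.\<close>
    have "\<eta> * \<eta> * f = (\<lambda>_. f u) * (\<eta> * \<eta>) + (\<Sum>b\<in>frame. ?a b * ex (g b))"
    proof
      fix w
      show "(\<eta> * \<eta> * f) w = ((\<lambda>_. f u) * (\<eta> * \<eta>) + (\<Sum>b\<in>frame. ?a b * ex (g b))) w"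
      proof (cases "w \<in> U \<and> \<beta> (\<phi> w) \<noteq> 0")
        case T: True
        have "f w = f u + (\<Sum>b\<in>frame. complex_of_real ((\<phi> w - y) \<bullet> b) * g b (\<phi> w))"
          using g(2)[OF \<beta>S, of w] T True chart_inv(1)[OF ch] by (simp add: lc_def y_def)
        then show ?thesis
          using T by (simp add: \<eta>_def co_def ex_def sum_distrib_left sum_fun_apply algebra_simps)
      qed (auto simp: \<eta>_def co_def ex_def sum_fun_apply)
    qed
    then have "Y (\<eta> * \<eta> * f) = (\<lambda>_. f u) * Y (\<eta> * \<eta>) + (\<Sum>b\<in>frame. Y (?a b * ex (g b)))"
      using Y \<eta> a eg
      by (simp add: vf_add[OF Y] vf_cmult[OF Y] vf_sum_arg[OF AC Y] C_inf_mult[OF AC]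
          C_inf_cmult[OF AC] C_inf_sum[OF AC])
    then have "Y (\<eta> * \<eta> * f) u = f u * Y (\<eta> * \<eta>) u + (\<Sum>b\<in>frame. Y (?a b * ex (g b)) u)"
      by (simp add: sum_fun_apply)
    moreover have "Y (\<eta> * \<eta> * f) = Y (\<eta> * \<eta>) * f + \<eta> * \<eta> * Y f"
      by (rule vf_mult[OF Y C_inf_mult[OF AC \<eta> \<eta>] f])
    ultimately have "\<eta> u * \<eta> u * Y f u = (\<Sum>b\<in>frame. Y (?a b * ex (g b)) u)"
      by (simp add: algebra_simps)
    also have "\<dots> = (\<Sum>b\<in>frame. (Y (co b) u - complex_of_real (y \<bullet> b) * Y \<eta> u) * (\<beta> y * d f y b))"
    proof (rule sum.cong)
      fix b
      have "Y (?a b * ex (g b)) u = Y (?a b) u * ex (g b) u + ?a b u * Y (ex (g b)) u"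
        by (simp add: vf_mult[OF Y a eg] del: plus_fun_apply) simp
      \<comment> \<open>The cut-off coordinate difference vanishes at \<open>u\<close>, so only its
        own derivative survives in the product rule.\<close>
      moreover have "?a b u = 0" using True by (simp add: co_def \<eta>_def ex_def y_def)
      moreover have "Y (?a b) u = Y (co b) u - complex_of_real (y \<bullet> b) * Y \<eta> u"
        by (simp add: vf_add[OF Y co C_inf_cmult[OF AC \<eta>]] vf_cmult[OF Y \<eta>])
      moreover have "ex (g b) u = \<beta> y * d f y b" using True g(3) by (simp add: ex_def y_def)
      ultimately show "Y (?a b * ex (g b)) u = (Y (co b) u - complex_of_real (y \<bullet> b) * Y \<eta> u) * (\<beta> y * d f y b)"
        by simp
    qed simp
    also have "\<dots> = Y \<eta> u * E 0 f u + (\<Sum>b\<in>frame. Y (co b) u * (\<beta> y * d f y b))"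
      using True f by (simp add: E_def vf_def ex_def y_def algebra_simps sum_subtractf sum_distrib_left sum_negf)
    also have "(\<Sum>b\<in>frame. Y (co b) u * (\<beta> y * d f y b)) = (\<Sum>b\<in>frame. Y (x b) u * E b f u)"
    proof (rule sum.cong)
      fix b :: 'e assume b: "b \<in> frame"
      then have b0: "b \<noteq> 0" using frame_nonzero by metis
      have "(\<Sum>c\<in>frame. (if c = b then 1 else 0) * d f y c) = d f y b"
        using b by (simp add: if_distrib[of "\<lambda>t. t * _"] cong: if_cong)
      then show "Y (co b) u * (\<beta> y * d f y b) = Y (x b) u * E b f u"
        using b0 True f by (simp add: E_def x_def vf_def ex_def y_def)
    qed simp
    finally show ?thesis
      by (simp add: x_def sum.insert[OF finite_frame_finite frame_nonzero])
  qed
  show ?thesis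
  proof (rule that[of "\<eta> * \<eta>" "insert 0 frame" x E])
    show "(\<eta> * \<eta>) m \<noteq> 0" using U(2) \<beta>(2) R(1) by (simp add: \<eta>_def ex_def)
    show "\<eta> * \<eta> * Y f = (\<Sum>i\<in>insert 0 frame. Y (x i) * E i f)"
      if "Y \<in> vector_fields A" "f \<in> C_inf A" for Y f
      using main[OF that] by (auto simp: fun_eq_iff sum_fun_apply simp del: sum.insert)
  qed (auto simp: x_def \<eta> co E C_inf_mult[OF AC])
qed

section \<open>First and second order of a bimodule deformation\<close>

text \<open>The part of \<open>bidifferential\<close> on which the comparison of coefficients rests.
  It also covers the operators of order 0 of a deformation, for which
  \<open>invariant_bimodule_deformation\<close> gives only a formula.\<close>

definition bilinear_op ::
  "('m1, 'e1::real_normed_vector) atlas \<Rightarrow> ('m2, 'e2::real_normed_vector) atlas \<Rightarrow>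
   ('n, 'f::real_normed_vector) atlas \<Rightarrow>
   (('m1 \<Rightarrow> complex) \<Rightarrow> ('m2 \<Rightarrow> complex) \<Rightarrow> ('n \<Rightarrow> complex)) \<Rightarrow> bool" where
  "bilinear_op A1 A2 B D \<longleftrightarrow>
     (\<forall>a\<in>C_inf A1. \<forall>b\<in>C_inf A2. D a b \<in> C_inf B) \<and>
     (\<forall>a\<in>C_inf A1. \<forall>a'\<in>C_inf A1. \<forall>b\<in>C_inf A2. D (a + a') b = D a b + D a' b) \<and>
     (\<forall>a\<in>C_inf A1. \<forall>b\<in>C_inf A2. \<forall>b'\<in>C_inf A2. D a (b + b') = D a b + D a b') \<and>
     (\<forall>c. \<forall>a\<in>C_inf A1. \<forall>b\<in>C_inf A2.
        D ((\<lambda>_. c) * a) b = (\<lambda>_. c) * D a b \<and> D a ((\<lambda>_. c) * b) = (\<lambda>_. c) * D a b)"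

lemma bidifferential_bilinear_op: "bidifferential A1 A2 B q1 q2 D \<Longrightarrow> bilinear_op A1 A2 B D"
  unfolding bidifferential_def bilinear_op_def by (elim conjE) (intro conjI)

lemma bilinear_opD:
  assumes "bilinear_op A1 A2 B D" "a \<in> C_inf A1" "b \<in> C_inf A2"
  shows bilinear_op_C_inf: "D a b \<in> C_inf B"
    and bilinear_op_add_left: "a' \<in> C_inf A1 \<Longrightarrow> D (a + a') b = D a b + D a' b"
    and bilinear_op_add_right: "b' \<in> C_inf A2 \<Longrightarrow> D a (b + b') = D a b + D a b'"
    and bilinear_op_cmult_left: "D ((\<lambda>_. c) * a) b = (\<lambda>_. c) * D a b"
    and bilinear_op_cmult_right: "D a ((\<lambda>_. c) * b) = (\<lambda>_. c) * D a b"
  using assms by (auto simp: bilinear_op_def)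

section \<open>Coefficients of formal products with constant series\<close>

lemma formal_C_inf_const:
  "covering_charts A \<Longrightarrow> a \<in> C_inf A \<Longrightarrow> fps_const a \<in> formal_C_inf A"
  by (simp add: formal_C_inf_def C_inf_zero)

lemma formal_C_inf_nth: "x \<in> formal_C_inf A \<Longrightarrow> fps_nth x n \<in> C_inf A"
  by (simp add: formal_C_inf_def)

context
  fixes A1 :: "('m1::topological_space, 'e1::real_normed_vector) atlas"
    and A2 :: "('m2::topological_space, 'e2::real_normed_vector) atlas"
    and B :: "('n::topological_space, 'f::real_normed_vector) atlas"
  assumes A1: "covering_charts A1" and A2: "covering_charts A2" and B: "covering_charts B"
begin

lemma bilinear_op_zero_left: "bilinear_op A1 A2 B D \<Longrightarrow> b \<in> C_inf A2 \<Longrightarrow> D 0 b = 0"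
  and bilinear_op_zero_right: "bilinear_op A1 A2 B D \<Longrightarrow> a \<in> C_inf A1 \<Longrightarrow> D a 0 = 0"
  using bilinear_op_add_left[of A1 A2 B D 0 b 0] bilinear_op_add_right[of A1 A2 B D a 0 0]
    C_inf_zero[OF A1] C_inf_zero[OF A2] by auto

lemma bilinear_op_diff_left:
  assumes "bilinear_op A1 A2 B D" "a \<in> C_inf A1" "a' \<in> C_inf A1" "b \<in> C_inf A2"
  shows "D (a - a') b = D a b - D a' b"
  using bilinear_op_add_left[OF assms(1) C_inf_diff[OF A1 assms(2,3)] assms(4,3)]
  by (simp add: algebra_simps)

lemma bilinear_op_diff_right:
  assumes "bilinear_op A1 A2 B D" "a \<in> C_inf A1" "b \<in> C_inf A2" "b' \<in> C_inf A2"
  shows "D a (b - b') = D a b - D a b'"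
  using bilinear_op_add_right[OF assms(1,2) C_inf_diff[OF A2 assms(3,4)] assms(4)]
  by (simp add: algebra_simps)

text \<open>Additive operators send 0 to 0, so the vanishing higher coefficients of a constant
  series collapse the inner sum to one term.\<close>

lemma formal_ext_const_left:
  assumes "\<And>r. bilinear_op A1 A2 B (D r)" "a \<in> C_inf A1" "x \<in> formal_C_inf A2"
  shows "fps_nth (formal_ext D (fps_const a) x) n = (\<Sum>r\<le>n. D r a (fps_nth x (n - r)))"
proof -
  have "(\<Sum>i\<le>n - r. D r (fps_nth (fps_const a) i) (fps_nth x (n - r - i))) = D r a (fps_nth x (n - r))"
    for r
  proof -
    have "(\<Sum>i\<le>n - r. D r (fps_nth (fps_const a) i) (fps_nth x (n - r - i))) =
        (\<Sum>i\<le>n - r. if i = 0 then D r a (fps_nth x (n - r)) else 0)"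
      by (rule sum.cong) (auto simp: bilinear_op_zero_left[OF assms(1)] formal_C_inf_nth[OF assms(3)])
    then show ?thesis by simp
  qed
  then show ?thesis by (simp add: formal_ext_def)
qed

lemma formal_ext_const_right:
  assumes "\<And>r. bilinear_op A1 A2 B (D r)" "b \<in> C_inf A2" "x \<in> formal_C_inf A1"
  shows "fps_nth (formal_ext D x (fps_const b)) n = (\<Sum>r\<le>n. D r (fps_nth x (n - r)) b)"
proof -
  have "(\<Sum>i\<le>n - r. D r (fps_nth x i) (fps_nth (fps_const b) (n - r - i))) = D r (fps_nth x (n - r)) b"
    for r
  proof -
    have "(\<Sum>i\<le>n - r. D r (fps_nth x i) (fps_nth (fps_const b) (n - r - i))) =
        (\<Sum>i\<le>n - r. if i = n - r then D r (fps_nth x (n - r)) b else 0)"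
      by (rule sum.cong) (auto simp: bilinear_op_zero_right[OF assms(1)] formal_C_inf_nth[OF assms(3)])
    then show ?thesis by simp
  qed
  then show ?thesis by (simp add: formal_ext_def)
qed

lemma formal_ext_const:
  assumes "\<And>r. bilinear_op A1 A2 B (D r)" "a \<in> C_inf A1" "b \<in> C_inf A2"
  shows "fps_nth (formal_ext D (fps_const a) (fps_const b)) n = D n a b"
proof -
  have "(\<Sum>r\<le>n. D r a (fps_nth (fps_const b) (n - r))) = (\<Sum>r\<le>n. if r = n then D n a b else 0)"
    by (rule sum.cong) (auto simp: bilinear_op_zero_right[OF assms(1) assms(2)])
  then show ?thesis
    by (simp add: formal_ext_const_left[OF assms(1,2) formal_C_inf_const[OF A2 assms(3)]])
qed

lemma formal_ext_const_C_inf: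
  assumes "\<And>r. bilinear_op A1 A2 B (D r)" "a \<in> C_inf A1" "b \<in> C_inf A2"
  shows "formal_ext D (fps_const a) (fps_const b) \<in> formal_C_inf B"
  using bilinear_op_C_inf[OF assms(1-3)] by (simp add: formal_C_inf_def formal_ext_const[OF assms])

end

text \<open>
  The case \<open>q = id\<close>, \<open>l = \<rho> = C\<close> is the star product algebra as a bimodule over itself; there
  \<open>D_commutator\<close> below is the Jacobi identity of the Poisson bracket.
\<close>

locale bimodule_deformation =
  fixes A :: "('m::topological_space, 'e::real_normed_vector) atlas"
    and B :: "('n::topological_space, 'f::real_normed_vector) atlas"
    and q :: "'n \<Rightarrow> 'm"
    and C :: "nat \<Rightarrow> ('m \<Rightarrow> complex) \<Rightarrow> ('m \<Rightarrow> complex) \<Rightarrow> ('m \<Rightarrow> complex)"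
    and l :: "nat \<Rightarrow> ('m \<Rightarrow> complex) \<Rightarrow> ('n \<Rightarrow> complex) \<Rightarrow> ('n \<Rightarrow> complex)"
    and \<rho> :: "nat \<Rightarrow> ('n \<Rightarrow> complex) \<Rightarrow> ('m \<Rightarrow> complex) \<Rightarrow> ('n \<Rightarrow> complex)"
  assumes A: "covering_charts A" and B: "covering_charts B"
    and q: "a \<in> C_inf A \<Longrightarrow> a \<circ> q \<in> C_inf B"
    and C: "bilinear_op A A A (C r)" and l: "bilinear_op A B B (l r)" and \<rho>: "bilinear_op B A B (\<rho> r)"
    and C0: "a \<in> C_inf A \<Longrightarrow> b \<in> C_inf A \<Longrightarrow> C 0 a b = a * b"
    and l0: "a \<in> C_inf A \<Longrightarrow> s \<in> C_inf B \<Longrightarrow> l 0 a s = (a \<circ> q) * s"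
    and \<rho>0: "a \<in> C_inf A \<Longrightarrow> s \<in> C_inf B \<Longrightarrow> \<rho> 0 s a = s * (a \<circ> q)"
    and left_assoc: "\<lbrakk>x \<in> formal_C_inf A; y \<in> formal_C_inf A; f \<in> formal_C_inf B\<rbrakk> \<Longrightarrow>
      formal_ext l (formal_ext C x y) f = formal_ext l x (formal_ext l y f)"
    and right_assoc: "\<lbrakk>x \<in> formal_C_inf A; y \<in> formal_C_inf A; f \<in> formal_C_inf B\<rbrakk> \<Longrightarrow>
      formal_ext \<rho> f (formal_ext C x y) = formal_ext \<rho> (formal_ext \<rho> f x) y"
    and middle_assoc: "\<lbrakk>x \<in> formal_C_inf A; y \<in> formal_C_inf A; f \<in> formal_C_inf B\<rbrakk> \<Longrightarrow>
      formal_ext \<rho> (formal_ext l x f) y = formal_ext l x (formal_ext \<rho> f y)"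
begin

text \<open>Equal to \<i> times the Poisson bracket of the star product; in this normalisation the
  identities for \<open>D\<close> contain no constants.\<close>

definition br :: "('m \<Rightarrow> complex) \<Rightarrow> ('m \<Rightarrow> complex) \<Rightarrow> ('m \<Rightarrow> complex)" where
  "br a b = C 1 a b - C 1 b a"

definition D :: "('m \<Rightarrow> complex) \<Rightarrow> ('n \<Rightarrow> complex) \<Rightarrow> ('n \<Rightarrow> complex)" where
  "D a s = l 1 a s - \<rho> 1 s a"

lemma left_assoc_nth:
  assumes "a \<in> C_inf A" "b \<in> C_inf A" "s \<in> C_inf B"
  shows "(\<Sum>r\<le>n. l r (C (n - r) a b) s) = (\<Sum>r\<le>n. l r a (l (n - r) b s))"
proof -
  have "fps_nth (formal_ext l (formal_ext C (fps_const a) (fps_const b)) (fps_const s)) n =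
      fps_nth (formal_ext l (fps_const a) (formal_ext l (fps_const b) (fps_const s))) n"
    using assms by (simp add: left_assoc formal_C_inf_const A B)
  then show ?thesis
    using assms
    by (simp add: formal_ext_const_right[OF A B B l] formal_ext_const_left[OF A B B l]
        formal_ext_const[OF A B B l] formal_ext_const[OF A A A C]
        formal_ext_const_C_inf[OF A A A C] formal_ext_const_C_inf[OF A B B l])
qed

lemma right_assoc_nth:
  assumes "a \<in> C_inf A" "b \<in> C_inf A" "s \<in> C_inf B"
  shows "(\<Sum>r\<le>n. \<rho> r s (C (n - r) a b)) = (\<Sum>r\<le>n. \<rho> r (\<rho> (n - r) s a) b)"
proof -
  have "fps_nth (formal_ext \<rho> (fps_const s) (formal_ext C (fps_const a) (fps_const b))) n =
      fps_nth (formal_ext \<rho> (formal_ext \<rho> (fps_const s) (fps_const a)) (fps_const b)) n"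
    using assms by (simp add: right_assoc formal_C_inf_const A B)
  then show ?thesis
    using assms
    by (simp add: formal_ext_const_right[OF B A B \<rho>] formal_ext_const_left[OF B A B \<rho>]
        formal_ext_const[OF B A B \<rho>] formal_ext_const[OF A A A C]
        formal_ext_const_C_inf[OF A A A C] formal_ext_const_C_inf[OF B A B \<rho>])
qed

lemma middle_assoc_nth:
  assumes "a \<in> C_inf A" "b \<in> C_inf A" "s \<in> C_inf B"
  shows "(\<Sum>r\<le>n. \<rho> r (l (n - r) a s) b) = (\<Sum>r\<le>n. l r a (\<rho> (n - r) s b))"
proof -
  have "fps_nth (formal_ext \<rho> (formal_ext l (fps_const a) (fps_const s)) (fps_const b)) n =
      fps_nth (formal_ext l (fps_const a) (formal_ext \<rho> (fps_const s) (fps_const b))) n"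
    using assms by (simp add: middle_assoc formal_C_inf_const A B)
  then show ?thesis
    using assms
    by (simp add: formal_ext_const_right[OF B A B \<rho>] formal_ext_const_left[OF A B B l]
        formal_ext_const[OF B A B \<rho>] formal_ext_const[OF A B B l]
        formal_ext_const_C_inf[OF A B B l] formal_ext_const_C_inf[OF B A B \<rho>])
qed

lemma closure:
  shows C_closed: "a \<in> C_inf A \<Longrightarrow> b \<in> C_inf A \<Longrightarrow> C r a b \<in> C_inf A"
    and l_closed: "a \<in> C_inf A \<Longrightarrow> s \<in> C_inf B \<Longrightarrow> l r a s \<in> C_inf B"
    and \<rho>_closed: "a \<in> C_inf A \<Longrightarrow> s \<in> C_inf B \<Longrightarrow> \<rho> r s a \<in> C_inf B"
    and br_closed: "a \<in> C_inf A \<Longrightarrow> b \<in> C_inf A \<Longrightarrow> br a b \<in> C_inf A"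
    and D_closed: "a \<in> C_inf A \<Longrightarrow> s \<in> C_inf B \<Longrightarrow> D a s \<in> C_inf B"
  unfolding br_def D_def
  by (intro bilinear_op_C_inf[OF C] bilinear_op_C_inf[OF l] bilinear_op_C_inf[OF \<rho>]
      C_inf_diff[OF A] C_inf_diff[OF B]; assumption)+

lemma D_add_left: "a \<in> C_inf A \<Longrightarrow> b \<in> C_inf A \<Longrightarrow> s \<in> C_inf B \<Longrightarrow> D (a + b) s = D a s + D b s"
  and D_add_right: "a \<in> C_inf A \<Longrightarrow> s \<in> C_inf B \<Longrightarrow> t \<in> C_inf B \<Longrightarrow> D a (s + t) = D a s + D a t"
  and D_cmult_left: "a \<in> C_inf A \<Longrightarrow> s \<in> C_inf B \<Longrightarrow> D ((\<lambda>_. c) * a) s = (\<lambda>_. c) * D a s"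
  by (simp_all add: D_def bilinear_opD[OF l] bilinear_opD[OF \<rho>] right_diff_distrib)

lemmas diffs = bilinear_op_diff_left[OF A B B l] bilinear_op_diff_right[OF A B B l]
  bilinear_op_diff_left[OF B A B \<rho>] bilinear_op_diff_right[OF B A B \<rho>]

lemmas closed_intros = A B q closure C_inf_mult[OF A] C_inf_mult[OF B]

text \<open>Degree 1 of the left, right and middle associativity law, in this order, each solved for
  one term so that unfolding them in \<open>D\<close> leaves only commutative algebra.\<close>

lemma first_order:
  assumes a: "a \<in> C_inf A" and b: "b \<in> C_inf A" and s: "s \<in> C_inf B"
  shows "l 1 (a * b) s = (a \<circ> q) * l 1 b s + l 1 a ((b \<circ> q) * s) - (C 1 a b \<circ> q) * s"
    and "\<rho> 1 s (a * b) = (b \<circ> q) * \<rho> 1 s a + \<rho> 1 ((a \<circ> q) * s) b - (C 1 a b \<circ> q) * s"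
    and "l 1 a ((b \<circ> q) * s) = (b \<circ> q) * l 1 a s + \<rho> 1 ((a \<circ> q) * s) b - (a \<circ> q) * \<rho> 1 s b"
  using left_assoc_nth[OF assms, of 1] right_assoc_nth[OF assms, of 1] middle_assoc_nth[OF assms, of 1]
  by (simp_all add: C0 l0 \<rho>0 closed_intros assms algebra_simps)

text \<open>In the difference of the left and right laws the two terms with \<open>C 1 a b\<close>
  cancel, and the middle law cancels \<open>\<rho> 1 ((a \<circ> q) * s) b\<close>, leaving the
  symmetric product rule.\<close>

lemma D_mult:
  assumes a: "a \<in> C_inf A" and b: "b \<in> C_inf A" and s: "s \<in> C_inf B"
  shows "D (a * b) s = (a \<circ> q) * D b s + (b \<circ> q) * D a s"
  unfolding D_def first_order(1,2)[OF assms] first_order(3)[OF assms] by (simp add: algebra_simps)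

lemma D_leibniz:
  assumes a: "a \<in> C_inf A" and b: "b \<in> C_inf A" and s: "s \<in> C_inf B"
  shows "D a ((b \<circ> q) * s) = (b \<circ> q) * D a s + (br a b \<circ> q) * s"
proof -
  \<comment> \<open>The right law is used for the pair \<open>b\<close>, \<open>a\<close>. As
    \<open>a * b = b * a\<close>, it can be combined with the law for \<open>a\<close>,
    \<open>b\<close> below, and the two correction terms \<open>C 1 a b\<close> and
    \<open>C 1 b a\<close> form the bracket.\<close>
  have 1: "\<rho> 1 ((b \<circ> q) * s) a = \<rho> 1 s (a * b) - (a \<circ> q) * \<rho> 1 s b + (C 1 b a \<circ> q) * s"
    using first_order(2)[OF b a s] by (simp add: mult.commute)
  have 2: "(br a b \<circ> q) = (C 1 a b \<circ> q) - (C 1 b a \<circ> q)"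
    by (simp add: br_def fun_eq_iff)
  show ?thesis
    unfolding D_def first_order(3)[OF assms] 1 first_order(2)[OF assms] 2
    by (simp add: algebra_simps)
qed

text \<open>Degree 2 of the three associativity laws rewrites the compositions of first-order
  operators in \<open>D a (D b s)\<close>. All terms with \<open>l 2\<close>,
  \<open>\<rho> 2\<close> or \<open>C 2\<close>, and the remaining terms
  \<open>\<rho> 1 (l 1 a s) b\<close> and \<open>\<rho> 1 (l 1 b s) a\<close>, enter symmetrically
  in \<open>a\<close> and \<open>b\<close>. Antisymmetrising leaves \<open>l 1\<close> and
  \<open>\<rho> 1\<close> applied to \<open>C 1 a b - C 1 b a\<close>.\<close>

lemma D_commutator:
  assumes a: "a \<in> C_inf A" and b: "b \<in> C_inf A" and s: "s \<in> C_inf B"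
  shows "D a (D b s) - D b (D a s) = D (br a b) s"
proof -
  have L: "l 1 a (l 1 b s) = l 2 (a * b) s + l 1 (C 1 a b) s + (C 2 a b \<circ> q) * s
      - (a \<circ> q) * l 2 b s - l 2 a ((b \<circ> q) * s)"
    if "a \<in> C_inf A" "b \<in> C_inf A" for a b
    using left_assoc_nth[OF that s, of 2]
    by (simp add: numeral_2_eq_2 C0 l0 closed_intros that s algebra_simps)
  have R: "\<rho> 1 (\<rho> 1 s a) b = \<rho> 2 s (a * b) + \<rho> 1 s (C 1 a b) + (C 2 a b \<circ> q) * s
      - (b \<circ> q) * \<rho> 2 s a - \<rho> 2 ((a \<circ> q) * s) b"
    if "a \<in> C_inf A" "b \<in> C_inf A" for a b
    using right_assoc_nth[OF that s, of 2]
    by (simp add: numeral_2_eq_2 C0 \<rho>0 closed_intros that s algebra_simps)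
  have M: "l 1 a (\<rho> 1 s b) = \<rho> 2 ((a \<circ> q) * s) b + \<rho> 1 (l 1 a s) b + (b \<circ> q) * l 2 a s
      - (a \<circ> q) * \<rho> 2 s b - l 2 a ((b \<circ> q) * s)"
    if "a \<in> C_inf A" "b \<in> C_inf A" for a b
    using middle_assoc_nth[OF that s, of 2]
    by (simp add: numeral_2_eq_2 l0 \<rho>0 closed_intros that s algebra_simps)
  have E: "D a (D b s) = l 1 a (l 1 b s) - l 1 a (\<rho> 1 s b) - \<rho> 1 (l 1 b s) a + \<rho> 1 (\<rho> 1 s b) a"
    if "a \<in> C_inf A" "b \<in> C_inf A" for a b
    using that s by (simp add: D_def diffs closed_intros)
  have F: "D (br a b) s = l 1 (C 1 a b) s - l 1 (C 1 b a) s - \<rho> 1 s (C 1 a b) + \<rho> 1 s (C 1 b a)"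
    using a b s by (simp add: D_def br_def diffs closed_intros)
  show ?thesis
    unfolding E[OF a b] E[OF b a] F L[OF a b] L[OF b a] R[OF a b] R[OF b a] M[OF a b] M[OF b a]
    by (simp add: algebra_simps)
qed

end

section \<open>Principal bundles and equivariant functions\<close>

lemma C_inf_continuous:
  fixes A :: "('m::t2_space, 'e::real_normed_vector) atlas"
  assumes A: "covering_charts A" and f: "f \<in> C_inf A" shows "continuous_on UNIV f"
proof -
  have "isCont f x" for x
  proof -
    obtain U \<phi> where U: "(U, \<phi>) \<in> A" "x \<in> U" using covering_chartsE[OF A] .
    note ch = covering_chartsD[OF A U(1)]
    have "continuous_on (\<phi> ` U) (f \<circ> inv_into U \<phi>)"
      using f U(1) unfolding C_inf_def by (blast intro: smooth_on_continuous)
    then have "continuous_on U (\<lambda>x. (f \<circ> inv_into U \<phi>) (\<phi> x))"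
      by (rule continuous_on_compose2[OF _ chart_open(3)[OF ch]]) simp
    then have "continuous_on U f"
      by (rule continuous_on_eq) (simp add: chart_inv(1)[OF ch])
    then show ?thesis
      using chart_open(1)[OF ch] U(2) by (simp add: continuous_on_eq_continuous_at)
  qed
  then show ?thesis by (simp add: continuous_at_imp_continuous_on)
qed

text \<open>Near \<open>x\<close> the function is the quotient of \<open>f * t\<close> by
  \<open>t\<close>. This gives smoothness of functions defined pointwise by division by a section or
  cosection that depends on the point.\<close>

lemma C_inf_local_quotient:
  fixes A :: "('m::t2_space, 'e::real_normed_vector) atlas"
  assumes A: "covering_charts A"
    and loc: "\<And>x. \<exists>t\<in>C_inf A. t x \<noteq> 0 \<and> f * t \<in> C_inf A"
  shows "f \<in> C_inf A"
  unfolding C_inf_iff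
proof (rule C_inf_on_local[OF A])
  fix x
  obtain t where t: "t \<in> C_inf A" "t x \<noteq> 0" "f * t \<in> C_inf A" using loc by blast
  let ?T = "{y. t y \<noteq> 0}"
  have T: "open ?T"
    using C_inf_continuous[OF A t(1)] by (intro open_Collect_neq continuous_intros)
  have "C_inf_on A ?T (\<lambda>y. (f * t) y / t y)"
    using t by (intro C_inf_on_divide[OF A T] C_inf_imp_on[of "f * t"] C_inf_imp_on[of t]) auto
  then have "C_inf_on A ?T f"
    by (rule C_inf_on_cong[OF A T, rotated]) auto
  then show "\<exists>T. open T \<and> x \<in> T \<and> C_inf_on A T f" using T t(2) by blast
qed

lemma C_inf_on_snd:
  fixes B :: "('n::topological_space, 'f::{real_inner, heine_borel}) atlas"
  assumes A: "covering_charts A" and B: "covering_charts B" and f: "f \<in> C_inf B"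
  shows "C_inf_on (prod_atlas A B) UNIV (\<lambda>z. f (snd z))"
  unfolding C_inf_on_def prod_atlas_def
proof clarsimp
  fix U \<phi> V \<psi> assume U: "(U, \<phi>) \<in> A" and V: "(V, \<psi>) \<in> B"
  note chU = covering_chartsD[OF A U] and chV = covering_chartsD[OF B V]
  have im: "map_prod \<phi> \<psi> ` (U \<times> V) = \<phi> ` U \<times> \<psi> ` V" by auto
  have op: "open (\<phi> ` U \<times> \<psi> ` V)" using chart_open(2)[OF chU] chart_open(2)[OF chV] by (rule open_Times)
  have "smooth_on (\<psi> ` V) (f \<circ> inv_into V \<psi>)" using f V by (auto simp: C_inf_def)
  then have "smooth_on (\<phi> ` U \<times> \<psi> ` V) (\<lambda>z. (f \<circ> inv_into V \<psi>) (snd z))"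
    by (rule smooth_on_compose[OF op chart_open(2)[OF chV] smooth_on_bounded_linear[OF bounded_linear_snd]])
      auto
  then show "smooth_on (map_prod \<phi> \<psi> ` (U \<times> V)) ((\<lambda>z. f (snd z)) \<circ> inv_into (U \<times> V) (map_prod \<phi> \<psi>))"
    unfolding im using smooth_on_cong[OF op, of "\<lambda>z. (f \<circ> inv_into V \<psi>) (snd z)"
        "(\<lambda>z. f (snd z)) \<circ> inv_into (U \<times> V) (map_prod \<phi> \<psi>)"]
      prod_atlas_charts(2)[OF A B U V] by simp
qed

text \<open>Restriction along the embedding of a slice of a product. With the unit of the group for
  \<open>c\<close> it describes functions along a local section of the bundle.\<close>

lemma C_inf_on_slice:
  fixes A :: "('m::topological_space, 'e::{real_inner, heine_borel}) atlas"
    and B :: "('n::topological_space, 'f::{real_inner, heine_borel}) atlas"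
  assumes A: "covering_charts A" and B: "covering_charts B" and S: "open S"
    and G: "C_inf_on (prod_atlas A B) (S \<times> UNIV) G"
  shows "C_inf_on A S (\<lambda>x. G (x, c))"
  unfolding C_inf_on_def
proof clarify
  fix U \<phi> assume U: "(U, \<phi>) \<in> A"
  obtain V \<psi> where V: "(V, \<psi>) \<in> B" "c \<in> V" using covering_chartsE[OF B] .
  note chU = covering_chartsD[OF A U] and chV = covering_chartsD[OF B V(1)]
  let ?W = "\<phi> ` (U \<inter> S) \<times> \<psi> ` V"
  let ?inv = "inv_into (U \<times> V) (map_prod \<phi> \<psi>)"
  have op: "open (\<phi> ` (U \<inter> S))" "open ?W"
    using chart_open_image[OF chU S] chart_open(2)[OF chV] by (auto intro: open_Times)
  have "(U \<times> V, map_prod \<phi> \<psi>) \<in> prod_atlas A B" using U V by (auto simp: prod_atlas_def)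
  then have "smooth_on (map_prod \<phi> \<psi> ` ((U \<times> V) \<inter> (S \<times> UNIV))) (G \<circ> ?inv)"
    by (rule C_inf_onD[OF G])
  moreover have "map_prod \<phi> \<psi> ` ((U \<times> V) \<inter> (S \<times> UNIV)) = ?W" by auto
  ultimately have 1: "smooth_on ?W (G \<circ> ?inv)" by simp
  have "smooth_on (\<phi> ` (U \<inter> S)) (\<lambda>z. (z, 0) + (0, \<psi> c))"
    by (intro smooth_on_add op smooth_on_const smooth_on_bounded_linear
        bounded_linear_Pair bounded_linear_ident bounded_linear_zero)
  then have "smooth_on (\<phi> ` (U \<inter> S)) (\<lambda>z. (z, \<psi> c))" by simp
  then have "smooth_on (\<phi> ` (U \<inter> S)) (\<lambda>z. (G \<circ> ?inv) (z, \<psi> c))"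
    by (rule smooth_on_compose[OF op _ 1]) (use V(2) in auto)
  moreover have "(G \<circ> ?inv) (z, \<psi> c) = ((\<lambda>x. G (x, c)) \<circ> inv_into U \<phi>) z"
    if "z \<in> \<phi> ` (U \<inter> S)" for z
    using that prod_atlas_charts(2)[OF A B U V(1), of "(z, \<psi> c)"] chart_inv(1)[OF chV V(2)] V(2)
    by auto
  ultimately show "smooth_on (\<phi> ` (U \<inter> S)) ((\<lambda>x. G (x, c)) \<circ> inv_into U \<phi>)"
    using smooth_on_cong[OF op(1)] by (metis (no_types, lifting))
qed

section \<open>Representations, invariant functions and equivariant functions\<close>

lemma representation_nonzero:
  assumes "group gmul e iv" "representation_on_C AG gmul e \<kappa>" shows "\<kappa> g \<noteq> 0"
proof -
  interpret group gmul e iv by (rule assms(1))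
  have "\<kappa> (iv g) * \<kappa> g = \<kappa> (gmul (iv g) g)" "\<kappa> e = 1"
    using assms(2) unfolding representation_on_C_def by metis+
  then show ?thesis by auto
qed

lemma representation_inverse:
  assumes "covering_charts AG" "group gmul e iv" "representation_on_C AG gmul e \<kappa>"
  shows "representation_on_C AG gmul e (\<lambda>g. inverse (\<kappa> g))"
  using assms(3) representation_nonzero[OF assms(2,3)] C_inf_on_inverse[OF assms(1) open_UNIV, of \<kappa>]
  by (auto simp: representation_on_C_def C_inf_iff)

context
  fixes AM :: "('m::{t2_space, second_countable_topology}, 'e::{real_inner, heine_borel}) atlas"
    and AP :: "('p::{t2_space, second_countable_topology}, 'q::{real_inner, heine_borel}) atlas"
    and AG :: "('g::{t2_space, second_countable_topology}, 'k::{real_inner, heine_borel}) atlas"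
    and gmul :: "'g \<Rightarrow> 'g \<Rightarrow> 'g" and e :: 'g and iv :: "'g \<Rightarrow> 'g"
    and p :: "'p \<Rightarrow> 'm" and act :: "'p \<Rightarrow> 'g \<Rightarrow> 'p"
  assumes pb: "principal_bundle AM AP AG gmul e iv p act"
begin

lemma bundle_charts: "covering_charts AM" "covering_charts AP" "covering_charts AG"
  "group gmul e iv" "smooth_manifold AM"
  using pb by (auto simp: principal_bundle_def lie_group_def smooth_manifold_charts)

lemma bundle_p_act: "p (act x g) = p x"
  using pb by (simp add: principal_bundle_def)

lemma bundle_trivialization:
  obtains U \<Phi> \<Psi> where "m \<in> U" "local_trivialization AM AP AG gmul p act U \<Phi> \<Psi>"
  using pb unfolding principal_bundle_def by meson

lemma C_inf_pullback: assumes "h \<in> C_inf AM" shows "h \<circ> p \<in> C_inf AP"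
proof -
  have "smooth_map_on AP AM UNIV p" using pb by (simp add: principal_bundle_def)
  then have "C_inf_on AP UNIV (\<lambda>x. h (p x))"
    using C_inf_on_compose[OF bundle_charts(2,1) open_UNIV open_UNIV] assms by (simp add: C_inf_iff)
  then show ?thesis by (simp add: C_inf_iff comp_def)
qed

lemma bundle_surj: "\<exists>x. p x = m"
proof -
  obtain U \<Phi> \<Psi> where U: "m \<in> U" "local_trivialization AM AP AG gmul p act U \<Phi> \<Psi>"
    using bundle_trivialization .
  then have "p (\<Psi> (m, e)) = m" unfolding local_trivialization_def by simp
  then show ?thesis by blast
qed

lemma bundle_fibre_transitive: assumes "p x = p y" shows "\<exists>g. act x g = y"
proof -
  interpret group gmul e iv by (rule bundle_charts)
  obtain U \<Phi> \<Psi> where U: "p x \<in> U" and triv: "local_trivialization AM AP AG gmul p act U \<Phi> \<Psi>"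
    using bundle_trivialization .
  have inv: "fst (\<Phi> z) = p z" "\<Psi> (\<Phi> z) = z" if "p z \<in> U" for z
    using triv that by (auto simp: local_trivialization_def)
  define g where "g = gmul (iv (snd (\<Phi> x))) (snd (\<Phi> y))"
  have "\<Phi> (act x g) = (p x, gmul (snd (\<Phi> x)) g)"
    using triv U by (auto simp: local_trivialization_def)
  also have "\<dots> = (p y, snd (\<Phi> y))"
    using assms by (simp add: g_def assoc[symmetric] right_inverse left_neutral)
  also have "\<dots> = \<Phi> y" using inv(1)[of y] assms U by (metis prod.collapse)
  finally have "\<Psi> (\<Phi> (act x g)) = \<Psi> (\<Phi> y)" by simp
  then show ?thesis using inv(2)[of y] inv(2)[of "act x g"] assms U bundle_p_act by metis
qed

text \<open>Transitivity on fibres gives the function on the base. Over a trivialising set it is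
  \<open>f\<close> composed with the local section \<open>\<Psi> (y, e)\<close>, hence
  smooth.\<close>

lemma invariant_descends:
  assumes f: "f \<in> C_inf AP" and inv: "\<And>x g. f (act x g) = f x"
  obtains h where "h \<in> C_inf AM" "f = h \<circ> p"
proof
  define h where "h m = f (SOME x. p x = m)" for m
  have h: "h (p x) = f x" for x
  proof -
    have "p (SOME y. p y = p x) = p x" by (rule someI) (rule refl)
    then show ?thesis using bundle_fibre_transitive inv unfolding h_def by metis
  qed
  then show "f = h \<circ> p" by auto
  show "h \<in> C_inf AM"
    unfolding C_inf_iff
  proof (rule C_inf_on_local[OF bundle_charts(1)])
    fix m
    obtain U \<Phi> \<Psi> where U: "m \<in> U" and triv: "local_trivialization AM AP AG gmul p act U \<Phi> \<Psi>"
      using bundle_trivialization .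
    have op: "open U" and \<Psi>: "smooth_map_on (prod_atlas AM AG) AP (U \<times> UNIV) \<Psi>"
      and p\<Psi>: "\<And>y. y \<in> U \<Longrightarrow> p (\<Psi> (y, e)) = y"
      using triv by (auto simp: local_trivialization_def)
    have "C_inf_on (prod_atlas AM AG) (U \<times> UNIV) (\<lambda>z. f (\<Psi> z))"
      by (rule C_inf_on_compose[OF prod_atlas_charts(1)[OF bundle_charts(1,3)] bundle_charts(2)
            open_Times[OF op open_UNIV] open_UNIV \<Psi>])
        (use f in \<open>auto simp: C_inf_iff\<close>)
    then have "C_inf_on AM U (\<lambda>y. f (\<Psi> (y, e)))"
      by (rule C_inf_on_slice[OF bundle_charts(1,3) op])
    then have "C_inf_on AM U h"
      by (rule C_inf_on_cong[OF bundle_charts(1) op, rotated]) (metis h p\<Psi>)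
    then show "\<exists>T. open T \<and> m \<in> T \<and> C_inf_on AM T h" using U op by blast
  qed
qed

text \<open>In a trivialisation, the inverse of \<kappa> of the group coordinate is equivariant and
  has no zeros. Multiplying it by a bump function pulled back from the base keeps it equivariant and
  allows extension by 0.\<close>

lemma nonvanishing_section:
  assumes \<kappa>: "representation_on_C AG gmul e \<kappa>"
  obtains u where "u \<in> line_bundle_sections AP act \<kappa>" "u x \<noteq> 0"
proof -
  obtain U \<Phi> \<Psi> where U: "p x \<in> U" and triv: "local_trivialization AM AP AG gmul p act U \<Phi> \<Psi>"
    using bundle_trivialization .
  have op: "open U" and \<Phi>: "smooth_map_on AP (prod_atlas AM AG) (p -` U) \<Phi>"
    and equi: "\<And>y g. p y \<in> U \<Longrightarrow> \<Phi> (act y g) = (p y, gmul (snd (\<Phi> y)) g)"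
    using triv by (auto simp: local_trivialization_def)
  obtain \<eta> K where \<eta>: "\<eta> \<in> C_inf AM" "\<eta> (p x) \<noteq> 0" "closed K" "K \<subseteq> U" "\<And>y. y \<notin> K \<Longrightarrow> \<eta> y = 0"
    using smooth_manifold_bump[OF bundle_charts(5) op U] by blast
  have pc: "continuous_on UNIV p" using pb by (simp add: principal_bundle_def smooth_map_on_def)
  have opP: "open (p -` U)" "closed (p -` K)"
    using pc op \<eta>(3) by (simp_all add: open_vimage closed_vimage)
  note \<kappa>0 = representation_nonzero[OF bundle_charts(4) \<kappa>]
  define u where "u y = (if p y \<in> U then \<eta> (p y) * inverse (\<kappa> (snd (\<Phi> y))) else 0)" for y
  have "\<kappa> \<in> C_inf AG" using \<kappa> by (simp add: representation_on_C_def)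
  then have "C_inf_on AP (p -` U) (\<lambda>y. \<kappa> (snd (\<Phi> y)))"
    by (intro C_inf_on_compose[OF bundle_charts(2) prod_atlas_charts(1)[OF bundle_charts(1,3)] opP(1)
          open_UNIV \<Phi> _ C_inf_on_snd[OF bundle_charts(1,3)]]) auto
  then have "C_inf_on AP (p -` U) (\<lambda>y. (\<eta> \<circ> p) y * inverse (\<kappa> (snd (\<Phi> y))))"
    by (intro C_inf_on_mult[OF bundle_charts(2) opP(1)] C_inf_on_inverse[OF bundle_charts(2) opP(1)]
        C_inf_imp_on[OF C_inf_pullback[OF \<eta>(1)]] \<kappa>0)
  then have "C_inf_on AP (p -` U) u"
    by (rule C_inf_on_cong[OF bundle_charts(2) opP(1), rotated]) (simp add: u_def)
  then have "u \<in> C_inf AP"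
    by (rule C_inf_zero_extension[OF bundle_charts(2) opP, rotated]) (use \<eta>(4,5) in \<open>auto simp: u_def\<close>)
  moreover have "u (act y g) = inverse (\<kappa> g) * u y" for y g
    using \<kappa> by (simp add: u_def bundle_p_act equi representation_on_C_def)
  ultimately have "u \<in> line_bundle_sections AP act \<kappa>" by (simp add: line_bundle_sections_def)
  moreover have "u x \<noteq> 0" using U \<eta>(2) \<kappa>0 by (simp add: u_def)
  ultimately show ?thesis by (rule that)
qed

end

section \<open>The flat connection of an invariant deformation\<close>

locale line_bundle =
  fixes AM :: "('m::{t2_space, second_countable_topology}, 'e::{real_inner, heine_borel}) atlas"
    and AP :: "('p::{t2_space, second_countable_topology}, 'q::{real_inner, heine_borel}) atlas"
    and AG :: "('g::{t2_space, second_countable_topology}, 'k::{real_inner, heine_borel}) atlas"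
    and gmul :: "'g \<Rightarrow> 'g \<Rightarrow> 'g" and e :: 'g and iv :: "'g \<Rightarrow> 'g"
    and p :: "'p \<Rightarrow> 'm" and act :: "'p \<Rightarrow> 'g \<Rightarrow> 'p" and \<kappa> :: "'g \<Rightarrow> complex"
  assumes pb: "principal_bundle AM AP AG gmul e iv p act"
    and rep: "representation_on_C AG gmul e \<kappa>"
begin

lemmas AM = bundle_charts(1)[OF pb] and AP = bundle_charts(2)[OF pb]

definition sections :: "('p \<Rightarrow> complex) set" where
  "sections = line_bundle_sections AP act \<kappa>"

text \<open>Sections of the dual line bundle: their products with sections are invariant and so
  descend to functions on the base.\<close>

definition cosections :: "('p \<Rightarrow> complex) set" where
  "cosections = line_bundle_sections AP act (\<lambda>g. inverse (\<kappa> g))"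

lemma sections_iff: "s \<in> sections \<longleftrightarrow> s \<in> C_inf AP \<and> (\<forall>x g. s (act x g) = inverse (\<kappa> g) * s x)"
  and cosections_iff: "t \<in> cosections \<longleftrightarrow> t \<in> C_inf AP \<and> (\<forall>x g. t (act x g) = \<kappa> g * t x)"
  by (simp_all add: sections_def cosections_def line_bundle_sections_def)

lemma \<kappa>_nonzero: "\<kappa> g \<noteq> 0"
  by (rule representation_nonzero[OF bundle_charts(4)[OF pb] rep])

lemma section_nonzero: obtains u where "u \<in> sections" "u x \<noteq> 0"
  unfolding sections_def by (rule nonvanishing_section[OF pb rep])

lemma cosection_nonzero: obtains t where "t \<in> cosections" "t x \<noteq> 0"
  unfolding cosections_def
  by (rule nonvanishing_section[OF pb representation_inverse[OF bundle_charts(3,4)[OF pb] rep]])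

lemma pullback_C_inf: "h \<in> C_inf AM \<Longrightarrow> h \<circ> p \<in> C_inf AP"
  by (rule C_inf_pullback[OF pb])

lemma sections_add: "s \<in> sections \<Longrightarrow> s' \<in> sections \<Longrightarrow> s + s' \<in> sections"
  and sections_diff: "s \<in> sections \<Longrightarrow> s' \<in> sections \<Longrightarrow> s - s' \<in> sections"
  by (auto simp: sections_iff C_inf_add[OF AP] C_inf_diff[OF AP] algebra_simps)

lemma sections_mult: "h \<in> C_inf AM \<Longrightarrow> s \<in> sections \<Longrightarrow> (h \<circ> p) * s \<in> sections"
  using bundle_p_act[OF pb] by (auto simp: sections_iff C_inf_mult[OF AP] pullback_C_inf)

lemma section_eqI:
  assumes "\<And>t. t \<in> cosections \<Longrightarrow> f * t = g * t" shows "f = g"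
proof
  fix x
  obtain t where t: "t \<in> cosections" "t x \<noteq> 0" by (rule cosection_nonzero)
  then have "f x * t x = g x * t x" using assms[OF t(1)] by (metis times_fun_apply)
  then show "f x = g x" using t by simp
qed

lemma pullback_inj:
  assumes "h \<circ> p = h' \<circ> p" shows "h = h'"
proof
  fix m
  obtain x where "p x = m" using bundle_surj[OF pb] by blast
  then show "h m = h' m" using assms by (metis comp_apply)
qed

lemma pullback_eqI:
  assumes "\<And>s. s \<in> sections \<Longrightarrow> (h \<circ> p) * s = (h' \<circ> p) * s" shows "h = h'"
proof (rule pullback_inj, rule ext)
  fix x
  obtain s where s: "s \<in> sections" "s x \<noteq> 0" by (rule section_nonzero)
  then have "(h \<circ> p) x * s x = (h' \<circ> p) x * s x" using assms[OF s(1)] by (metis times_fun_apply)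
  then show "(h \<circ> p) x = (h' \<circ> p) x" using s by simp
qed

definition descend :: "('p \<Rightarrow> complex) \<Rightarrow> ('m \<Rightarrow> complex)" where
  "descend f = (THE h. f = h \<circ> p)"

lemma descend_pullback: "descend (h \<circ> p) = h"
  unfolding descend_def by (rule the_equality) (auto dest: pullback_inj)

lemma descend:
  assumes "f \<in> C_inf AP" "\<And>x g. f (act x g) = f x"
  shows "descend f \<in> C_inf AM" "descend f \<circ> p = f"
proof -
  obtain h where "h \<in> C_inf AM" "f = h \<circ> p"
    by (rule invariant_descends[OF pb assms(1)]) (rule assms(2), blast)
  then show "descend f \<in> C_inf AM" "descend f \<circ> p = f" using descend_pullback[of h] by auto
qed

lemma pairing:
  assumes "s \<in> sections" "t \<in> cosections"
  shows "descend (t * s) \<in> C_inf AM" "descend (t * s) \<circ> p = t * s"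
proof -
  have "t * s \<in> C_inf AP" "\<And>x g. (t * s) (act x g) = (t * s) x"
    using assms \<kappa>_nonzero by (auto simp: sections_iff cosections_iff C_inf_mult[OF AP])
  then show "descend (t * s) \<in> C_inf AM" "descend (t * s) \<circ> p = t * s"
    by (auto intro: descend)
qed

lemma connectionD:
  assumes "connection AM AP p act \<kappa> nabla"
  shows nabla_sections: "X \<in> vector_fields AM \<Longrightarrow> s \<in> sections \<Longrightarrow> nabla X s \<in> sections"
    and nabla_add_vf: "X \<in> vector_fields AM \<Longrightarrow> Y \<in> vector_fields AM \<Longrightarrow> s \<in> sections \<Longrightarrow>
      nabla (X + Y) s = nabla X s + nabla Y s"
    and nabla_vscale: "h \<in> C_inf AM \<Longrightarrow> X \<in> vector_fields AM \<Longrightarrow> s \<in> sections \<Longrightarrow>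
      nabla (vscale h X) s = (h \<circ> p) * nabla X s"
    and nabla_add: "X \<in> vector_fields AM \<Longrightarrow> s \<in> sections \<Longrightarrow> t \<in> sections \<Longrightarrow>
      nabla X (s + t) = nabla X s + nabla X t"
    and nabla_leibniz: "h \<in> C_inf AM \<Longrightarrow> X \<in> vector_fields AM \<Longrightarrow> s \<in> sections \<Longrightarrow>
      nabla X ((h \<circ> p) * s) = (X h \<circ> p) * s + (h \<circ> p) * nabla X s"
  using assms by (simp_all add: connection_def Let_def sections_def)

definition curv :: "('m vfield \<Rightarrow> ('p \<Rightarrow> complex) \<Rightarrow> ('p \<Rightarrow> complex)) \<Rightarrow>
    'm vfield \<Rightarrow> 'm vfield \<Rightarrow> ('p \<Rightarrow> complex) \<Rightarrow> ('p \<Rightarrow> complex)" where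
  "curv nabla X Y s = nabla X (nabla Y s) - nabla Y (nabla X s) - nabla (lie_bracket X Y) s"

context
  fixes nabla
  assumes con: "connection AM AP p act \<kappa> nabla"
begin

lemma nabla_uminus_vf: "X \<in> vector_fields AM \<Longrightarrow> s \<in> sections \<Longrightarrow> nabla (- X) s = - nabla X s"
  using nabla_vscale[OF con C_inf_const[OF AM], of X s "-1"]
  by (simp add: vscale_minus_one[OF AM]) (simp add: fun_eq_iff)

lemma nabla_diff_vf:
  "X \<in> vector_fields AM \<Longrightarrow> Y \<in> vector_fields AM \<Longrightarrow> s \<in> sections \<Longrightarrow>
    nabla (X - Y) s = nabla X s - nabla Y s"
  using nabla_add_vf[OF con _ vector_fields_uminus[OF AM], of X Y s] nabla_uminus_vf[of Y s] by simp

lemma curv_antisym: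
  assumes "X \<in> vector_fields AM" "Y \<in> vector_fields AM" "s \<in> sections"
  shows "curv nabla X Y s = - curv nabla Y X s"
proof -
  have "lie_bracket X Y = - lie_bracket Y X" by (simp add: lie_bracket_def fun_eq_iff)
  then show ?thesis
    using nabla_uminus_vf[OF vector_fields_lie_bracket[OF AM assms(2,1)] assms(3)]
    by (simp add: curv_def)
qed

lemma curv_add:
  assumes "X \<in> vector_fields AM" "X' \<in> vector_fields AM" "Y \<in> vector_fields AM" "s \<in> sections"
  shows "curv nabla (X + X') Y s = curv nabla X Y s + curv nabla X' Y s"
  using assms
  by (simp add: curv_def lie_bracket_add_left[OF AM] nabla_add_vf[OF con] nabla_add[OF con]
      nabla_sections[OF con] vector_fields_lie_bracket[OF AM] algebra_simps)

text \<open>The derivative of \<open>h\<close> from the Leibniz rule cancels against the one from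
  the Lie bracket. With \<open>curv_antisym\<close> the curvature is linear over functions in both
  fields, so it may be tested on generators.\<close>

lemma curv_vscale:
  assumes "h \<in> C_inf AM" "X \<in> vector_fields AM" "Y \<in> vector_fields AM" "s \<in> sections"
  shows "curv nabla (vscale h X) Y s = (h \<circ> p) * curv nabla X Y s"
  using assms
  by (simp add: curv_def lie_bracket_vscale_left[OF AM] nabla_diff_vf nabla_vscale[OF con]
      nabla_leibniz[OF con] nabla_sections[OF con] vector_fields_lie_bracket[OF AM] vf_C_inf
      vector_fields_vscale[OF AM] algebra_simps)

end

text \<open>
  Two connections differ by a 1-form: an operator on sections that is linear over functions on the
  base is a multiplication, since \<open>(t s) u = (t u) s\<close> for sections \<open>s\<close>, \<open>u\<close> and cosections \<open>t\<close>.
\<close>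

lemma connection_difference:
  assumes con: "connection AM AP p act \<kappa> nabla" and con': "connection AM AP p act \<kappa> nabla'"
  obtains \<theta> where "\<theta> \<in> forms1 AM"
    "\<And>X s. X \<in> vector_fields AM \<Longrightarrow> s \<in> sections \<Longrightarrow> nabla' X s = nabla X s + (\<theta> X \<circ> p) * s"
proof -
  define L where "L X s = nabla' X s - nabla X s" for X s
  have L_sec: "L X s \<in> sections" if "X \<in> vector_fields AM" "s \<in> sections" for X s
    using that unfolding L_def by (intro sections_diff nabla_sections[OF con] nabla_sections[OF con'])
  have L_mult: "L X ((h \<circ> p) * s) = (h \<circ> p) * L X s"
    if "X \<in> vector_fields AM" "s \<in> sections" "h \<in> C_inf AM" for X s h
    using that by (simp add: L_def nabla_leibniz[OF con] nabla_leibniz[OF con'] right_diff_distrib)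
  have L_comm: "L X s * u = L X u * s"
    if X: "X \<in> vector_fields AM" and s: "s \<in> sections" and u: "u \<in> sections" for X s u
  proof (rule section_eqI)
    fix t assume t: "t \<in> cosections"
    have "(descend (t * s) \<circ> p) * u = (descend (t * u) \<circ> p) * s"
      unfolding pairing(2)[OF s t] pairing(2)[OF u t] by (simp add: mult_ac)
    then have "L X ((descend (t * s) \<circ> p) * u) = L X ((descend (t * u) \<circ> p) * s)"
      by (rule arg_cong)
    then have "(t * s) * L X u = (t * u) * L X s"
      using L_mult[OF X u pairing(1)[OF s t]] L_mult[OF X s pairing(1)[OF u t]]
        pairing(2)[OF s t] pairing(2)[OF u t] by simp
    then show "L X s * u * t = L X u * s * t" by (simp add: mult_ac)
  qed
  \<comment> \<open>The multiplier is computed at each point as \<open>L X s / s\<close> with a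
    section that does not vanish there; \<open>L_comm\<close> makes it independent of that
    section.\<close>
  define w where "w x = (SOME u. u \<in> sections \<and> u x \<noteq> 0)" for x
  have w: "w x \<in> sections" "w x x \<noteq> 0" for x
    using someI_ex[of "\<lambda>u. u \<in> sections \<and> u x \<noteq> 0"] section_nonzero[of x] unfolding w_def by blast+
  define Q where "Q X = (\<lambda>x. L X (w x) x / w x x)" for X
  have Q: "Q X * s = L X s" if X: "X \<in> vector_fields AM" and s: "s \<in> sections" for X s
  proof
    fix x
    have "(L X (w x) * s) x = (L X s * w x) x" using L_comm[OF X w(1) s] by simp
    then show "(Q X * s) x = L X s x" using w(2)[of x] by (simp add: Q_def field_simps)
  qed
  have Q_C: "Q X \<in> C_inf AP" if X: "X \<in> vector_fields AM" for X
  proof (rule C_inf_local_quotient[OF AP])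
    fix x
    show "\<exists>t\<in>C_inf AP. t x \<noteq> 0 \<and> Q X * t \<in> C_inf AP"
      using Q[OF X w(1)] w[of x] L_sec[OF X w(1)] sections_iff by auto
  qed
  have Q_inv: "Q X (act x g) = Q X x" if X: "X \<in> vector_fields AM" for X x g
  proof -
    have "Q X (act x g) * w x (act x g) = inverse (\<kappa> g) * (Q X x * w x x)"
      using Q[OF X w(1)[of x]] L_sec[OF X w(1)[of x]] by (metis sections_iff times_fun_apply)
    moreover have "w x (act x g) = inverse (\<kappa> g) * w x x" using w(1) by (simp add: sections_iff)
    ultimately show ?thesis using w(2)[of x] \<kappa>_nonzero[of g] by (simp add: field_simps)
  qed
  define \<theta> where "\<theta> X = descend (Q X)" for X
  have \<theta>: "\<theta> X \<in> C_inf AM" "\<theta> X \<circ> p = Q X" if "X \<in> vector_fields AM" for X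
    using descend[OF Q_C[OF that] Q_inv[OF that]] by (simp_all add: \<theta>_def)
  have \<theta>L: "(\<theta> X \<circ> p) * s = L X s" if "X \<in> vector_fields AM" "s \<in> sections" for X s
    using \<theta>(2) Q that by simp
  have "\<theta> \<in> forms1 AM"
    unfolding forms1_def
  proof (intro CollectI conjI ballI)
    fix X Y assume X: "X \<in> vector_fields AM" and Y: "Y \<in> vector_fields AM"
    show "\<theta> (X + Y) = \<theta> X + \<theta> Y"
    proof (rule pullback_eqI)
      fix s assume s: "s \<in> sections"
      have "(\<theta> (X + Y) \<circ> p) * s = (\<theta> X \<circ> p) * s + (\<theta> Y \<circ> p) * s"
        using \<theta>L[OF X s] \<theta>L[OF Y s] \<theta>L[OF vector_fields_add[OF AM X Y] s] X Y s
        by (simp add: L_def nabla_add_vf[OF con] nabla_add_vf[OF con'])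
      then show "(\<theta> (X + Y) \<circ> p) * s = (\<theta> X + \<theta> Y \<circ> p) * s"
        by (simp add: fun_eq_iff algebra_simps)
    qed
  next
    fix h X assume h: "h \<in> C_inf AM" and X: "X \<in> vector_fields AM"
    show "\<theta> (vscale h X) = h * \<theta> X"
    proof (rule pullback_eqI)
      fix s assume s: "s \<in> sections"
      have "(\<theta> (vscale h X) \<circ> p) * s = (h \<circ> p) * ((\<theta> X \<circ> p) * s)"
        using \<theta>L[OF X s] \<theta>L[OF vector_fields_vscale[OF AM h X] s] X h s
        by (simp add: L_def nabla_vscale[OF con] nabla_vscale[OF con'] right_diff_distrib)
      then show "(\<theta> (vscale h X) \<circ> p) * s = (h * \<theta> X \<circ> p) * s"
        by (simp add: fun_eq_iff mult.assoc)
    qed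
  qed (rule \<theta>(1))
  moreover have "nabla' X s = nabla X s + (\<theta> X \<circ> p) * s"
    if "X \<in> vector_fields AM" "s \<in> sections" for X s
    using \<theta>L[OF that] by (simp add: L_def)
  ultimately show ?thesis by (rule that)
qed

text \<open>In rank one the term quadratic in \<theta> is symmetric in \<open>X\<close> and
  \<open>Y\<close>, and so is the sum of the mixed terms with \<theta> and \<open>nabla\<close>.
  Only the exterior derivative of \<theta> survives in the commutator.\<close>

lemma curv_connection_difference:
  assumes con: "connection AM AP p act \<kappa> nabla" and con': "connection AM AP p act \<kappa> nabla'"
    and \<theta>: "\<theta> \<in> forms1 AM"
    and eq: "\<And>X s. X \<in> vector_fields AM \<Longrightarrow> s \<in> sections \<Longrightarrow> nabla' X s = nabla X s + (\<theta> X \<circ> p) * s"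
    and X: "X \<in> vector_fields AM" and Y: "Y \<in> vector_fields AM" and s: "s \<in> sections"
  shows "curv nabla' X Y s = curv nabla X Y s + (ext_d1 \<theta> X Y \<circ> p) * s"
proof -
  have step: "nabla' X (nabla' Y s) = nabla X (nabla Y s) + (\<theta> X \<circ> p) * nabla Y s +
      (X (\<theta> Y) \<circ> p) * s + (\<theta> Y \<circ> p) * nabla X s + (\<theta> X \<circ> p) * ((\<theta> Y \<circ> p) * s)"
    if X: "X \<in> vector_fields AM" and Y: "Y \<in> vector_fields AM" for X Y
  proof -
    have \<theta>Y: "\<theta> Y \<in> C_inf AM" using form1_C_inf[OF AM \<theta> Y] .
    have "nabla' X (nabla' Y s) = nabla' X (nabla Y s) + nabla' X ((\<theta> Y \<circ> p) * s)"
      unfolding eq[OF Y s]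
      by (rule nabla_add[OF con' X nabla_sections[OF con Y s] sections_mult[OF \<theta>Y s]])
    then show ?thesis
      unfolding eq[OF X nabla_sections[OF con Y s]] eq[OF X sections_mult[OF \<theta>Y s]]
        nabla_leibniz[OF con \<theta>Y X s] by (simp add: algebra_simps)
  qed
  have "(ext_d1 \<theta> X Y \<circ> p) * s = (X (\<theta> Y) \<circ> p) * s - (Y (\<theta> X) \<circ> p) * s - (\<theta> (lie_bracket X Y) \<circ> p) * s"
    by (simp add: ext_d1_def fun_eq_iff algebra_simps)
  then show ?thesis
    unfolding curv_def step[OF X Y] step[OF Y X] eq[OF vector_fields_lie_bracket[OF AM X Y] s]
    by (simp add: algebra_simps)
qed

text \<open>Any connection differs from the flat one by a 1-form \<theta>, so its curvature form is
  the exterior derivative of \<theta> and its class is 0. This gives the uniqueness that the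
  definite description asks for; \<open>nabla\<close> itself provides existence.\<close>

lemma flat_chern_class1:
  assumes con: "connection AM AP p act \<kappa> nabla"
    and flat: "\<And>X Y s. X \<in> vector_fields AM \<Longrightarrow> Y \<in> vector_fields AM \<Longrightarrow> s \<in> sections \<Longrightarrow> curv nabla X Y s = 0"
  shows "chern_class1 AM AP p act \<kappa> = de_rham_class AM 0"
  unfolding chern_class1_def
proof (rule the_equality)
  define c where "c = \<i> / (2 * of_real pi)"
  have main: "de_rham_class AM (\<lambda>X Y. (\<lambda>_. c) * F X Y) = de_rham_class AM 0"
    if con': "connection AM AP p act \<kappa> nabla'" and cF: "curvature_form AM AP p act \<kappa> nabla' F" for nabla' F
  proof -
    obtain \<theta> where \<theta>: "\<theta> \<in> forms1 AM"
      "\<And>X s. X \<in> vector_fields AM \<Longrightarrow> s \<in> sections \<Longrightarrow> nabla' X s = nabla X s + (\<theta> X \<circ> p) * s"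
      using connection_difference[OF con con'] by blast
    have F: "F X Y = ext_d1 \<theta> X Y" if X: "X \<in> vector_fields AM" and Y: "Y \<in> vector_fields AM" for X Y
    proof (rule pullback_eqI)
      fix s assume s: "s \<in> sections"
      have "(F X Y \<circ> p) * s = curv nabla' X Y s"
        using cF X Y s by (simp add: curvature_form_def curv_def sections_def)
      then show "(F X Y \<circ> p) * s = (ext_d1 \<theta> X Y \<circ> p) * s"
        using curv_connection_difference[OF con con' \<theta> X Y s] flat[OF X Y s] by simp
    qed
    have F2: "F \<in> forms2 AM" using cF by (simp add: curvature_form_def)
    show ?thesis
    proof (rule de_rham_class_exact[OF AM])
      have scale: "(\<lambda>X. (\<lambda>_. c) * \<phi> X) \<in> forms1 AM" if "\<phi> \<in> forms1 AM" for \<phi>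
        using that by (simp add: forms1_def C_inf_cmult[OF AM] distrib_left mult.left_commute)
      show "(\<lambda>X. (\<lambda>_. c) * \<theta> X) \<in> forms1 AM" by (rule scale[OF \<theta>(1)])
      show "(\<lambda>X Y. (\<lambda>_. c) * F X Y) \<in> forms2 AM"
        using F2 scale by (simp add: forms2_def)
      show "(\<lambda>_. c) * F X Y = ext_d1 (\<lambda>X. (\<lambda>_. c) * \<theta> X) X Y"
        if X: "X \<in> vector_fields AM" and Y: "Y \<in> vector_fields AM" for X Y
        using X Y \<theta>(1)
        by (simp add: F ext_d1_def vf_cmult[OF X] vf_cmult[OF Y] form1_C_inf[OF AM] right_diff_distrib)
    qed
  qed
  \<comment> \<open>The flat connection has the zero form as a curvature form, which witnesses that
    the description is inhabited.\<close>
  have "(\<lambda>X Y. 0) \<in> forms2 AM"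
    by (simp add: forms2_def forms1_def C_inf_zero[OF AM])
  moreover have "(0 \<circ> p) * s = 0" for s :: "'p \<Rightarrow> complex" by (simp add: fun_eq_iff)
  ultimately have "curvature_form AM AP p act \<kappa> nabla (\<lambda>X Y. 0)"
    using flat by (simp add: curvature_form_def curv_def sections_def)
  note F0 = this
  show "\<exists>nabla F. connection AM AP p act \<kappa> nabla \<and>
      curvature_form AM AP p act \<kappa> nabla F \<and>
      de_rham_class AM 0 = de_rham_class AM (\<lambda>X Y. (\<lambda>_. \<i> / (2 * of_real pi)) * F X Y)"
    using con F0 main[OF con F0, symmetric] unfolding c_def by (intro exI conjI)
  show "d = de_rham_class AM 0"
    if "\<exists>nabla F. connection AM AP p act \<kappa> nabla \<and> curvature_form AM AP p act \<kappa> nabla F \<and>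
      d = de_rham_class AM (\<lambda>X Y. (\<lambda>_. \<i> / (2 * of_real pi)) * F X Y)" for d
    using that main unfolding c_def by blast
qed

end

locale invariant_deformation = line_bundle AM AP AG gmul e iv p act \<kappa>
  for AM :: "('m::{t2_space, second_countable_topology}, 'e::{real_inner, heine_borel}) atlas"
    and AP :: "('p::{t2_space, second_countable_topology}, 'q::{real_inner, heine_borel}) atlas"
    and AG :: "('g::{t2_space, second_countable_topology}, 'k::{real_inner, heine_borel}) atlas"
    and gmul :: "'g \<Rightarrow> 'g \<Rightarrow> 'g" and e :: 'g and iv :: "'g \<Rightarrow> 'g"
    and p :: "'p \<Rightarrow> 'm" and act :: "'p \<Rightarrow> 'g \<Rightarrow> 'p" and \<kappa> :: "'g \<Rightarrow> complex" +
  fixes \<omega> :: "'m form2"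
    and C :: "nat \<Rightarrow> ('m \<Rightarrow> complex) \<Rightarrow> ('m \<Rightarrow> complex) \<Rightarrow> ('m \<Rightarrow> complex)"
    and l :: "nat \<Rightarrow> ('m \<Rightarrow> complex) \<Rightarrow> ('p \<Rightarrow> complex) \<Rightarrow> ('p \<Rightarrow> complex)"
    and \<rho> :: "nat \<Rightarrow> ('p \<Rightarrow> complex) \<Rightarrow> ('m \<Rightarrow> complex) \<Rightarrow> ('p \<Rightarrow> complex)"
  assumes symplectic: "symplectic_form AM \<omega>"
    and star: "star_product AM C"
    and poisson: "poisson_bracket_of AM \<omega> (\<lambda>a b. (\<lambda>_. 1 / \<i>) * (C 1 a b - C 1 b a))"
    and deform: "invariant_bimodule_deformation AM AP p act C l \<rho>"
begin

lemma C_bilinear: "bilinear_op AM AM AM (C r)"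
  using star by (auto simp: star_product_def intro: bidifferential_bilinear_op)

lemma l_bilinear: "bilinear_op AM AP AP (l r)" and \<rho>_bilinear: "bilinear_op AP AM AP (\<rho> r)"
proof -
  have zero: "l 0 b f = (b \<circ> p) * f" "\<rho> 0 f b = f * (b \<circ> p)" if "b \<in> C_inf AM" "f \<in> C_inf AP" for b f
    using deform that by (simp_all add: invariant_bimodule_deformation_def)
  have comp: "(a + b) \<circ> p = (a \<circ> p) + (b \<circ> p)" "((\<lambda>_. c) * a) \<circ> p = (\<lambda>_. c) * (a \<circ> p)"
    for a b :: "'m \<Rightarrow> complex" and c
    by (simp_all add: fun_eq_iff)
  show "bilinear_op AM AP AP (l r)"
  proof (cases "r = 0")
    case True
    show ?thesis
      unfolding bilinear_op_def True
      by (auto simp: zero comp C_inf_add[OF AM] C_inf_add[OF AP] C_inf_cmult[OF AM]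
          C_inf_cmult[OF AP] C_inf_mult[OF AP] pullback_C_inf distrib_left distrib_right
          mult.assoc mult.left_commute)
  next
    case False
    then have "bidifferential AM AP AP p id (l r)"
      using deform by (simp add: invariant_bimodule_deformation_def)
    then show ?thesis by (rule bidifferential_bilinear_op)
  qed
  show "bilinear_op AP AM AP (\<rho> r)"
  proof (cases "r = 0")
    case True
    show ?thesis
      unfolding bilinear_op_def True
      by (auto simp: zero comp C_inf_add[OF AM] C_inf_add[OF AP] C_inf_cmult[OF AM]
          C_inf_cmult[OF AP] C_inf_mult[OF AP] pullback_C_inf distrib_left distrib_right
          mult.assoc mult.left_commute)
  next
    case False
    then have "bidifferential AP AM AP id p (\<rho> r)"
      using deform by (simp add: invariant_bimodule_deformation_def)
    then show ?thesis by (rule bidifferential_bilinear_op)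
  qed
qed

sublocale P: bimodule_deformation AM AP p C l \<rho>
  using deform star
  by unfold_locales
    (simp_all add: AM AP pullback_C_inf C_bilinear l_bilinear \<rho>_bilinear
      invariant_bimodule_deformation_def star_product_def)

sublocale M: bimodule_deformation AM AM id C C C
  using star by unfold_locales (simp_all add: AM C_bilinear star_product_def)

abbreviation br where "br \<equiv> P.br"

lemma M_D: "M.D a b = br a b"
  by (simp add: M.D_def P.br_def)

lemma br_antisym: "br a b = - br b a"
  by (simp add: P.br_def)

lemma br_jacobi:
  assumes "a \<in> C_inf AM" "b \<in> C_inf AM" "c \<in> C_inf AM"
  shows "br a (br b c) - br b (br a c) = br (br a b) c"
  using M.D_commutator[OF assms] by (simp add: M_D)

text \<open>For a section \<open>s\<close>, translation by \<open>g\<close> multiplies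
  \<open>s\<close> by the constant \<open>inverse (\<kappa> g)\<close>. Invariance of the module
  structures and linearity over the complex numbers carry this over to each coefficient of the
  products with \<open>a\<close>.\<close>

lemma equivariant_op:
  assumes a: "a \<in> C_inf AM" and s: "s \<in> sections"
  shows "l r a s \<in> sections" "\<rho> r s a \<in> sections"
proof -
  have s': "s \<in> C_inf AP" using s by (simp add: sections_iff)
  have pull: "pullback (\<lambda>x. act x g) (fps_const s) = fps_const ((\<lambda>_. inverse (\<kappa> g)) * s)" for g
    using s by (auto simp: pullback_def sections_iff fps_eq_iff fun_eq_iff)
  have "l r a s (act x g) = inverse (\<kappa> g) * l r a s x \<and> \<rho> r s a (act x g) = inverse (\<kappa> g) * \<rho> r s a x"
    for x g
  proof -
    let ?r = "pullback (\<lambda>x. act x g)"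
    have c: "(\<lambda>_. inverse (\<kappa> g)) * s \<in> C_inf AP" by (rule C_inf_cmult[OF AP s'])
    have "?r (formal_ext l (fps_const a) (fps_const s)) = formal_ext l (fps_const a) (?r (fps_const s))"
      "?r (formal_ext \<rho> (fps_const s) (fps_const a)) = formal_ext \<rho> (?r (fps_const s)) (fps_const a)"
      using deform formal_C_inf_const[OF AM a] formal_C_inf_const[OF AP s']
      by (auto simp: invariant_bimodule_deformation_def)
    then have "fps_nth (?r (formal_ext l (fps_const a) (fps_const s))) r =
        fps_nth (formal_ext l (fps_const a) (fps_const ((\<lambda>_. inverse (\<kappa> g)) * s))) r"
      "fps_nth (?r (formal_ext \<rho> (fps_const s) (fps_const a))) r =
        fps_nth (formal_ext \<rho> (fps_const ((\<lambda>_. inverse (\<kappa> g)) * s)) (fps_const a)) r"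
      by (simp_all add: pull)
    then have "l r a s \<circ> (\<lambda>x. act x g) = (\<lambda>_. inverse (\<kappa> g)) * l r a s"
      "\<rho> r s a \<circ> (\<lambda>x. act x g) = (\<lambda>_. inverse (\<kappa> g)) * \<rho> r s a"
      by (simp_all add: pullback_def formal_ext_const[OF AM AP AP l_bilinear a s']
          formal_ext_const[OF AM AP AP l_bilinear a c] formal_ext_const[OF AP AM AP \<rho>_bilinear s' a]
          formal_ext_const[OF AP AM AP \<rho>_bilinear c a] bilinear_op_cmult_right[OF l_bilinear a s']
          bilinear_op_cmult_left[OF \<rho>_bilinear s' a])
    then show ?thesis by (auto dest!: fun_cong[where x = x])
  qed
  then show "l r a s \<in> sections" "\<rho> r s a \<in> sections"
    using P.l_closed[OF a s'] P.\<rho>_closed[OF a s'] by (simp_all add: sections_iff)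
qed

lemma D_sections: "a \<in> C_inf AM \<Longrightarrow> s \<in> sections \<Longrightarrow> P.D a s \<in> sections"
  unfolding P.D_def by (intro sections_diff equivariant_op)

section \<open>Hamiltonian vector fields and the construction of the connection\<close>

lemma \<omega>: "\<omega> \<in> forms2 AM"
  using symplectic by (simp add: symplectic_form_def closed_forms2_def)

lemma nondegenerate:
  assumes X: "X \<in> vector_fields AM" and Y: "Y \<in> vector_fields AM"
    and eq: "\<And>W. W \<in> vector_fields AM \<Longrightarrow> \<omega> X W = \<omega> Y W"
  shows "X = Y"
proof -
  have d: "X - Y \<in> vector_fields AM" by (rule vector_fields_diff[OF AM X Y])
  have "\<omega> (X - Y) W = 0" if "W \<in> vector_fields AM" for W
    using form1_diff[OF AM form2_right[OF AM \<omega> that] X Y] eq[OF that] by simp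
  then have "\<forall>W\<in>vector_fields AM. \<omega> (X - Y) W m = 0" for m by simp
  then have "(X - Y) f m = 0" if "f \<in> C_inf AM" for f m
    using symplectic d that unfolding symplectic_form_def by blast
  then have "X f = Y f" if "f \<in> C_inf AM" for f
    using that by (simp add: fun_eq_iff)
  moreover have "X f = Y f" if "f \<notin> C_inf AM" for f
    using vf_outside[OF X that] vf_outside[OF Y that] by simp
  ultimately show ?thesis by blast
qed

definition ham :: "('m \<Rightarrow> complex) \<Rightarrow> 'm vfield" where
  "ham a = (SOME X. hamiltonian_vf AM \<omega> a X)"

lemma hamiltonian_unique:
  "hamiltonian_vf AM \<omega> a X \<Longrightarrow> hamiltonian_vf AM \<omega> a Y \<Longrightarrow> X = Y"
  by (rule nondegenerate) (simp_all add: hamiltonian_vf_def)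

text \<open>Existence of Hamiltonian fields is contained in \<open>poisson_bracket_of\<close>, and
  non-degeneracy makes them unique. The last claim is \<omega>(X_b, X_a) = X_a b, multiplied by
  \<i>.\<close>

lemma ham:
  assumes a: "a \<in> C_inf AM"
  shows ham_vf: "ham a \<in> vector_fields AM"
    and \<omega>_ham: "Y \<in> vector_fields AM \<Longrightarrow> \<omega> (ham a) Y = Y a"
    and br_ham: "b \<in> C_inf AM \<Longrightarrow> br b a = (\<lambda>_. \<i>) * ham a b"
proof -
  have ex: "\<exists>X Y. hamiltonian_vf AM \<omega> b X \<and> hamiltonian_vf AM \<omega> a Y \<and>
      (\<lambda>_. 1 / \<i>) * (C 1 b a - C 1 a b) = \<omega> X Y" if "b \<in> C_inf AM" for b
    using poisson a that unfolding poisson_bracket_of_def by blast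
  then have "\<exists>X. hamiltonian_vf AM \<omega> a X" using a by blast
  then have h: "hamiltonian_vf AM \<omega> a (ham a)" unfolding ham_def by (rule someI_ex)
  then show 1: "ham a \<in> vector_fields AM" and "Y \<in> vector_fields AM \<Longrightarrow> \<omega> (ham a) Y = Y a"
    by (simp_all add: hamiltonian_vf_def)
  assume b: "b \<in> C_inf AM"
  obtain X Y where XY: "hamiltonian_vf AM \<omega> b X" "hamiltonian_vf AM \<omega> a Y"
    "(\<lambda>_. 1 / \<i>) * (C 1 b a - C 1 a b) = \<omega> X Y" using ex[OF b] by blast
  have "Y = ham a" using hamiltonian_unique[OF XY(2) h] .
  then have "(\<lambda>_. 1 / \<i>) * br b a = ham a b"
    using XY 1 by (simp add: P.br_def hamiltonian_vf_def)
  then have "(\<lambda>_. \<i>) * ((\<lambda>_. 1 / \<i>) * br b a) = (\<lambda>_. \<i>) * ham a b" by simp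
  moreover have "(\<lambda>_. \<i>) * ((\<lambda>_. 1 / \<i>) * br b a) = br b a" by (simp add: fun_eq_iff)
  ultimately show "br b a = (\<lambda>_. \<i>) * ham a b" by simp
qed

text \<open>
  \<open>V s t\<close> is the contraction of \<open>a \<mapsto> D a s\<close>, a vector field with values in the line bundle, with the
  cosection \<open>t\<close>. The connection is determined by \<open>t (nabla X s) = \<i> \<omega>(X, V s t)\<close> for all \<open>t\<close>.
\<close>

definition V :: "('p \<Rightarrow> complex) \<Rightarrow> ('p \<Rightarrow> complex) \<Rightarrow> 'm vfield" where
  "V s t a = (if a \<in> C_inf AM then descend (t * P.D a s) else 0)"

lemma V_pullback:
  "s \<in> sections \<Longrightarrow> t \<in> cosections \<Longrightarrow> a \<in> C_inf AM \<Longrightarrow> V s t a \<circ> p = t * P.D a s"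
  by (simp add: V_def pairing(2) D_sections)

text \<open>The derivation property is \<open>D_mult\<close>. All identities are checked after
  pullback along \<open>p\<close>, which is injective and turns \<open>V s t a\<close> into the
  product \<open>t * P.D a s\<close>.\<close>

lemma V_vector_field:
  assumes s: "s \<in> sections" and t: "t \<in> cosections" shows "V s t \<in> vector_fields AM"
proof (rule vfI)
  note Vp = V_pullback[OF s t]
  have s': "s \<in> C_inf AP" using s by (simp add: sections_iff)
  fix a assume a: "a \<in> C_inf AM"
  show "V s t a \<in> C_inf AM" using a by (simp add: V_def pairing(1) D_sections s t)
  show "V s t ((\<lambda>_. c) * a) = (\<lambda>_. c) * V s t a" for c
  proof (rule pullback_inj)
    have "V s t ((\<lambda>_. c) * a) \<circ> p = (\<lambda>_. c) * (V s t a \<circ> p)"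
      using a by (simp add: Vp C_inf_cmult[OF AM] P.D_cmult_left s' mult.left_commute)
    then show "V s t ((\<lambda>_. c) * a) \<circ> p = ((\<lambda>_. c) * V s t a) \<circ> p" by (simp add: fun_eq_iff)
  qed
  fix b assume b: "b \<in> C_inf AM"
  show "V s t (a + b) = V s t a + V s t b"
  proof (rule pullback_inj)
    have "V s t (a + b) \<circ> p = (V s t a \<circ> p) + (V s t b \<circ> p)"
      using a b by (simp add: Vp C_inf_add[OF AM] P.D_add_left s' distrib_left)
    then show "V s t (a + b) \<circ> p = (V s t a + V s t b) \<circ> p" by (simp add: fun_eq_iff)
  qed
  show "V s t (a * b) = V s t a * b + a * V s t b"
  proof (rule pullback_inj)
    have "V s t (a * b) \<circ> p = (V s t a \<circ> p) * (b \<circ> p) + (a \<circ> p) * (V s t b \<circ> p)"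
      using a b by (simp add: Vp C_inf_mult[OF AM] P.D_mult s' algebra_simps)
    then show "V s t (a * b) \<circ> p = (V s t a * b + a * V s t b) \<circ> p" by (simp add: fun_eq_iff)
  qed
qed (simp add: V_def)

lemma vf_eq_pullbackI:
  assumes "X \<in> vector_fields AM" "Y \<in> vector_fields AM"
    and "\<And>a. a \<in> C_inf AM \<Longrightarrow> X a \<circ> p = Y a \<circ> p"
  shows "X = Y"
proof
  fix a show "X a = Y a"
    using pullback_inj[OF assms(3)] vf_outside[OF assms(1), of a] vf_outside[OF assms(2), of a]
    by (cases "a \<in> C_inf AM") auto
qed

text \<open>The defining equation is divided at each point by a cosection that is non-zero there;
  \<open>nabla_cosection\<close> removes the dependence on this choice.\<close>

definition nabla :: "'m vfield \<Rightarrow> ('p \<Rightarrow> complex) \<Rightarrow> ('p \<Rightarrow> complex)" where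
  "nabla X s x = (let t = SOME t. t \<in> cosections \<and> t x \<noteq> 0 in \<i> * \<omega> X (V s t) (p x) / t x)"

lemma \<omega>_right: "X \<in> vector_fields AM \<Longrightarrow> \<omega> X \<in> forms1 AM"
  and \<omega>_left: "X \<in> vector_fields AM \<Longrightarrow> (\<lambda>Y. \<omega> Y X) \<in> forms1 AM"
  by (simp_all add: form2_left[OF AM \<omega>] form2_right[OF AM \<omega>])

lemmas \<omega>_add_left = form1_add[OF AM \<omega>_left] and \<omega>_vscale_left = form1_vscale[OF AM \<omega>_left]
  and \<omega>_add_right = form1_add[OF AM \<omega>_right] and \<omega>_vscale_right = form1_vscale[OF AM \<omega>_right]
  and \<omega>_C_inf = form1_C_inf[OF AM \<omega>_right]

text \<open>To compare \<open>t\<close> with the chosen \<open>t0\<close>, both are multiplied by a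
  section \<open>u\<close>: coefficients of vector fields must be functions on the base, and
  \<open>t * u\<close> and \<open>t0 * u\<close> descend. Then (t u) \<open>V s t0\<close> and (t0
  u) \<open>V s t\<close> agree, since applied to \<open>a\<close> both pull back to the product of
  \<open>t\<close>, \<open>t0\<close>, \<open>u\<close> and \<open>P.D a s\<close>.\<close>

lemma nabla_cosection:
  assumes X: "X \<in> vector_fields AM" and s: "s \<in> sections" and t: "t \<in> cosections"
  shows "t * nabla X s = (\<lambda>_. \<i>) * (\<omega> X (V s t) \<circ> p)"
proof
  fix x
  define t0 where "t0 = (SOME t. t \<in> cosections \<and> t x \<noteq> 0)"
  have t0: "t0 \<in> cosections" "t0 x \<noteq> 0"
    using someI_ex[of "\<lambda>t. t \<in> cosections \<and> t x \<noteq> 0"] cosection_nonzero[of x] unfolding t0_def by blast+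
  obtain u where u: "u \<in> sections" "u x \<noteq> 0" by (rule section_nonzero)
  note V = V_vector_field[OF s t] and V0 = V_vector_field[OF s t0(1)]
  note h = pairing[OF u(1) t] and h0 = pairing[OF u(1) t0(1)]
  have "vscale (descend (t * u)) (V s t0) = vscale (descend (t0 * u)) (V s t)"
  proof (rule vf_eq_pullbackI)
    fix a assume a: "a \<in> C_inf AM"
    have "(descend (t * u) \<circ> p) * (V s t0 a \<circ> p) = (descend (t0 * u) \<circ> p) * (V s t a \<circ> p)"
      using V_pullback[OF s _ a] t t0 h(2) h0(2) by (simp add: mult_ac)
    then show "vscale (descend (t * u)) (V s t0) a \<circ> p = vscale (descend (t0 * u)) (V s t) a \<circ> p"
      by (simp add: vscale_apply fun_eq_iff)
  qed (intro vector_fields_vscale[OF AM] h h0 V V0)+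
  then have "descend (t * u) * \<omega> X (V s t0) = descend (t0 * u) * \<omega> X (V s t)"
    using \<omega>_vscale_right[OF X h(1) V0] \<omega>_vscale_right[OF X h0(1) V] by simp
  then have "(descend (t * u) \<circ> p) x * \<omega> X (V s t0) (p x) = (descend (t0 * u) \<circ> p) x * \<omega> X (V s t) (p x)"
    by (auto dest: fun_cong[where x = "p x"])
  then have "t x * u x * \<omega> X (V s t0) (p x) = t0 x * u x * \<omega> X (V s t) (p x)"
    using h(2) h0(2) by simp
  then have "t x * \<omega> X (V s t0) (p x) = t0 x * \<omega> X (V s t) (p x)"
    using u(2) by (simp add: mult_ac)
  moreover have "nabla X s x = \<i> * \<omega> X (V s t0) (p x) / t0 x"
    by (simp add: nabla_def t0_def Let_def)
  ultimately have "t0 x * (t x * nabla X s x) = t0 x * (\<i> * \<omega> X (V s t) (p x))"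
    using t0(2) by (simp add: mult.left_commute)
  then show "(t * nabla X s) x = ((\<lambda>_. \<i>) * (\<omega> X (V s t) \<circ> p)) x"
    using t0(2) by simp
qed

lemma nabla_in_sections:
  assumes X: "X \<in> vector_fields AM" and s: "s \<in> sections" shows "nabla X s \<in> sections"
proof -
  have "nabla X s \<in> C_inf AP"
  proof (rule C_inf_local_quotient[OF AP])
    fix x
    obtain t where t: "t \<in> cosections" "t x \<noteq> 0" by (rule cosection_nonzero)
    have "(\<lambda>_. \<i>) * (\<omega> X (V s t) \<circ> p) \<in> C_inf AP"
      by (intro C_inf_cmult[OF AP] pullback_C_inf \<omega>_C_inf X V_vector_field s t(1))
    then show "\<exists>t\<in>C_inf AP. t x \<noteq> 0 \<and> nabla X s * t \<in> C_inf AP"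
      using t nabla_cosection[OF X s t(1)] by (auto simp: cosections_iff mult.commute)
  qed
  moreover have "nabla X s (act x g) = inverse (\<kappa> g) * nabla X s x" for x g
  proof -
    obtain t where t: "t \<in> cosections" "t x \<noteq> 0" by (rule cosection_nonzero)
    have "t y * nabla X s y = \<i> * \<omega> X (V s t) (p y)" for y
      using nabla_cosection[OF X s t(1)] by (metis comp_apply times_fun_apply)
    from this[of x] this[of "act x g"] have "t (act x g) * nabla X s (act x g) = t x * nabla X s x"
      by (simp add: bundle_p_act[OF pb])
    moreover have "t (act x g) = \<kappa> g * t x" using t(1) by (simp add: cosections_iff)
    ultimately show ?thesis using t(2) \<kappa>_nonzero[of g] by (simp add: field_simps)
  qed
  ultimately show ?thesis by (simp add: sections_iff)
qed

section \<open>Verification of the connection axioms\<close>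

lemma cosection_eqI:
  assumes "\<And>t. t \<in> cosections \<Longrightarrow> t * f = t * g" shows "f = g"
  by (rule section_eqI) (use assms in \<open>simp add: mult.commute\<close>)

lemma V_add:
  assumes s: "s \<in> sections" and s': "s' \<in> sections" and t: "t \<in> cosections"
  shows "V (s + s') t = V s t + V s' t"
proof (rule vf_eq_pullbackI)
  fix a assume a: "a \<in> C_inf AM"
  have "V (s + s') t a \<circ> p = (V s t a \<circ> p) + (V s' t a \<circ> p)"
    unfolding V_pullback[OF sections_add[OF s s'] t a] V_pullback[OF s t a] V_pullback[OF s' t a]
    using s s' by (simp add: P.D_add_right[OF a] sections_iff distrib_left)
  then show "V (s + s') t a \<circ> p = (V s t + V s' t) a \<circ> p" by (simp add: fun_eq_iff)
qed (use s s' t in \<open>auto intro!: vector_fields_add[OF AM] V_vector_field sections_add\<close>)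

text \<open>The Leibniz rule for \<open>D\<close> adds \<open>br a h\<close>, which as a function of
  \<open>a\<close> is \<i> times the Hamiltonian field of \<open>h\<close> applied to
  \<open>a\<close>.\<close>

lemma V_mult:
  assumes h: "h \<in> C_inf AM" and s: "s \<in> sections" and t: "t \<in> cosections"
  shows "V ((h \<circ> p) * s) t = vscale h (V s t) + vscale ((\<lambda>_. \<i>) * descend (t * s)) (ham h)"
proof (rule vf_eq_pullbackI)
  have s': "s \<in> C_inf AP" using s by (simp add: sections_iff)
  fix a assume a: "a \<in> C_inf AM"
  have "V ((h \<circ> p) * s) t a \<circ> p = (h \<circ> p) * (V s t a \<circ> p) + t * s * (br a h \<circ> p)"
    unfolding V_pullback[OF sections_mult[OF h s] t a] V_pullback[OF s t a] P.D_leibniz[OF a h s']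
    by (simp add: algebra_simps)
  also have "t * s = descend (t * s) \<circ> p" using pairing(2)[OF s t] by simp
  finally have eq: "V ((h \<circ> p) * s) t a \<circ> p =
    (h \<circ> p) * (V s t a \<circ> p) + (descend (t * s) \<circ> p) * (br a h \<circ> p)" .
  show "V ((h \<circ> p) * s) t a \<circ> p =
      (vscale h (V s t) + vscale ((\<lambda>_. \<i>) * descend (t * s)) (ham h)) a \<circ> p"
    unfolding eq br_ham[OF h a] by (simp add: vscale_apply fun_eq_iff)
qed (use h s t in \<open>auto intro!: vector_fields_add[OF AM] vector_fields_vscale[OF AM] V_vector_field
      sections_mult C_inf_cmult[OF AM] pairing(1) ham_vf\<close>)

lemma connection_nabla: "connection AM AP p act \<kappa> nabla"
  unfolding connection_def Let_def sections_def[symmetric]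
proof (intro conjI ballI)
  fix X s assume X: "X \<in> vector_fields AM" and s: "s \<in> sections"
  show "nabla X s \<in> sections" by (rule nabla_in_sections[OF X s])
next
  fix X Y s assume X: "X \<in> vector_fields AM" and Y: "Y \<in> vector_fields AM" and s: "s \<in> sections"
  show "nabla (X + Y) s = nabla X s + nabla Y s"
  proof (rule cosection_eqI)
    fix t assume t: "t \<in> cosections"
    show "t * nabla (X + Y) s = t * (nabla X s + nabla Y s)"
      unfolding distrib_left nabla_cosection[OF vector_fields_add[OF AM X Y] s t]
        nabla_cosection[OF X s t] nabla_cosection[OF Y s t] \<omega>_add_left[OF V_vector_field[OF s t] X Y]
      by (simp add: fun_eq_iff algebra_simps)
  qed
next
  fix h X s assume h: "h \<in> C_inf AM" and X: "X \<in> vector_fields AM" and s: "s \<in> sections"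
  show "nabla (vscale h X) s = (h \<circ> p) * nabla X s"
  proof (rule cosection_eqI)
    fix t assume t: "t \<in> cosections"
    show "t * nabla (vscale h X) s = t * ((h \<circ> p) * nabla X s)"
      unfolding mult.left_commute[of t] nabla_cosection[OF vector_fields_vscale[OF AM h X] s t]
        nabla_cosection[OF X s t] \<omega>_vscale_left[OF V_vector_field[OF s t] h X]
      by (simp add: fun_eq_iff)
  qed
  show "nabla X ((h \<circ> p) * s) = (X h \<circ> p) * s + (h \<circ> p) * nabla X s"
  proof (rule cosection_eqI)
    fix t assume t: "t \<in> cosections"
    note pr = pairing[OF s t]
    have "\<omega> X (V ((h \<circ> p) * s) t) = h * \<omega> X (V s t) + (\<lambda>_. \<i>) * descend (t * s) * \<omega> X (ham h)"
      using \<omega>_add_right[OF X] \<omega>_vscale_right[OF X] h s t X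
      by (simp add: V_mult vector_fields_vscale[OF AM] V_vector_field C_inf_cmult[OF AM] pr(1) ham_vf)
    \<comment> \<open>This sign and the two factors \<i>, one from \<open>V_mult\<close> and one
      from \<open>nabla\<close>, multiply to 1, so the extra term is \<open>X h\<close>
      itself.\<close>
    also have "\<omega> X (ham h) = - X h"
      using form2_antisym[OF AM \<omega> X ham_vf[OF h]] \<omega>_ham[OF h X] by simp
    finally have eq: "\<omega> X (V ((h \<circ> p) * s) t) =
        h * \<omega> X (V s t) + (\<lambda>_. \<i>) * descend (t * s) * - X h" .
    have "t * nabla X ((h \<circ> p) * s) =
        (h \<circ> p) * ((\<lambda>_. \<i>) * (\<omega> X (V s t) \<circ> p)) + (descend (t * s) \<circ> p) * (X h \<circ> p)"
      unfolding nabla_cosection[OF X sections_mult[OF h s] t] eq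
      by (simp add: fun_eq_iff algebra_simps)
    then show "t * nabla X ((h \<circ> p) * s) = t * ((X h \<circ> p) * s + (h \<circ> p) * nabla X s)"
      unfolding nabla_cosection[OF X s t, symmetric] pr(2) by (simp add: algebra_simps)
  qed
next
  fix X s s' assume X: "X \<in> vector_fields AM" and s: "s \<in> sections" and s': "s' \<in> sections"
  show "nabla X (s + s') = nabla X s + nabla X s'"
  proof (rule cosection_eqI)
    fix t assume t: "t \<in> cosections"
    show "t * nabla X (s + s') = t * (nabla X s + nabla X s')"
      unfolding distrib_left nabla_cosection[OF X sections_add[OF s s'] t]
        nabla_cosection[OF X s t] nabla_cosection[OF X s' t] V_add[OF s s' t]
        \<omega>_add_right[OF X V_vector_field[OF s t] V_vector_field[OF s' t]]
      by (simp add: fun_eq_iff algebra_simps)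
  qed
qed

text \<open>For a Hamiltonian field, \<omega> evaluates \<open>V s t\<close> on \<open>a\<close>,
  which is the contraction of \<open>D a s\<close> with \<open>t\<close>.\<close>

lemma nabla_ham:
  assumes a: "a \<in> C_inf AM" and s: "s \<in> sections"
  shows "nabla (ham a) s = (\<lambda>_. \<i>) * P.D a s"
proof (rule cosection_eqI)
  fix t assume t: "t \<in> cosections"
  show "t * nabla (ham a) s = t * ((\<lambda>_. \<i>) * P.D a s)"
    unfolding nabla_cosection[OF ham_vf[OF a] s t] \<omega>_ham[OF a V_vector_field[OF s t]]
      V_pullback[OF s t a] by (simp add: mult.left_commute)
qed

section \<open>Flatness, first for Hamiltonian and then for all vector fields\<close>

lemma lie_bracket_ham:
  assumes a: "a \<in> C_inf AM" and b: "b \<in> C_inf AM"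
  shows "lie_bracket (ham a) (ham b) = vscale (\<lambda>_. \<i>) (ham (br a b))"
proof
  fix c
  have i2: "(\<lambda>_. \<i>) * ((\<lambda>_. \<i>) * f) = - f" for f :: "'m \<Rightarrow> complex" by (simp add: fun_eq_iff)
  show "lie_bracket (ham a) (ham b) c = vscale (\<lambda>_. \<i>) (ham (br a b)) c"
  proof (cases "c \<in> C_inf AM")
    case False
    then show ?thesis
      using vf_outside[OF ham_vf[OF a]] vf_outside[OF ham_vf[OF b]] vf_zero[OF AM ham_vf[OF a]]
        vf_zero[OF AM ham_vf[OF b]] vf_outside[OF ham_vf[OF P.br_closed[OF a b]]]
      by (simp add: lie_bracket_def vscale_apply)
  next
    case c: True
    have ham_eq: "ham x y = (\<lambda>_. \<i>) * br x y" if "x \<in> C_inf AM" "y \<in> C_inf AM" for x y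
      using br_ham[OF that] i2[of "ham x y"] br_antisym[of x y] by simp
    \<comment> \<open>Two Hamiltonian fields contribute \<i> * \<i> = -1, so the commutator is minus
      a double bracket. By the Jacobi identity it is \<open>- br (br a b) c\<close>, which is \<i>
      times \<open>ham (br a b) c\<close>.\<close>
    have twice: "ham x (ham y c) = - br x (br y c)" if "x \<in> C_inf AM" "y \<in> C_inf AM" for x y
      using that c vf_cmult[OF ham_vf[OF that(1)], of "br y c" \<i>]
      by (simp add: ham_eq P.br_closed i2)
    show ?thesis
      using br_jacobi[OF a b c, symmetric] twice[OF a b] twice[OF b a] ham_eq[OF P.br_closed[OF a b] c]
      by (simp add: lie_bracket_def vscale_apply i2)
  qed
qed

text \<open>Both the commutator of the covariant derivatives and the derivative along the Lie
  bracket come out as \<open>- P.D (br a b) s\<close>: the former by \<open>D_commutator\<close> and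
  \<i> * \<i> = -1, the latter by \<open>lie_bracket_ham\<close>.\<close>

lemma curv_ham:
  assumes a: "a \<in> C_inf AM" and b: "b \<in> C_inf AM" and s: "s \<in> sections"
  shows "curv nabla (ham a) (ham b) s = 0"
proof -
  have i2: "(\<lambda>_. \<i>) * ((\<lambda>_. \<i>) * f) = - f" for f :: "'p \<Rightarrow> complex" by (simp add: fun_eq_iff)
  have s': "s \<in> C_inf AP" using s by (simp add: sections_iff)
  have "nabla (ham a) (nabla (ham b) s) = - P.D a (P.D b s)" if a: "a \<in> C_inf AM" and b: "b \<in> C_inf AM" for a b
  proof -
    have Db: "P.D b s \<in> sections" by (rule D_sections[OF b s])
    have eq: "(\<lambda>_. \<i>) * P.D b s = ((\<lambda>_. \<i>) \<circ> p) * P.D b s" by (simp add: comp_def)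
    have "nabla (ham a) ((\<lambda>_. \<i>) * P.D b s) = (\<lambda>_. \<i>) * nabla (ham a) (P.D b s)"
      unfolding eq nabla_leibniz[OF connection_nabla C_inf_const[OF AM] ham_vf[OF a] Db]
      by (simp add: vf_const[OF AM ham_vf[OF a]] fun_eq_iff)
    then show ?thesis by (simp add: nabla_ham[OF b s] nabla_ham[OF a Db] i2)
  qed
  note this[OF a b] this[OF b a]
  moreover have "nabla (lie_bracket (ham a) (ham b)) s = ((\<lambda>_. \<i>) \<circ> p) * nabla (ham (br a b)) s"
    unfolding lie_bracket_ham[OF a b]
    by (rule nabla_vscale[OF connection_nabla C_inf_const[OF AM] ham_vf[OF P.br_closed[OF a b]] s])
  then have "nabla (lie_bracket (ham a) (ham b)) s = - P.D (br a b) s"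
    by (simp add: nabla_ham[OF P.br_closed[OF a b] s] comp_def i2)
  ultimately show ?thesis
    using P.D_commutator[OF a b s'] by (simp add: curv_def algebra_simps)
qed

text \<open>Linearity over functions reduces the claim to showing that, near a given point, vector
  fields are generated by Hamiltonian ones. Since \<sigma> is non-zero only near that point, the
  conclusion is drawn pointwise.\<close>

lemma vanish_on_ham:
  fixes K :: "'m vfield \<Rightarrow> ('p \<Rightarrow> complex)"
  assumes add: "\<And>X Y. X \<in> vector_fields AM \<Longrightarrow> Y \<in> vector_fields AM \<Longrightarrow> K (X + Y) = K X + K Y"
    and scale: "\<And>h X. h \<in> C_inf AM \<Longrightarrow> X \<in> vector_fields AM \<Longrightarrow> K (vscale h X) = (h \<circ> p) * K X"
    and ham0: "\<And>a. a \<in> C_inf AM \<Longrightarrow> K (ham a) = 0"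
    and X: "X \<in> vector_fields AM"
  shows "K X = 0"
proof
  fix y
  obtain \<sigma> and I :: "'e set" and x E where dual: "\<sigma> \<in> C_inf AM" "\<sigma> (p y) \<noteq> 0" "finite I"
    "\<And>i. i \<in> I \<Longrightarrow> x i \<in> C_inf AM" "\<And>i. i \<in> I \<Longrightarrow> E i \<in> vector_fields AM"
    "\<And>Y f. Y \<in> vector_fields AM \<Longrightarrow> f \<in> C_inf AM \<Longrightarrow> \<sigma> * Y f = (\<Sum>i\<in>I. Y (x i) * E i f)"
    using vector_fields_dual_basis[OF bundle_charts(5)[OF pb], of "p y"] by blast
  have coef: "\<omega> X (E i) \<in> C_inf AM" if "i \<in> I" for i using \<omega>_C_inf[OF X dual(5)[OF that]] .
  let ?Z = "\<lambda>i. vscale (\<omega> X (E i)) (ham (x i))"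
  have Z: "?Z i \<in> vector_fields AM" if "i \<in> I" for i
    by (intro vector_fields_vscale[OF AM] coef ham_vf dual(4) that)
  \<comment> \<open>The dual basis transposed by \<omega>: evaluating \<omega>(X, \<sigma> W) on
    \<sigma> W = \<Sum> W(x_i) E_i gives \<Sum> \<omega>(X, E_i) W(x_i), and W(x_i) is \<omega>(ham
    x_i, W). Non-degeneracy removes \<open>W\<close>.\<close>
  have "vscale \<sigma> X = sum ?Z I"
  proof (rule nondegenerate)
    fix W assume W: "W \<in> vector_fields AM"
    have "vscale \<sigma> W = (\<Sum>i\<in>I. vscale (W (x i)) (E i))"
    proof
      fix f
      show "vscale \<sigma> W f = (\<Sum>i\<in>I. vscale (W (x i)) (E i)) f"
        using dual(6)[OF W, of f] vf_outside[OF W, of f] vf_outside[OF dual(5), of _ f]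
        by (cases "f \<in> C_inf AM") (simp_all add: vscale_apply sum_fun_apply)
    qed
    then have "\<sigma> * \<omega> X W = \<omega> X (\<Sum>i\<in>I. vscale (W (x i)) (E i))"
      using \<omega>_vscale_right[OF X dual(1) W] by simp
    also have "\<dots> = (\<Sum>i\<in>I. W (x i) * \<omega> X (E i))"
      using W dual(4,5)
      by (simp add: form1_sum[OF AM \<omega>_right[OF X]] \<omega>_vscale_right[OF X] vector_fields_vscale[OF AM] vf_C_inf)
    also have "\<dots> = (\<Sum>i\<in>I. \<omega> (?Z i) W)"
      by (rule sum.cong) (simp_all add: \<omega>_vscale_left[OF W] coef ham_vf \<omega>_ham W dual(4) mult.commute)
    also have "\<dots> = \<omega> (sum ?Z I) W"
      by (rule form1_sum[OF AM \<omega>_left[OF W] Z, symmetric])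
    finally show "\<omega> (vscale \<sigma> X) W = \<omega> (sum ?Z I) W"
      using \<omega>_vscale_left[OF W dual(1) X] by simp
  qed (rule vector_fields_vscale[OF AM dual(1) X], rule vector_fields_sum[OF AM Z])
  then have "(\<sigma> \<circ> p) * K X = K (sum ?Z I)" using scale[OF dual(1) X] by simp
  also have "\<dots> = (\<Sum>i\<in>I. K (?Z i))"
  proof -
    have "K 0 = 0" using add[OF zero_vector_field[OF AM] zero_vector_field[OF AM]] by simp
    have "K (sum ?Z J) = (\<Sum>i\<in>J. K (?Z i))" if "finite J" "J \<subseteq> I" for J
      using that
    proof (induction J rule: finite_induct)
      case empty
      show ?case unfolding sum.empty by (rule \<open>K 0 = 0\<close>)
    next
      case (insert i J)
      have "sum ?Z J \<in> vector_fields AM"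
        by (rule vector_fields_sum[OF AM]) (use insert.prems Z in blast)
      then have "K (?Z i + sum ?Z J) = K (?Z i) + (\<Sum>i\<in>J. K (?Z i))"
        using insert.prems insert.IH add[OF Z] by simp
      then show ?case unfolding sum.insert[OF insert.hyps(1,2)] .
    qed
    then show ?thesis using dual(3) by blast
  qed
  also have "\<dots> = 0"
    by (rule sum.neutral) (simp add: scale coef ham_vf dual(4) ham0)
  finally have "\<sigma> (p y) * K X y = 0" by (auto dest: fun_cong[where x = y])
  then show "K X y = 0 y" using dual(2) by simp
qed

text \<open>\<open>vanish_on_ham\<close> is applied twice to the first slot: once with a Hamiltonian
  field in the second, and, after exchanging the slots by antisymmetry, with an arbitrary
  one.\<close>

lemma curv_zero:
  assumes X: "X \<in> vector_fields AM" and Y: "Y \<in> vector_fields AM" and s: "s \<in> sections"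
  shows "curv nabla X Y s = 0"
proof -
  note con = connection_nabla
  have 1: "curv nabla X (ham b) s = 0" if X: "X \<in> vector_fields AM" and b: "b \<in> C_inf AM" for X b
    by (rule vanish_on_ham[where K = "\<lambda>X. curv nabla X (ham b) s", OF _ _ _ X])
      (simp_all add: curv_add[OF con] curv_vscale[OF con] curv_ham ham_vf b s)
  have "curv nabla (ham a) Y s = 0" if a: "a \<in> C_inf AM" for a
    using 1[OF Y a] curv_antisym[OF con ham_vf[OF a] Y s] by simp
  then show ?thesis
    by (intro vanish_on_ham[where K = "\<lambda>X. curv nabla X Y s", OF _ _ _ X])
      (simp_all add: curv_add[OF con] curv_vscale[OF con] Y s)
qed

lemma chern_class1_zero: "chern_class1 AM AP p act \<kappa> = de_rham_class AM 0"
  by (rule flat_chern_class1[OF connection_nabla curv_zero])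

end

theorem corollary6p7:
  fixes AM :: "('m::{t2_space, second_countable_topology}, 'e::{real_inner, heine_borel}) atlas"
    and AP :: "('p::{t2_space, second_countable_topology}, 'q::{real_inner, heine_borel}) atlas"
    and AG :: "('g::{t2_space, second_countable_topology}, 'k::{real_inner, heine_borel}) atlas"
    and gmul :: "'g \<Rightarrow> 'g \<Rightarrow> 'g" and e :: 'g and iv :: "'g \<Rightarrow> 'g"
    and p :: "'p \<Rightarrow> 'm" and act :: "'p \<Rightarrow> 'g \<Rightarrow> 'p"
    and \<omega> :: "'m form2"
    and C :: "nat \<Rightarrow> ('m \<Rightarrow> complex) \<Rightarrow> ('m \<Rightarrow> complex) \<Rightarrow> ('m \<Rightarrow> complex)"
  assumes "smooth_manifold AM" and "symplectic_form AM \<omega>"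
    and "principal_bundle AM AP AG gmul e iv p act"
    and "sufficiently_nontrivial AM AP AG gmul e p act"
    and "symplectic_star_product AM C"
  shows "\<not> (\<exists>l \<rho>. invariant_bimodule_deformation AM AP p act C l \<rho>)"
proof
  assume "\<exists>l \<rho>. invariant_bimodule_deformation AM AP p act C l \<rho>"
  then obtain l \<rho> where def: "invariant_bimodule_deformation AM AP p act C l \<rho>" by blast
  obtain \<kappa> where \<kappa>: "representation_on_C AG gmul e \<kappa>"
    "chern_class1 AM AP p act \<kappa> \<noteq> de_rham_class AM 0"
    using assms(4) by (auto simp: sufficiently_nontrivial_def)
  \<comment> \<open>The connection is built from \<omega>', the symplectic form whose Poisson
    bracket the star product induces.\<close>
  obtain \<omega>' where \<omega>': "symplectic_form AM \<omega>'"
    "poisson_bracket_of AM \<omega>' (\<lambda>a b. (\<lambda>_. 1 / \<i>) * (C 1 a b - C 1 b a))" and star: "star_product AM C"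
    using assms(5) by (auto simp: symplectic_star_product_def)
  interpret invariant_deformation AM AP AG gmul e iv p act \<kappa> \<omega>' C l \<rho>
    by unfold_locales (rule assms(3) \<kappa>(1) \<omega>' star def)+
  show False using chern_class1_zero \<kappa>(2) by contradiction
qed

end
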